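(* Let $m\ge1$, let $0\neq w\in\bigotimes^3\mathbb{C}^m$ be a polystable tensor, let $Gw$ be its $\mathrm{GL}_m^3$-orbit and $\Phi_w$ its fundamental invariant. (1) The zero set of $\Phi_w$ in $\overline{Gw}$ equals the boundary $\overline{Gw}\setminus Gw$. (2) The coordinate ring $\mathcal{O}(Gw)$ of the orbit equals the localization of the coordinate ring $\mathcal{O}(\overline{Gw})$ of the orbit closure with respect to $\Phi_w$. (3) If $m\,a(w)<e(w)$, then the vanishing ideal of the boundary $\overline{Gw}\setminus Gw$ in $\mathcal{O}(\overline{Gw})$ is strictly larger than the principal ideal $\Phi_w\mathcal{O}(\overline{Gw})$. Moreover, $\overline{Gw}$ is then not a normal algebraic variety. In particular, $\mathcal{O}(\overline{Gw})$ is not a valuation ring.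
   Context: Work over $\mathbb{C}$. $\mathrm{GL}_m^3$ acts on $\bigotimes^3\mathbb{C}^m$ by $(g_1,g_2,g_3)w=(g_1\otimes g_2\otimes g_3)w$. A tensor is polystable if its $\mathrm{SL}_m^3$-orbit is closed. $\mathrm{stab}(w)$ is the stabilizer of $w$ in $\mathrm{GL}_m^3$ and $\chi(g_1,g_2,g_3)=\det(g_1)\det(g_2)\det(g_3)$; for nonzero polystable $w$ the group $\chi(\mathrm{stab}(w))\subseteq\mathbb{C}^\times$ is finite and the stabilizer period $a(w)$ is its order. $\mathcal{O}(\overline{Gw})^{\mathrm{SL}_m^3}_d$ is the space of $\mathrm{SL}_m^3$-invariant regular functions on the orbit closure $\overline{Gw}$ homogeneous of degree $d$; for nonzero polystable $w$ it is at most one-dimensional, nonzero for some $d>0$, and zero unless $d$ is a multiple of $m\,a(w)$. The minimal degree $e(w)$ is the smallest positive $d$ with $\mathcal{O}(\overline{Gw})^{\mathrm{SL}_m^3}_d\ne0$ (the condition $m\,a(w)<e(w)$ is equivalent to $e'(w):=e(w)/(m\,a(w))>1$). The fundamental invariant $\Phi_w$ is the unique element of $\mathcal{O}(\overline{Gw})^{\mathrm{SL}_m^3}_{e(w)}$ with $\Phi_w(w)=1$. *)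

theory Defs
  imports "HOL-Analysis.Determinants" "HOL-Algebra.QuotRing" "HOL-Algebra.Polynomials"
begin

section \<open>Commutative algebra\<close>

text \<open>
  The ring of fractions of a commutative ring \<open>R\<close> with respect to a multiplicative set \<open>S\<close>.
  The class of \<open>(a, s)\<close> is the fraction \<open>a / s\<close>; the extra factor \<open>u\<close> is needed when \<open>S\<close>
  contains zero divisors.
\<close>

definition frac_rel :: "('a, 'b) ring_scheme \<Rightarrow> 'a set \<Rightarrow> (('a \<times> 'a) \<times> ('a \<times> 'a)) set" where
  "frac_rel R S = {((a, s), (b, t)). a \<in> carrier R \<and> b \<in> carrier R \<and> s \<in> S \<and> t \<in> S \<and>
     (\<exists>u\<in>S. u \<otimes>\<^bsub>R\<^esub> (t \<otimes>\<^bsub>R\<^esub> a) = u \<otimes>\<^bsub>R\<^esub> (s \<otimes>\<^bsub>R\<^esub> b))}"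

definition fraction :: "('a, 'b) ring_scheme \<Rightarrow> 'a set \<Rightarrow> 'a \<Rightarrow> 'a \<Rightarrow> ('a \<times> 'a) set" where
  "fraction R S a s = frac_rel R S `` {(a, s)}"

definition localization :: "('a, 'b) ring_scheme \<Rightarrow> 'a set \<Rightarrow> (('a \<times> 'a) set) ring" where
  "localization R S =
     \<lparr> carrier = (carrier R \<times> S) // frac_rel R S,
       mult = (\<lambda>A B. \<Union>(a, s)\<in>A. \<Union>(b, t)\<in>B. fraction R S (a \<otimes>\<^bsub>R\<^esub> b) (s \<otimes>\<^bsub>R\<^esub> t)),
       one = fraction R S \<one>\<^bsub>R\<^esub> \<one>\<^bsub>R\<^esub>,
       zero = fraction R S \<zero>\<^bsub>R\<^esub> \<one>\<^bsub>R\<^esub>,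
       add = (\<lambda>A B. \<Union>(a, s)\<in>A. \<Union>(b, t)\<in>B.
                fraction R S ((a \<otimes>\<^bsub>R\<^esub> t) \<oplus>\<^bsub>R\<^esub> (b \<otimes>\<^bsub>R\<^esub> s)) (s \<otimes>\<^bsub>R\<^esub> t)) \<rparr>"

definition powers :: "('a, 'b) ring_scheme \<Rightarrow> 'a \<Rightarrow> 'a set" where
  "powers R a = {a [^]\<^bsub>R\<^esub> n | n :: nat. True}"

definition fraction_field :: "('a, 'b) ring_scheme \<Rightarrow> (('a \<times> 'a) set) ring" where
  "fraction_field R = localization R (carrier R - {\<zero>\<^bsub>R\<^esub>})"

definition embedded_ring :: "('a, 'b) ring_scheme \<Rightarrow> ('a \<times> 'a) set set" where
  "embedded_ring R = (\<lambda>a. fraction R (carrier R - {\<zero>\<^bsub>R\<^esub>}) a \<one>\<^bsub>R\<^esub>) ` carrier R"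

definition integral_over :: "('a, 'b) ring_scheme \<Rightarrow> 'a set \<Rightarrow> 'a \<Rightarrow> bool" where
  "integral_over L K x \<longleftrightarrow>
     (\<exists>p. polynomial\<^bsub>L\<^esub> K p \<and> p \<noteq> [] \<and> lead_coeff p = \<one>\<^bsub>L\<^esub> \<and> ring.eval L p x = \<zero>\<^bsub>L\<^esub>)"

definition integrally_closed_domain :: "('a, 'b) ring_scheme \<Rightarrow> bool" where
  "integrally_closed_domain R \<longleftrightarrow> domain R \<and>
     (\<forall>x\<in>carrier (fraction_field R).
        integral_over (fraction_field R) (embedded_ring R) x \<longrightarrow> x \<in> embedded_ring R)"

definition valuation_ring :: "('a, 'b) ring_scheme \<Rightarrow> bool" where
  "valuation_ring R \<longleftrightarrow> domain R \<and>
     (\<forall>x\<in>carrier (fraction_field R) - {\<zero>\<^bsub>fraction_field R\<^esub>}.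
        x \<in> embedded_ring R \<or> inv\<^bsub>fraction_field R\<^esub> x \<in> embedded_ring R)"


section \<open>Affine varieties in complex affine space\<close>

inductive_set poly_fun :: "(complex ^ 'n \<Rightarrow> complex) set" where
  const: "(\<lambda>x. c) \<in> poly_fun"
| coord: "(\<lambda>x. x $ i) \<in> poly_fun"
| add: "p \<in> poly_fun \<Longrightarrow> q \<in> poly_fun \<Longrightarrow> (\<lambda>x. p x + q x) \<in> poly_fun"
| mult: "p \<in> poly_fun \<Longrightarrow> q \<in> poly_fun \<Longrightarrow> (\<lambda>x. p x * q x) \<in> poly_fun"

definition zariski_closed :: "(complex ^ 'n) set \<Rightarrow> bool" where
  "zariski_closed Z \<longleftrightarrow> (\<exists>P\<subseteq>poly_fun. Z = {x. \<forall>p\<in>P. p x = 0})"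

abbreviation zariski_closure :: "(complex ^ 'n) set \<Rightarrow> (complex ^ 'n) set" where
  "zariski_closure S \<equiv> zariski_closed hull S"

text \<open>
  Functions on a set \<open>V\<close> are represented by extensional functions, so that two
  functions are equal iff they agree on \<open>V\<close>.
\<close>

definition function_ring :: "'a set \<Rightarrow> ('a \<Rightarrow> complex) set \<Rightarrow> ('a \<Rightarrow> complex) ring" where
  "function_ring V F =
     \<lparr> carrier = F,
       mult = (\<lambda>f g. \<lambda>x\<in>V. f x * g x),
       one = (\<lambda>x\<in>V. 1),
       zero = (\<lambda>x\<in>V. 0),
       add = (\<lambda>f g. \<lambda>x\<in>V. f x + g x) \<rparr>"

definition coord_ring :: "(complex ^ 'n) set \<Rightarrow> (complex ^ 'n \<Rightarrow> complex) ring" where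
  "coord_ring V = function_ring V ((\<lambda>p. restrict p V) ` poly_fun)"

text \<open>
  \<open>coord_ring\<close> is meant for Zariski closed sets, where every regular function is the restriction
  of a polynomial. On a set \<open>Y\<close> that is only locally closed, such as an orbit, a regular function
  is Zariski locally a quotient of polynomials.
\<close>

definition regular_fun :: "(complex ^ 'n) set \<Rightarrow> (complex ^ 'n \<Rightarrow> complex) set" where
  "regular_fun Y = {f \<in> extensional Y. \<forall>x\<in>Y. \<exists>U. zariski_closed (- U) \<and> x \<in> U \<and>
     (\<exists>p\<in>poly_fun. \<exists>q\<in>poly_fun. \<forall>y\<in>U \<inter> Y. q y \<noteq> 0 \<and> f y = p y / q y)}"

definition regular_ring :: "(complex ^ 'n) set \<Rightarrow> (complex ^ 'n \<Rightarrow> complex) ring" where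
  "regular_ring Y = function_ring Y (regular_fun Y)"

definition vanishing_ideal ::
  "(complex ^ 'n) set \<Rightarrow> (complex ^ 'n) set \<Rightarrow> (complex ^ 'n \<Rightarrow> complex) set" where
  "vanishing_ideal V B = {f \<in> carrier (coord_ring V). \<forall>x\<in>B. f x = 0}"

definition local_ring ::
  "(complex ^ 'n) set \<Rightarrow> complex ^ 'n \<Rightarrow>
     (((complex ^ 'n \<Rightarrow> complex) \<times> (complex ^ 'n \<Rightarrow> complex)) set) ring" where
  "local_ring V x = localization (coord_ring V) {f \<in> carrier (coord_ring V). f x \<noteq> 0}"

definition normal_variety :: "(complex ^ 'n) set \<Rightarrow> bool" where
  "normal_variety V \<longleftrightarrow> (\<forall>x\<in>V. integrally_closed_domain (local_ring V x))"


section \<open>Tensors of order three and their orbits\<close>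

text \<open>
  With \<open>m = CARD('m)\<close>, the entry \<open>w $ (i, j, k)\<close> is the coefficient of
  \<open>e\<^sub>i \<otimes> e\<^sub>j \<otimes> e\<^sub>k\<close> in \<open>w\<close>.
\<close>

type_synonym 'm tensor = "complex ^ ('m \<times> 'm \<times> 'm)"
type_synonym 'm mat = "complex ^ 'm ^ 'm"
type_synonym 'm triple = "'m mat \<times> 'm mat \<times> 'm mat"

definition kronecker3 ::
  "'m::finite mat \<Rightarrow> 'm mat \<Rightarrow> 'm mat \<Rightarrow> complex ^ ('m \<times> 'm \<times> 'm) ^ ('m \<times> 'm \<times> 'm)" where
  "kronecker3 A B C = (\<chi> r c. case r of (i, j, k) \<Rightarrow> case c of (i', j', k') \<Rightarrow>
     A $ i $ i' * B $ j $ j' * C $ k $ k')"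

definition act :: "'m::finite triple \<Rightarrow> 'm tensor \<Rightarrow> 'm tensor" where
  "act g w = (case g of (g1, g2, g3) \<Rightarrow> kronecker3 g1 g2 g3 *v w)"

definition GL3 :: "'m::finite triple set" where
  "GL3 = {g. invertible g} \<times> {g. invertible g} \<times> {g. invertible g}"

definition SL3 :: "'m::finite triple set" where
  "SL3 = {g. det g = 1} \<times> {g. det g = 1} \<times> {g. det g = 1}"

definition orbit :: "'m::finite tensor \<Rightarrow> 'm tensor set" where
  "orbit w = (\<lambda>g. act g w) ` GL3"

abbreviation orbit_closure :: "'m::finite tensor \<Rightarrow> 'm tensor set" where
  "orbit_closure w \<equiv> zariski_closure (orbit w)"

definition boundary :: "'m::finite tensor \<Rightarrow> 'm tensor set" where
  "boundary w = orbit_closure w - orbit w"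

definition polystable :: "'m::finite tensor \<Rightarrow> bool" where
  "polystable w \<longleftrightarrow> zariski_closed ((\<lambda>g. act g w) ` SL3)"

definition stab :: "'m::finite tensor \<Rightarrow> 'm triple set" where
  "stab w = {g \<in> GL3. act g w = w}"

definition det_char :: "'m::finite triple \<Rightarrow> complex" where
  "det_char g = (case g of (g1, g2, g3) \<Rightarrow> det g1 * det g2 * det g3)"

definition stab_period :: "'m::finite tensor \<Rightarrow> nat" where
  "stab_period w = card (det_char ` stab w)"

text \<open>
  For \<open>w \<noteq> 0\<close> the orbit closure is a cone, so \<open>f (c *s x)\<close> below only evaluates \<open>f\<close> on its domain.
\<close>

definition invariants :: "'m::finite tensor \<Rightarrow> nat \<Rightarrow> ('m tensor \<Rightarrow> complex) set" where
  "invariants w d = {f \<in> carrier (coord_ring (orbit_closure w)).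
     (\<forall>g\<in>SL3. \<forall>x\<in>orbit_closure w. f (act g x) = f x) \<and>
     (\<forall>c. \<forall>x\<in>orbit_closure w. f (c *s x) = c ^ d * f x)}"

definition minimal_degree :: "'m::finite tensor \<Rightarrow> nat" where
  "minimal_degree w =
     (LEAST d. d > 0 \<and> invariants w d \<noteq> {\<zero>\<^bsub>coord_ring (orbit_closure w)\<^esub>})"

definition fundamental_invariant :: "'m::finite tensor \<Rightarrow> 'm tensor \<Rightarrow> complex" where
  "fundamental_invariant w = (THE f. f \<in> invariants w (minimal_degree w) \<and> f w = 1)"

end

theory Submission
  imports Defs "HOL-Computational_Algebra.Fundamental_Theorem_Algebra"
    "HOL-Analysis.Continuum_Not_Denumerable" "HOL-Analysis.Complex_Transcendental"
begin

text \<open>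
  Let \<open>V\<close> be the orbit of \<open>w\<close> under \<open>SL3\<close>, which is closed because \<open>w\<close> is polystable and misses the
  origin because \<open>w \<noteq> 0\<close>. An invertible complex matrix is a scalar times a matrix of determinant
  one, so the orbit of \<open>w\<close> is the cone of all \<open>c *s v\<close> with \<open>c \<noteq> 0\<close> and \<open>v \<in> V\<close>
  (\<open>orbit_eq_cone\<close>). Invariant homogeneous functions are therefore determined by their degree \<open>d\<close>:
  up to a factor they are \<open>c *s v \<mapsto> c ^ d\<close>, and \<open>has_degree d\<close> says that this function extends to a
  polynomial.

  Some positive degree occurs (\<open>exists_invariant_form\<close>). Take a polynomial that is \<open>1\<close> on \<open>V\<close>
  and \<open>0\<close> at the origin and subtract from it its orthogonal projection to the polynomials that
  vanish on \<open>V\<close> and at the origin. For the standard hermitian product on coefficient tensors the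
  adjoint of a substitution \<open>M\<close> is the substitution of the conjugate transpose of \<open>M\<close>, and \<open>SL3\<close> is
  stable under conjugate transposition, so the difference is invariant. One of its homogeneous
  components of positive degree does not vanish at \<open>w\<close>.

  For the first claim, sort the homogeneous components of a polynomial \<open>p\<close> by their degree modulo
  \<open>e\<close>, the degree of \<open>\<Phi>\<close>, and make each class homogeneous by multiplying with powers of \<open>\<Phi>\<close>
  (\<open>residue_part\<close>). On the cone the result is an average of \<open>p\<close> over the \<open>e\<close>-th roots of unity. If
  \<open>\<Phi> x = 1\<close> and \<open>x\<close> is not in the orbit, some \<open>p\<close> vanishes on \<open>\<zeta> V\<close> for all \<open>e\<close>-th roots of unity
  \<open>\<zeta>\<close> but not at \<open>x\<close>; one of its classes then vanishes on the orbit but not at \<open>x\<close>, so \<open>x\<close> is not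
  in the closure (\<open>closure_nonzero_in_cone\<close>).

  So the orbit is the principal open subset of its closure where \<open>\<Phi> \<noteq> 0\<close>, and the second claim is
  the Nullstellensatz for such sets: the denominators of a regular function generate the unit
  ideal of the ring of all \<open>p / \<Phi> ^ n\<close> (\<open>regular_fun_eq_fraction\<close>). It holds because this ring has
  countable dimension over the uncountable field of complex numbers.

  For the third claim put \<open>k = m a(w)\<close>. A scalar \<open>c\<close> that moves a point of \<open>V\<close> into \<open>V\<close>
  satisfies \<open>c ^ k = 1\<close> (\<open>slice_scalars\<close>), so \<open>c *s v \<mapsto> c ^ k\<close> is a well defined function on the
  orbit. Locally it is a quotient of two residue parts of one polynomial, hence it is regular and
  has the form \<open>p / \<Phi> ^ n\<close> (\<open>exists_semi_invariant\<close>). Its \<open>e\<close>-th power is \<open>\<Phi> ^ k\<close>, so it is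
  integral over the coordinate ring. If it were in the local ring at the origin, taking the
  component of degree \<open>k\<close> would show \<open>has_degree k\<close>, which is impossible when \<open>k < e\<close>. Its
  inverse has negative degree, so the coordinate ring is not a valuation ring either.
  Finally \<open>k + e n\<close> is a degree that is not a multiple of \<open>e\<close>; the invariant of the smallest such
  degree vanishes on the boundary, and its quotient by \<open>\<Phi>\<close> would have a smaller degree of the same
  kind (\<open>vanishing_ideal_not_principal\<close>).
\<close>

section \<open>Polynomial functions and their coefficients\<close>

lemma poly_fun_sum: "(\<And>i. i \<in> A \<Longrightarrow> f i \<in> poly_fun) \<Longrightarrow> (\<lambda>x. \<Sum>i\<in>A. f i x) \<in> poly_fun"
  by (induction A rule: infinite_finite_induct) (auto intro: poly_fun.intros)

lemma poly_fun_prod: "(\<And>i. i \<in> A \<Longrightarrow> f i \<in> poly_fun) \<Longrightarrow> (\<lambda>x. \<Prod>i\<in>A. f i x) \<in> poly_fun"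
  by (induction A rule: infinite_finite_induct) (auto intro: poly_fun.intros)

lemma poly_fun_power: "p \<in> poly_fun \<Longrightarrow> (\<lambda>x. p x ^ n) \<in> poly_fun"
  by (induction n) (auto intro: poly_fun.intros)

lemma poly_fun_cmult: "p \<in> poly_fun \<Longrightarrow> (\<lambda>x. c * p x) \<in> poly_fun"
  by (intro poly_fun.intros)

lemma poly_fun_diff: "p \<in> poly_fun \<Longrightarrow> q \<in> poly_fun \<Longrightarrow> (\<lambda>x. p x - q x) \<in> poly_fun"
  using poly_fun.add[of p "\<lambda>x. (-1) * q x"] poly_fun_cmult[of q "-1"] by simp

lemma poly_fun_compose_coords:
  assumes "p \<in> poly_fun" "\<And>i. (\<lambda>x. f x $ i) \<in> poly_fun"
  shows "(\<lambda>x. p (f x)) \<in> poly_fun"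
  using assms(1) by induction (auto intro: poly_fun.intros assms(2))

lemma poly_fun_matrix: "p \<in> poly_fun \<Longrightarrow> (\<lambda>x. p (M *v x)) \<in> poly_fun"
  by (rule poly_fun_compose_coords)
     (auto simp: matrix_vector_mult_def intro!: poly_fun_sum poly_fun_cmult poly_fun.coord)

lemma poly_fun_scale: "p \<in> poly_fun \<Longrightarrow> (\<lambda>x. p (c *s x)) \<in> poly_fun"
  by (rule poly_fun_compose_coords) (auto intro!: poly_fun_cmult poly_fun.coord)

definition monomial :: "'n list \<Rightarrow> complex ^ 'n::finite \<Rightarrow> complex" where
  "monomial I x = prod_list (map (\<lambda>i. x $ i) I)"

definition words :: "nat \<Rightarrow> 'n::finite list set" where
  "words D = {I. length I \<le> D}"

text \<open>
  A homogeneous polynomial is stored as a coefficient tensor indexed by words in the coordinates,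
  and different tensors may give the same polynomial. In exchange a linear substitution acts on
  the coefficients by a tensor power of its matrix, which makes its adjoint visible.
\<close>

definition form :: "nat \<Rightarrow> ('n::finite list \<Rightarrow> complex) \<Rightarrow> complex ^ 'n \<Rightarrow> complex" where
  "form d T x = (\<Sum>I | length I = d. T I * monomial I x)"

lemma finite_words [simp]: "finite (words D :: 'n::finite list set)"
  using finite_lists_length_le[of "UNIV :: 'n set" D] by (simp add: words_def)

lemma words_iff [simp]: "I \<in> words D \<longleftrightarrow> length I \<le> D"
  by (simp add: words_def)

lemma finite_words_eq [simp]: "finite {I :: 'n::finite list. length I = d}"
  using finite_lists_length_eq[of "UNIV :: 'n set" d] by simp

lemma monomial_simps [simp]:
  "monomial [] x = 1" "monomial (i # I) x = x $ i * monomial I x"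
  "monomial (I @ J) x = monomial I x * monomial J x"
  by (simp_all add: monomial_def)

lemma monomial_scale: "monomial I (c *s x) = c ^ length I * monomial I x"
  by (induction I) (auto simp: algebra_simps)

lemma monomial_poly_fun: "monomial I \<in> poly_fun"
proof (induction I)
  case Nil
  have "monomial [] = (\<lambda>x. 1)" by auto
  then show ?case by (simp add: poly_fun.const)
next
  case (Cons i I)
  have "monomial (i # I) = (\<lambda>x. x $ i * monomial I x)" by auto
  then show ?case using Cons by (simp add: poly_fun.coord poly_fun.mult)
qed

lemma form_poly_fun: "form d T \<in> poly_fun"
proof -
  have "form d T = (\<lambda>x. \<Sum>I | length I = d. T I * monomial I x)"
    by (auto simp: form_def)
  then show ?thesis
    by (auto intro!: poly_fun_sum poly_fun_cmult monomial_poly_fun)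
qed

lemma form_scale: "form d T (c *s x) = c ^ d * form d T x"
  by (auto simp: form_def monomial_scale sum_distrib_left algebra_simps intro!: sum.cong)

lemma form_0: "form 0 T x = T []"
  by (simp add: form_def)

lemma sum_words_eq_sum_form: "(\<Sum>I\<in>words D. T I * monomial I x) = (\<Sum>d\<le>D. form d T x)"
proof -
  have "(\<Sum>d\<le>D. form d T x) = (\<Sum>d\<in>{..D}. \<Sum>I\<in>{I. I \<in> words D \<and> length I = d}. T I * monomial I x)"
    unfolding form_def by (intro sum.cong) auto
  also have "\<dots> = (\<Sum>I\<in>words D. T I * monomial I x)"
    by (rule sum.group) auto
  finally show ?thesis ..
qed

definition word_sums :: "(complex ^ 'n::finite \<Rightarrow> complex) set" where
  "word_sums = {f. \<exists>D T. \<forall>x. f x = (\<Sum>I\<in>words D. T I * monomial I x)}"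

lemma word_sums_add:
  assumes "f \<in> word_sums" "g \<in> word_sums"
  shows "(\<lambda>x. f x + g x) \<in> word_sums"
proof -
  obtain D T E U where f: "\<And>x. f x = (\<Sum>I\<in>words D. T I * monomial I x)"
    and g: "\<And>x. g x = (\<Sum>I\<in>words E. U I * monomial I x)"
    using assms unfolding word_sums_def by blast
  have pad: "(\<Sum>I\<in>words k. V I * monomial I x) =
      (\<Sum>I\<in>words (max D E). (if I \<in> words k then V I else 0) * monomial I x)"
    if "k \<in> {D, E}" for k V and x :: "complex ^ 'a"
    by (intro sum.mono_neutral_cong_left) (use that in auto)
  have "f x + g x = (\<Sum>I\<in>words (max D E).
      ((if I \<in> words D then T I else 0) + (if I \<in> words E then U I else 0)) * monomial I x)" for x
    unfolding f g by (subst (1 2) pad) (auto simp: sum.distrib algebra_simps)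
  then show ?thesis unfolding word_sums_def by (intro CollectI exI allI)
qed

lemma word_sums_monomial: "(\<lambda>x. c * monomial I x) \<in> word_sums"
proof -
  have "c * monomial I x = (\<Sum>J\<in>words (length I). (if J = I then c else 0) * monomial J x)" for x
  proof -
    have "(\<Sum>J\<in>words (length I). (if J = I then c else 0) * monomial J x)
        = (\<Sum>J\<in>words (length I). if J = I then c * monomial I x else 0)"
      by (intro sum.cong) auto
    also have "\<dots> = c * monomial I x"
    proof -
      have "I \<in> words (length I)" by simp
      then show ?thesis by (simp add: sum.delta del: words_iff)
    qed
    finally show ?thesis ..
  qed
  then show ?thesis unfolding word_sums_def by (intro CollectI exI allI)
qed

lemma word_sums_sum: "(\<And>i. i \<in> A \<Longrightarrow> f i \<in> word_sums) \<Longrightarrow> (\<lambda>x. \<Sum>i\<in>A. f i x) \<in> word_sums"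
  using word_sums_monomial[of 0 "[]"]
  by (induction A rule: infinite_finite_induct) (auto intro: word_sums_add)

lemma poly_fun_word_sum:
  assumes "p \<in> poly_fun"
  obtains D T where "\<And>x. p x = (\<Sum>I\<in>words D. T I * monomial I x)"
proof -
  from assms have "p \<in> word_sums"
  proof induction
    case (const c)
    then show ?case using word_sums_monomial[of c "[]"] by simp
  next
    case (coord i)
    then show ?case using word_sums_monomial[of 1 "[i]"] by simp
  next
    case (add p q)
    then show ?case by (intro word_sums_add)
  next
    case (mult p q)
    obtain D T E U where p: "\<And>x. p x = (\<Sum>I\<in>words D. T I * monomial I x)"
      and q: "\<And>x. q x = (\<Sum>I\<in>words E. U I * monomial I x)"
      using mult unfolding word_sums_def by blast
    have "p x * q x = (\<Sum>I\<in>words D. \<Sum>J\<in>words E. (T I * U J) * monomial (I @ J) x)" for x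
      unfolding p q sum_product by (simp add: algebra_simps)
    then show ?case by (auto intro!: word_sums_sum word_sums_monomial simp del: monomial_simps)
  qed
  then show ?thesis using that unfolding word_sums_def by blast
qed

lemma poly_fun_forms:
  assumes "p \<in> poly_fun"
  obtains D T where "\<And>x. p x = (\<Sum>d\<le>D. form d T x)"
  using poly_fun_word_sum[OF assms] sum_words_eq_sum_form by metis

section \<open>Invariant forms\<close>

text \<open>
  Induction on the coordinates. The members of \<open>B\<close> that vanish at the new coordinate \<open>j\<close> have a
  projection by induction, and they have codimension at most one in \<open>B\<close>; one Gram-Schmidt step with
  some \<open>c \<in> B\<close>, \<open>c j \<noteq> 0\<close>, accounts for the remaining direction.
\<close>

lemma orthogonal_projection:
  fixes B :: "('i \<Rightarrow> complex) set"
  assumes "finite F" "(\<lambda>i. 0) \<in> B" "\<And>a b. a \<in> B \<Longrightarrow> b \<in> B \<Longrightarrow> (\<lambda>i. a i + b i) \<in> B"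
    and "\<And>c b. b \<in> B \<Longrightarrow> (\<lambda>i. c * b i) \<in> B"
  shows "\<exists>b\<in>B. \<forall>b'\<in>B. (\<Sum>i\<in>F. (T i - b i) * cnj (b' i)) = 0"
  using assms
proof (induction F arbitrary: B T)
  case empty
  then show ?case by auto
next
  case (insert j F)
  define B0 where "B0 = {b \<in> B. b j = 0}"
  have B0_proj: "\<exists>b\<in>B0. \<forall>b'\<in>B0. (\<Sum>i\<in>F. (U i - b i) * cnj (b' i)) = 0" for U
    by (rule insert.IH) (use insert.prems in \<open>auto simp: B0_def\<close>)
  have drop_j: "(\<Sum>i\<in>insert j F. h i * cnj (b' i)) = (\<Sum>i\<in>F. h i * cnj (b' i))" if "b' \<in> B0" for h b'
    using insert.hyps that by (simp add: B0_def)
  obtain b0 where b0: "b0 \<in> B0" "\<And>b'. b' \<in> B0 \<Longrightarrow> (\<Sum>i\<in>insert j F. (T i - b0 i) * cnj (b' i)) = 0"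
    using B0_proj[of T] drop_j[of _ "\<lambda>i. T i - b0 i" for b0] by metis
  show ?case
  proof (cases "B0 = B")
    case True
    then show ?thesis using b0 by auto
  next
    case False
    then obtain c where c: "c \<in> B" "c j \<noteq> 0" by (auto simp: B0_def)
    obtain c0 where c0: "c0 \<in> B0" "\<And>b'. b' \<in> B0 \<Longrightarrow> (\<Sum>i\<in>insert j F. (c i - c0 i) * cnj (b' i)) = 0"
      using B0_proj[of c] drop_j[of _ "\<lambda>i. c i - c0 i" for c0] by metis
    define c' where "c' = (\<lambda>i. c i - c0 i)"
    have c'j: "c' j = c j" using c0 by (simp add: c'_def B0_def)
    have c'B: "c' \<in> B"
      using insert.prems(2)[OF c(1) insert.prems(3)[of c0 "-1"]] c0(1) by (simp add: c'_def B0_def)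
    define N where "N = (\<Sum>i\<in>insert j F. c' i * cnj (c' i))"
    have "N = of_real (\<Sum>i\<in>insert j F. (cmod (c' i))\<^sup>2)"
      unfolding N_def of_real_sum complex_norm_square ..
    moreover have "(\<Sum>i\<in>insert j F. (cmod (c' i))\<^sup>2) > 0"
      using insert.hyps c c'j by (intro sum_pos2[of _ j]) auto
    ultimately have N: "N \<noteq> 0" by (metis of_real_eq_0_iff less_irrefl)
    define l where "l = (\<Sum>i\<in>insert j F. (T i - b0 i) * cnj (c' i)) / N"
    define b where "b i = b0 i + l * c' i" for i
    show ?thesis
    proof (intro bexI ballI)
      show "b \<in> B"
        using insert.prems(2)[OF _ insert.prems(3)[OF c'B, of l]] b0(1) unfolding b_def B0_def by blast
      fix b' assume b': "b' \<in> B"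
      define t where "t = b' j / c' j"
      define b'' where "b'' = (\<lambda>i. b' i - t * c' i)"
      have "b'' \<in> B"
        using insert.prems(2)[OF b' insert.prems(3)[OF c'B, of "-t"]] by (simp add: b''_def)
      then have b'': "b'' \<in> B0" using c c'j by (simp add: B0_def b''_def t_def)
      have *: "(\<Sum>i\<in>insert j F. (T i - b i) * cnj (b'' i)) = 0"
      proof -
        have "(\<Sum>i\<in>insert j F. (T i - b i) * cnj (b'' i)) =
           (\<Sum>i\<in>insert j F. (T i - b0 i) * cnj (b'' i)) - l * (\<Sum>i\<in>insert j F. c' i * cnj (b'' i))"
          unfolding sum_distrib_left sum_subtractf[symmetric]
          by (intro sum.cong) (auto simp: b_def algebra_simps)
        then show ?thesis using b0(2)[OF b''] c0(2)[OF b''] unfolding c'_def by simp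
      qed
      have **: "(\<Sum>i\<in>insert j F. (T i - b i) * cnj (c' i)) = 0"
      proof -
        have "(\<Sum>i\<in>insert j F. (T i - b i) * cnj (c' i)) =
           (\<Sum>i\<in>insert j F. (T i - b0 i) * cnj (c' i)) - l * N"
          unfolding N_def sum_distrib_left sum_subtractf[symmetric]
          by (intro sum.cong) (auto simp: b_def algebra_simps)
        then show ?thesis using N by (simp add: l_def)
      qed
      have "(\<Sum>i\<in>insert j F. (T i - b i) * cnj (b' i)) =
         (\<Sum>i\<in>insert j F. (T i - b i) * cnj (b'' i)) + cnj t * (\<Sum>i\<in>insert j F. (T i - b i) * cnj (c' i))"
        unfolding sum_distrib_left sum.distrib[symmetric]
        by (intro sum.cong) (auto simp: b''_def algebra_simps)
      then show "(\<Sum>i\<in>insert j F. (T i - b i) * cnj (b' i)) = 0" using * ** by simp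
    qed
  qed
qed

text \<open>
  These are the entries of the tensor powers of \<open>M\<close>, extended by \<open>0\<close> to pairs of words of different
  length.
\<close>

fun word_coeff :: "complex ^ 'n ^ 'n \<Rightarrow> 'n list \<Rightarrow> 'n list \<Rightarrow> complex" where
  "word_coeff M [] [] = 1"
| "word_coeff M (j # J) (i # I) = M $ j $ i * word_coeff M J I"
| "word_coeff M _ _ = 0"

lemma word_coeff_length: "word_coeff M J I \<noteq> 0 \<Longrightarrow> length J = length I"
  by (induction M J I rule: word_coeff.induct) auto

definition adjoint_matrix :: "complex ^ 'n ^ 'n \<Rightarrow> complex ^ 'n ^ 'n" where
  "adjoint_matrix M = (\<chi> i j. cnj (M $ j $ i))"

lemma word_coeff_adjoint: "word_coeff (adjoint_matrix M) I J = cnj (word_coeff M J I)"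
  by (induction M J I rule: word_coeff.induct) (auto simp: adjoint_matrix_def)

lemma sum_words_Suc:
  "(\<Sum>I | length (I :: 'n::finite list) = Suc d. h I) = (\<Sum>i\<in>UNIV. \<Sum>I | length I = d. h (i # I))"
proof -
  have "(\<Sum>I | length (I :: 'n list) = Suc d. h I)
      = (\<Sum>(i, I)\<in>UNIV \<times> {I. length I = d}. h (i # I))"
    by (rule sum.reindex_bij_witness[of _ "\<lambda>(i, I). i # I" "\<lambda>I. (hd I, tl I)"])
       (auto simp: length_Suc_conv)
  then show ?thesis by (simp add: sum.cartesian_product)
qed

lemma monomial_matrix:
  fixes M :: "complex ^ 'n::finite ^ 'n"
  shows "monomial J (M *v x) = (\<Sum>I | length I = length J. word_coeff M J I * monomial I x)"
proof (induction J)
  case Nil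
  then show ?case by simp
next
  case (Cons j J)
  have "monomial (j # J) (M *v x)
      = (\<Sum>i\<in>UNIV. \<Sum>I | length I = length J. (M $ j $ i * x $ i) * (word_coeff M J I * monomial I x))"
    unfolding monomial_simps Cons by (simp add: matrix_vector_mult_def sum_product)
  also have "\<dots> = (\<Sum>I | length I = length (j # J). word_coeff M (j # J) I * monomial I x)"
    by (simp add: sum_words_Suc algebra_simps)
  finally show ?case .
qed

definition word_act :: "nat \<Rightarrow> complex ^ 'n::finite ^ 'n \<Rightarrow> ('n list \<Rightarrow> complex) \<Rightarrow> 'n list \<Rightarrow> complex" where
  "word_act D M T I = (\<Sum>J\<in>words D. T J * word_coeff M J I)"

lemma form_word_act:
  assumes "d \<le> D"
  shows "form d T (M *v x) = form d (word_act D M T) x"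
proof -
  have "form d T (M *v x) = (\<Sum>J | length J = d. \<Sum>I | length I = d. T J * word_coeff M J I * monomial I x)"
    by (auto simp: form_def monomial_matrix sum_distrib_left algebra_simps intro!: sum.cong)
  also have "\<dots> = (\<Sum>I | length I = d. \<Sum>J | length J = d. T J * word_coeff M J I * monomial I x)"
    by (rule sum.swap)
  also have "\<dots> = (\<Sum>I | length I = d. \<Sum>J\<in>words D. T J * word_coeff M J I * monomial I x)"
    using assms word_coeff_length[of M] by (intro sum.cong refl sum.mono_neutral_left) auto
  also have "\<dots> = form d (word_act D M T) x"
    by (simp add: form_def word_act_def sum_distrib_right)
  finally show ?thesis .
qed

lemma word_act_Nil: "word_act D M T [] = T []"
proof -
  have "word_act D M T [] = (\<Sum>J\<in>{[]}. T J * word_coeff M J [])"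
    unfolding word_act_def
    using word_coeff_length[of M _ "[]"] by (intro sum.mono_neutral_right) auto
  then show ?thesis by simp
qed

lemma word_act_adjoint:
  "(\<Sum>I\<in>words D. word_act D M T I * cnj (S I)) = (\<Sum>J\<in>words D. T J * cnj (word_act D (adjoint_matrix M) S J))"
  unfolding word_act_def cnj_sum sum_distrib_left sum_distrib_right complex_cnj_mult
    word_coeff_adjoint complex_cnj_cnj
  by (subst sum.swap) (simp add: algebra_simps)

text \<open>
  As \<open>V\<close> is closed, some polynomial is \<open>1\<close> on \<open>V\<close> and \<open>0\<close> at the origin.
  Projecting away the polynomials \<open>B\<close> that vanish on both sets makes the choice canonical for the
  hermitian product. As \<open>G\<close> is stable under adjoints, every \<open>M \<in> G\<close> preserves the orthogonal
  complement of \<open>B\<close> as well as \<open>B\<close>, and a canonical choice is fixed by \<open>G\<close>. This takes the place of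
  averaging over a maximal compact subgroup.
\<close>

lemma exists_invariant_form:
  fixes V :: "(complex ^ 'n::finite) set"
  assumes "zariski_closed V" "0 \<notin> V" "x0 \<in> V"
    and stable: "\<And>M x. M \<in> G \<Longrightarrow> x \<in> V \<Longrightarrow> M *v x \<in> V"
    and adj: "\<And>M. M \<in> G \<Longrightarrow> adjoint_matrix M \<in> G"
  obtains d T where "d > 0" "form d T x0 \<noteq> 0" "\<And>M x. M \<in> G \<Longrightarrow> form d T (M *v x) = form d T x"
proof -
  obtain p0 where p0: "p0 \<in> poly_fun" "\<And>x. x \<in> V \<Longrightarrow> p0 x = 0" "p0 0 \<noteq> 0"
    using assms(1,2) by (auto simp: zariski_closed_def)
  have "(\<lambda>x. 1 - inverse (p0 0) * p0 x) \<in> poly_fun"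
    by (intro poly_fun_diff poly_fun_cmult p0 poly_fun.const)
  then obtain D T where T: "\<And>x. 1 - inverse (p0 0) * p0 x = (\<Sum>d\<le>D. form d T x)"
    using poly_fun_forms by blast
  have T_nil: "T [] = 0"
  proof -
    have "(\<Sum>d\<le>D. form d T 0) = (\<Sum>d\<in>{0}. form d T 0)"
    proof (intro sum.mono_neutral_right ballI)
      fix d assume "d \<in> {..D} - {0}"
      then show "form d T 0 = 0" using form_scale[of d T 0 0] by (auto simp: power_0_left)
    qed auto
    then show ?thesis using T[of 0] p0(3) by (simp add: form_0)
  qed
  define ev where "ev S x = (\<Sum>I\<in>words D. S I * monomial I x)" for S :: "'n list \<Rightarrow> complex" and x
  have ev_T: "ev T x = 1" if "x \<in> V" for x
    unfolding ev_def sum_words_eq_sum_form T[symmetric] using p0(2)[OF that] by simp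
  have ev_diff: "ev (\<lambda>I. S I - U I) x = ev S x - ev U x" for S U x
    by (simp add: ev_def algebra_simps sum_subtractf)
  have ev_act: "ev (word_act D M S) x = ev S (M *v x)" for M S x
    unfolding ev_def sum_words_eq_sum_form by (intro sum.cong) (auto simp: form_word_act)
  define B where "B = {b. b [] = 0 \<and> (\<forall>x\<in>V. ev b x = 0)}"
  have "\<exists>b\<in>B. \<forall>b'\<in>B. (\<Sum>I\<in>words D. (T I - b I) * cnj (b' I)) = 0"
    by (rule orthogonal_projection)
       (auto simp: B_def ev_def algebra_simps sum.distrib simp flip: sum_distrib_left)
  then obtain b where b: "b \<in> B" "\<And>b'. b' \<in> B \<Longrightarrow> (\<Sum>I\<in>words D. (T I - b I) * cnj (b' I)) = 0" by blast
  define U where "U I = T I - b I" for I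
  have U_nil: "U [] = 0" using T_nil b(1) by (simp add: U_def B_def)
  have ev_U: "ev U x = 1" if "x \<in> V" for x
    using that b(1) ev_T unfolding U_def ev_diff by (simp add: B_def)
  have act_B: "word_act D M c \<in> B" if "M \<in> G" "c \<in> B" for M c
    using that stable by (auto simp: B_def word_act_Nil ev_act)
  \<comment> \<open>The difference \<open>c\<close> lies in \<open>B\<close> and is orthogonal to \<open>B\<close>, so its norm is zero.\<close>
  have U_inv: "word_act D M U I = U I" if "M \<in> G" "I \<in> words D" for M I
  proof -
    define c where "c I = word_act D M U I - U I" for I
    have c: "c \<in> B"
      using stable[OF that(1)] ev_U unfolding c_def
      by (auto simp: B_def word_act_Nil ev_act ev_diff)
    have "(\<Sum>I\<in>words D. c I * cnj (c I))
      = (\<Sum>I\<in>words D. word_act D M U I * cnj (c I)) - (\<Sum>I\<in>words D. U I * cnj (c I))"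
      unfolding sum_subtractf[symmetric] by (intro sum.cong refl) (simp add: c_def algebra_simps)
    also have "\<dots> = 0"
      using b(2)[OF c] b(2)[OF act_B[OF adj[OF that(1)] c]] by (simp add: word_act_adjoint U_def)
    finally have "of_real (\<Sum>I\<in>words D. (cmod (c I))\<^sup>2) = (0::complex)"
      unfolding of_real_sum complex_norm_square .
    then have "(\<Sum>I\<in>words D. (cmod (c I))\<^sup>2) = 0" using of_real_eq_0_iff by blast
    then have "(cmod (c I))\<^sup>2 = 0"
      using that(2) by (subst (asm) sum_nonneg_eq_0_iff) auto
    then show ?thesis by (simp add: c_def)
  qed
  have "(\<Sum>d\<le>D. form d U x0) = 1" using ev_U[OF assms(3)] by (simp add: ev_def sum_words_eq_sum_form)
  then obtain d where d: "d \<le> D" "form d U x0 \<noteq> 0"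
    by (metis (no_types, lifting) atMost_iff sum.neutral zero_neq_one)
  have "d > 0" using d U_nil by (auto simp: form_0 intro!: Nat.gr0I)
  moreover have "form d U (M *v x) = form d U x" if "M \<in> G" for M x
    unfolding form_word_act[OF d(1)] unfolding form_def
    by (intro sum.cong) (use that d(1) U_inv in auto)
  ultimately show ?thesis using that d(2) by blast
qed

section \<open>Values of regular functions\<close>

lemma in_zariski_closure_iff:
  "x \<in> zariski_closure Y \<longleftrightarrow> (\<forall>p\<in>poly_fun. (\<forall>y\<in>Y. p y = 0) \<longrightarrow> p x = 0)"
proof
  define Z where "Z = {x. \<forall>p\<in>{p \<in> poly_fun. \<forall>y\<in>Y. p y = 0}. p x = 0}"
  have "zariski_closed Z" unfolding zariski_closed_def Z_def by blast
  moreover have "Y \<subseteq> Z" by (auto simp: Z_def)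
  ultimately have "zariski_closure Y \<subseteq> Z" by (intro hull_minimal)
  then show "x \<in> zariski_closure Y \<Longrightarrow> \<forall>p\<in>poly_fun. (\<forall>y\<in>Y. p y = 0) \<longrightarrow> p x = 0"
    by (auto simp: Z_def)
next
  assume *: "\<forall>p\<in>poly_fun. (\<forall>y\<in>Y. p y = 0) \<longrightarrow> p x = 0"
  show "x \<in> zariski_closure Y"
    unfolding hull_def
  proof (intro InterI, clarify)
    fix t assume "zariski_closed t" "Y \<subseteq> t"
    then show "x \<in> t" using * unfolding zariski_closed_def by blast
  qed
qed

text \<open>
  Gaussian elimination: a vector \<open>c0\<close> with nonzero \<open>j\<close>-th coordinate is used to clear that
  coordinate in all the others.
\<close>

lemma linear_dependence:
  fixes T :: "'c \<Rightarrow> 'i \<Rightarrow> complex"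
  assumes "finite F" "finite C" "card F < card C"
  shows "\<exists>l. (\<exists>c\<in>C. l c \<noteq> 0) \<and> (\<forall>i\<in>F. (\<Sum>c\<in>C. l c * T c i) = 0)"
  using assms
proof (induction F arbitrary: C T)
  case empty
  then have "C \<noteq> {}" by auto
  then show ?case by (auto intro!: exI[of _ "\<lambda>_. 1"])
next
  case (insert j F)
  show ?case
  proof (cases "\<forall>c\<in>C. T c j = 0")
    case True
    have "card F < card C" using insert by simp
    then obtain l where "\<exists>c\<in>C. l c \<noteq> 0" "\<forall>i\<in>F. (\<Sum>c\<in>C. l c * T c i) = 0"
      using insert.IH[OF insert.prems(1)] by blast
    then show ?thesis using True by (intro exI[of _ l]) auto
  next
    case False
    then obtain c0 where c0: "c0 \<in> C" "T c0 j \<noteq> 0" by auto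
    define U where "U c i = T c i - T c j / T c0 j * T c0 i" for c i
    have "card F < card (C - {c0})" using insert c0 by simp
    then obtain l where l: "\<exists>c\<in>C - {c0}. l c \<noteq> 0" "\<forall>i\<in>F. (\<Sum>c\<in>C - {c0}. l c * U c i) = 0"
      using insert.IH[of "C - {c0}" U] insert.prems(1) by blast
    define s where "s = (\<Sum>c\<in>C - {c0}. l c * T c j) / T c0 j"
    define l' where "l' = l(c0 := - s)"
    have *: "(\<Sum>c\<in>C. l' c * T c i) = (\<Sum>c\<in>C - {c0}. l c * T c i) - s * T c0 i" for i
      using insert.prems(1) c0 by (subst sum.remove[of _ c0]) (auto simp: l'_def intro!: sum.cong)
    have **: "(\<Sum>c\<in>C - {c0}. l c * U c i) = (\<Sum>c\<in>C - {c0}. l c * T c i) - s * T c0 i" for i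
      by (simp add: U_def s_def algebra_simps sum_subtractf sum_distrib_left sum_divide_distrib)
    show ?thesis
    proof (intro exI[of _ l'] conjI ballI)
      show "\<exists>c\<in>C. l' c \<noteq> 0" using l(1) by (auto simp: l'_def)
      fix i assume "i \<in> insert j F"
      then show "(\<Sum>c\<in>C. l' c * T c i) = 0"
        using l(2) c0 by (auto simp: * ** s_def)
    qed
  qed
qed

locale function_algebra =
  fixes A :: "('a \<Rightarrow> complex) set"
  assumes const: "(\<lambda>x. c) \<in> A"
    and add: "a \<in> A \<Longrightarrow> b \<in> A \<Longrightarrow> (\<lambda>x. a x + b x) \<in> A"
    and mult: "a \<in> A \<Longrightarrow> b \<in> A \<Longrightarrow> (\<lambda>x. a x * b x) \<in> A"
begin

definition fun_ideal :: "('a \<Rightarrow> complex) set \<Rightarrow> bool" where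
  "fun_ideal J \<longleftrightarrow> J \<subseteq> A \<and> (\<lambda>x. 0) \<in> J \<and> (\<forall>a\<in>J. \<forall>b\<in>J. (\<lambda>x. a x + b x) \<in> J) \<and>
     (\<forall>a\<in>A. \<forall>b\<in>J. (\<lambda>x. a x * b x) \<in> J)"

lemma minus_const: "a \<in> A \<Longrightarrow> (\<lambda>x. a x - c) \<in> A"
  using add[OF _ const[of "-c"]] by simp

lemma fun_idealD:
  assumes "fun_ideal J"
  shows "a \<in> J \<Longrightarrow> a \<in> A" "a \<in> J \<Longrightarrow> b \<in> J \<Longrightarrow> (\<lambda>x. a x + b x) \<in> J"
    "a \<in> A \<Longrightarrow> b \<in> J \<Longrightarrow> (\<lambda>x. a x * b x) \<in> J" "(\<lambda>x. 0) \<in> J"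
  using assms by (auto simp: fun_ideal_def)

lemma fun_ideal_cmult: "fun_ideal J \<Longrightarrow> b \<in> J \<Longrightarrow> (\<lambda>x. c * b x) \<in> J"
  using fun_idealD(3)[OF _ const[of c]] by blast

lemma fun_ideal_diff: "fun_ideal J \<Longrightarrow> a \<in> J \<Longrightarrow> b \<in> J \<Longrightarrow> (\<lambda>x. a x - b x) \<in> J"
  using fun_idealD(2)[OF _ _ fun_ideal_cmult[of J b "-1"], of a] by simp

lemma fun_ideal_sum:
  "fun_ideal J \<Longrightarrow> (\<And>i. i \<in> I \<Longrightarrow> f i \<in> J) \<Longrightarrow> (\<lambda>x. \<Sum>i\<in>I. f i x) \<in> J"
  by (induction I rule: infinite_finite_induct) (auto intro: fun_idealD)

lemma prod_closed: "(\<And>i. i \<in> I \<Longrightarrow> f i \<in> A) \<Longrightarrow> (\<lambda>x. \<Prod>i\<in>I. f i x) \<in> A"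
  by (induction I rule: infinite_finite_induct) (auto intro: const mult)

lemma sum_closed: "(\<And>i. i \<in> I \<Longrightarrow> f i \<in> A) \<Longrightarrow> (\<lambda>x. \<Sum>i\<in>I. f i x) \<in> A"
  by (induction I rule: infinite_finite_induct) (auto intro: const add)

lemma poly_closed: "a \<in> A \<Longrightarrow> (\<lambda>x. poly h (a x)) \<in> A"
  by (induction h) (auto intro: const add mult)

text \<open>
  Over the complex numbers \<open>h\<close> splits into linear factors. Each \<open>a - c\<close> is invertible modulo \<open>J\<close>, so
  the factors can be cancelled one by one.
\<close>

lemma one_in_ideal_of_poly:
  assumes J: "fun_ideal J" and a: "a \<in> A"
    and units: "\<And>c. \<exists>u\<in>A. (\<lambda>x. 1 - u x * (a x - c)) \<in> J"
    and "h \<noteq> 0" "(\<lambda>x. poly h (a x)) \<in> J"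
  shows "(\<lambda>x. 1) \<in> J"
  using assms(4,5)
proof (induction "degree h" arbitrary: h)
  case 0
  then obtain c where c: "h = [:c:]" by (metis degree_eq_zeroE)
  then show ?case using fun_ideal_cmult[OF J 0(3), of "inverse c"] 0(2) by simp
next
  case (Suc n)
  have "\<not> constant (poly h)" using Suc(2) by (simp add: constant_degree)
  then obtain d where "poly h d = 0" using fundamental_theorem_of_algebra by blast
  then obtain g where h: "h = [:-d, 1:] * g" using poly_eq_0_iff_dvd by blast
  obtain u where u: "u \<in> A" "(\<lambda>x. 1 - u x * (a x - d)) \<in> J" using units by blast
  have g0: "g \<noteq> 0" using Suc(3) h by auto
  have "degree h = Suc (degree g)" unfolding h using g0 by (subst degree_mult_eq) auto
  then have deg: "n = degree g" using Suc(2) by simp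
  have "(\<lambda>x. u x * poly h (a x) + poly g (a x) * (1 - u x * (a x - d))) \<in> J"
    by (intro fun_idealD(2)[OF J] fun_idealD(3)[OF J] u Suc poly_closed a)
  also have "(\<lambda>x. u x * poly h (a x) + poly g (a x) * (1 - u x * (a x - d))) = (\<lambda>x. poly g (a x))"
    unfolding h by (auto simp: algebra_simps)
  finally show ?case using Suc(1)[OF deg g0] by blast
qed

text \<open>
  The heart of the Nullstellensatz. If adding \<open>a - c\<close> to \<open>J\<close> gave the unit ideal for every \<open>c\<close>, each
  \<open>a - c\<close> would have an inverse \<open>u c\<close> modulo \<open>J\<close>. These are uncountably many elements of an algebra that is a countable
  union of finite dimensional spaces, so finitely many of them satisfy a linear relation. Clearing
  denominators in the relation gives a nonzero polynomial in \<open>a\<close> that belongs to \<open>J\<close>.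
\<close>

lemma adjoin_value:
  fixes F :: "'k::countable \<Rightarrow> 'i set"
  assumes J: "fun_ideal J" and proper: "(\<lambda>x. 1) \<notin> J" and a: "a \<in> A"
    and null: "\<And>b. b \<in> A \<Longrightarrow> (\<forall>y\<in>Y. b y = 0) \<Longrightarrow> b \<in> J"
    and dim: "\<And>b. b \<in> A \<Longrightarrow> \<exists>k T. \<forall>y\<in>Y. b y = (\<Sum>i\<in>F k. T i * e k i y)"
    and fin: "\<And>k. finite (F k)"
  obtains c J' where "fun_ideal J'" "(\<lambda>x. 1) \<notin> J'" "J \<subseteq> J'" "(\<lambda>x. a x - c) \<in> J'"
proof -
  have "\<exists>c. \<forall>u\<in>A. (\<lambda>x. 1 - u x * (a x - c)) \<notin> J"
  proof (rule ccontr)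
    assume contra: "\<not> ?thesis"
    then have units: "\<exists>u\<in>A. (\<lambda>x. 1 - u x * (a x - c)) \<in> J" for c by blast
    then obtain u where u: "\<And>c. u c \<in> A" "\<And>c. (\<lambda>x. 1 - u c x * (a x - c)) \<in> J" by metis
    have "\<forall>c. \<exists>k T. \<forall>y\<in>Y. u c y = (\<Sum>i\<in>F k. T i * e k i y)" using dim[OF u(1)] by blast
    then obtain k T where kT: "\<And>c y. y \<in> Y \<Longrightarrow> u c y = (\<Sum>i\<in>F (k c). T c i * e (k c) i y)"
      by metis
    \<comment> \<open>Infinitely many of the inverses lie in one of the countably many finite dimensional pieces.\<close>
    have "\<exists>k0. infinite {c. k c = k0}"
    proof (rule ccontr)
      assume "\<not> ?thesis"
      then have "countable (\<Union>k0. {c. k c = k0})"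
        by (intro countable_UN) (auto intro: countable_finite)
      moreover have "(\<Union>k0. {c. k c = k0}) = UNIV" by auto
      ultimately show False using uncountable_UNIV_complex by simp
    qed
    then obtain k0 where "infinite {c. k c = k0}" ..
    then obtain C where C: "C \<subseteq> {c. k c = k0}" "finite C" "card C = Suc (card (F k0))"
      using infinite_arbitrarily_large by blast
    obtain l where l: "\<exists>c\<in>C. l c \<noteq> 0" "\<forall>i\<in>F k0. (\<Sum>c\<in>C. l c * T c i) = 0"
      using linear_dependence[of "F k0" C T] fin C by auto
    have rel: "(\<Sum>c\<in>C. l c * u c y) = 0" if "y \<in> Y" for y
    proof -
      have "(\<Sum>c\<in>C. l c * u c y) = (\<Sum>c\<in>C. \<Sum>i\<in>F k0. l c * T c i * e k0 i y)"
        using C(1) kT[OF that] by (intro sum.cong) (auto simp: sum_distrib_left algebra_simps)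
      also have "\<dots> = (\<Sum>i\<in>F k0. (\<Sum>c\<in>C. l c * T c i) * e k0 i y)"
        by (subst sum.swap) (simp add: sum_distrib_right)
      finally show ?thesis using l(2) by simp
    qed
    define P where "P c x = (\<Prod>d\<in>C - {c}. a x - d)" for c x
    have P_A: "P c \<in> A" for c unfolding P_def by (intro prod_closed minus_const a)
    \<comment> \<open>The relation \<open>\<Sum> l c / (a - c) = 0\<close>, multiplied by the product of all \<open>a - d\<close>.\<close>
    define H where "H = (\<Sum>c\<in>C. smult (l c) (\<Prod>d\<in>C - {c}. [:- d, 1:]))"
    have poly_H: "poly H z = (\<Sum>c\<in>C. l c * (\<Prod>d\<in>C - {c}. z - d))" for z
      by (simp add: H_def poly_sum poly_prod)
    have "H \<noteq> 0"
    proof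
      assume H: "H = 0"
      obtain c where c: "c \<in> C" "l c \<noteq> 0" using l(1) by blast
      have "poly H c = l c * (\<Prod>d\<in>C - {c}. c - d)"
        unfolding poly_H using C(2) c(1)
        by (subst sum.remove[of _ c]) (auto intro!: sum.neutral)
      also have "\<dots> \<noteq> 0" using c C(2) by auto
      finally show False using H by simp
    qed
    moreover have "(\<lambda>x. poly H (a x)) \<in> J"
    proof -
      have split: "poly H (a x) = (\<Sum>c\<in>C. l c * (P c x * (1 - u c x * (a x - c))))
          + (\<Prod>d\<in>C. a x - d) * (\<Sum>c\<in>C. l c * u c x)" for x
      proof -
        have P_mult: "P c x * (a x - c) = (\<Prod>d\<in>C. a x - d)" if "c \<in> C" for c
          using C(2) that by (subst prod.remove[of C c]) (auto simp: P_def)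
        have "(\<Prod>d\<in>C. a x - d) * (\<Sum>c\<in>C. l c * u c x)
          = (\<Sum>c\<in>C. l c * (P c x * (u c x * (a x - c))))"
          unfolding sum_distrib_left
        proof (intro sum.cong refl)
          fix c assume "c \<in> C"
          show "(\<Prod>d\<in>C. a x - d) * (l c * u c x) = l c * (P c x * (u c x * (a x - c)))"
            unfolding P_mult[OF \<open>c \<in> C\<close>, symmetric] by (simp add: mult_ac)
        qed
        then show ?thesis
          unfolding poly_H P_def[symmetric] by (simp add: right_diff_distrib sum_subtractf)
      qed
      have 1: "(\<lambda>x. \<Sum>c\<in>C. l c * (P c x * (1 - u c x * (a x - c)))) \<in> J"
        by (intro fun_ideal_sum[OF J] fun_ideal_cmult[OF J] fun_idealD(3)[OF J] P_A u)
      have 2: "(\<lambda>x. (\<Prod>d\<in>C. a x - d) * (\<Sum>c\<in>C. l c * u c x)) \<in> J"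
        by (intro null mult prod_closed minus_const a sum_closed const u) (simp add: rel)
      show ?thesis unfolding split by (rule fun_idealD(2)[OF J 1 2])
    qed
    ultimately show False using one_in_ideal_of_poly[OF J a units] proper by blast
  qed
  then obtain c where c: "\<And>u. u \<in> A \<Longrightarrow> (\<lambda>x. 1 - u x * (a x - c)) \<notin> J" by blast
  define J' where "J' = {(\<lambda>x. j x + b x * (a x - c)) | j b. j \<in> J \<and> b \<in> A}"
  have J'I: "f \<in> J'" if "j \<in> J" "b \<in> A" "\<And>x. f x = j x + b x * (a x - c)" for f j b
    unfolding J'_def using that by blast
  have J'E: "\<exists>j\<in>J. \<exists>b\<in>A. f = (\<lambda>x. j x + b x * (a x - c))" if "f \<in> J'" for f
    using that unfolding J'_def by blast
  show thesis
  proof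
    show "fun_ideal J'"
      unfolding fun_ideal_def
    proof (intro conjI ballI subsetI)
      fix f assume "f \<in> J'"
      then obtain j b where "j \<in> J" "b \<in> A" "f = (\<lambda>x. j x + b x * (a x - c))" using J'E by blast
      then show "f \<in> A" by (simp add: add mult minus_const a fun_idealD(1)[OF J])
    next
      show "(\<lambda>x. 0) \<in> J'" by (rule J'I[OF fun_idealD(4)[OF J] const[of 0]]) simp
    next
      fix f g assume "f \<in> J'" "g \<in> J'"
      then obtain j b j' b' where *: "j \<in> J" "b \<in> A" "f = (\<lambda>x. j x + b x * (a x - c))"
         "j' \<in> J" "b' \<in> A" "g = (\<lambda>x. j' x + b' x * (a x - c))" using J'E by meson
      show "(\<lambda>x. f x + g x) \<in> J'"
        by (rule J'I[OF fun_idealD(2)[OF J *(1,4)] add[OF *(2,5)]]) (simp add: * algebra_simps)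
    next
      fix f g assume f: "f \<in> A" and "g \<in> J'"
      then obtain j b where *: "j \<in> J" "b \<in> A" "g = (\<lambda>x. j x + b x * (a x - c))" using J'E by meson
      show "(\<lambda>x. f x * g x) \<in> J'"
        by (rule J'I[OF fun_idealD(3)[OF J f *(1)] mult[OF f *(2)]]) (simp add: * algebra_simps)
    qed
    show "(\<lambda>x. 1) \<notin> J'"
    proof
      assume "(\<lambda>x. 1) \<in> J'"
      then obtain j b where *: "j \<in> J" "b \<in> A" "(\<lambda>x. 1) = (\<lambda>x. j x + b x * (a x - c))" using J'E by meson
      have "j x = 1 - b x * (a x - c)" for x using fun_cong[OF *(3), of x] by (simp add: algebra_simps)
      then have "j = (\<lambda>x. 1 - b x * (a x - c))" by blast
      then show False using c[OF *(2)] *(1) by simp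
    qed
    show "J \<subseteq> J'" by (intro subsetI, rule J'I[OF _ const[of 0]]) auto
    show "(\<lambda>x. a x - c) \<in> J'" by (rule J'I[OF fun_idealD(4)[OF J] const[of 1]]) simp
  qed
qed

lemma exists_values:
  fixes F :: "'k::countable \<Rightarrow> 'i set" and a :: "'n \<Rightarrow> 'a \<Rightarrow> complex"
  assumes "finite N" "fun_ideal J" "(\<lambda>x. 1) \<notin> J" "\<And>i. i \<in> N \<Longrightarrow> a i \<in> A"
    and "\<And>b. b \<in> A \<Longrightarrow> (\<forall>y\<in>Y. b y = 0) \<Longrightarrow> b \<in> J"
    and "\<And>b. b \<in> A \<Longrightarrow> \<exists>k T. \<forall>y\<in>Y. b y = (\<Sum>i\<in>F k. T i * e k i y)"
    and "\<And>k. finite (F k)"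
  shows "\<exists>J' c. fun_ideal J' \<and> (\<lambda>x. 1) \<notin> J' \<and> J \<subseteq> J' \<and> (\<forall>i\<in>N. (\<lambda>x. a i x - c i) \<in> J')"
  using assms(1,4)
proof (induction N)
  case empty
  then show ?case using assms(2,3) by blast
next
  case (insert j N)
  then obtain J1 c where J1: "fun_ideal J1" "(\<lambda>x. 1) \<notin> J1" "J \<subseteq> J1"
    "\<And>i. i \<in> N \<Longrightarrow> (\<lambda>x. a i x - c i) \<in> J1"
  proof -
    have "\<exists>J' c. fun_ideal J' \<and> (\<lambda>x. 1) \<notin> J' \<and> J \<subseteq> J' \<and> (\<forall>i\<in>N. (\<lambda>x. a i x - c i) \<in> J')"
      by (rule insert.IH) (rule insert.prems, simp)
    then show thesis using that by blast
  qed
  have null: "b \<in> J1" if "b \<in> A" "\<forall>y\<in>Y. b y = 0" for b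
    using assms(5) that J1(3) by blast
  obtain d J2 where J2: "fun_ideal J2" "(\<lambda>x. 1) \<notin> J2" "J1 \<subseteq> J2" "(\<lambda>x. a j x - d) \<in> J2"
    by (rule adjoin_value[OF J1(1,2) insert.prems[OF insertI1] null assms(6,7)])
  then show ?case
    using J1 insert.hyps by (intro exI[of _ J2] exI[of _ "c(j := d)"]) auto
qed

end

text \<open>
  Let \<open>A\<close> be the algebra of all \<open>p / \<phi> ^ n\<close> on \<open>Y\<close> and \<open>J\<close> the ideal of those \<open>a \<in> A\<close> with \<open>a f \<in> A\<close>. A
  proper ideal extends to one that contains all \<open>x $ i - z $ i\<close> for some point \<open>z\<close>. This point lies in
  \<open>Y\<close>, because the polynomials that vanish on \<open>Y\<close> are in \<open>J\<close> and \<open>\<phi>\<close> is a unit of \<open>A\<close>. But near \<open>z\<close>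
  the function \<open>f\<close> has a denominator, which belongs to \<open>J\<close> and does not vanish at \<open>z\<close>.
\<close>

lemma regular_fun_eq_fraction:
  fixes Y :: "(complex ^ 'n::finite) set"
  assumes phi: "\<phi> \<in> poly_fun" and phi0: "\<And>y. y \<in> Y \<Longrightarrow> \<phi> y \<noteq> 0"
    and Y: "\<And>y. y \<in> zariski_closure Y \<Longrightarrow> \<phi> y \<noteq> 0 \<Longrightarrow> y \<in> Y"
    and f: "f \<in> regular_fun Y"
  obtains p n where "p \<in> poly_fun" "\<And>y. y \<in> Y \<Longrightarrow> f y = p y / \<phi> y ^ n"
proof -
  define A where "A = {a. \<exists>p\<in>poly_fun. \<exists>n. \<forall>y\<in>Y. a y = p y / \<phi> y ^ n}"
  have A_I: "a \<in> A" if "p \<in> poly_fun" "\<And>y. y \<in> Y \<Longrightarrow> a y = p y / \<phi> y ^ n" for a p n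
    unfolding A_def using that by blast
  have A_E: "\<exists>p\<in>poly_fun. \<exists>n. \<forall>y\<in>Y. a y = p y / \<phi> y ^ n" if "a \<in> A" for a
    using that unfolding A_def by blast
  have poly_A: "p \<in> A" if "p \<in> poly_fun" for p by (rule A_I[OF that, of _ 0]) simp
  interpret function_algebra A
  proof
    show "(\<lambda>x. c) \<in> A" for c by (intro poly_A poly_fun.const)
    fix a b assume "a \<in> A" "b \<in> A"
    then obtain p n q m where *: "p \<in> poly_fun" "\<And>y. y \<in> Y \<Longrightarrow> a y = p y / \<phi> y ^ n"
      "q \<in> poly_fun" "\<And>y. y \<in> Y \<Longrightarrow> b y = q y / \<phi> y ^ m" using A_E by meson
    show "(\<lambda>x. a x + b x) \<in> A"
    proof (rule A_I)
      show "(\<lambda>x. p x * \<phi> x ^ m + q x * \<phi> x ^ n) \<in> poly_fun"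
        by (intro poly_fun.add poly_fun.mult poly_fun_power phi *)
      show "a y + b y = (p y * \<phi> y ^ m + q y * \<phi> y ^ n) / \<phi> y ^ (n + m)" if "y \<in> Y" for y
        using phi0[OF that] by (simp add: *(2,4)[OF that] divide_simps power_add)
    qed
    show "(\<lambda>x. a x * b x) \<in> A"
      by (rule A_I[OF poly_fun.mult[OF *(1,3)], of _ "n + m"]) (simp add: * power_add)
  qed
  define J where "J = {a \<in> A. (\<lambda>x. a x * f x) \<in> A}"
  have null_A: "b \<in> A" if "\<forall>y\<in>Y. b y = 0" for b
    by (rule A_I[OF poly_fun.const[of 0], of _ 0]) (use that in auto)
  have J: "fun_ideal J"
    unfolding fun_ideal_def J_def
    using add mult const[of 0]
    by (auto simp: distrib_right mult.assoc)
  show thesis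
  proof (cases "(\<lambda>x. 1) \<in> J")
    case True
    then have "f \<in> A" by (simp add: J_def)
    then show thesis using A_E that by meson
  next
    case False
    define F where "F k = (words (fst k) :: 'n list set)" for k :: "nat \<times> nat"
    have "\<exists>J' c. fun_ideal J' \<and> (\<lambda>x. 1) \<notin> J' \<and> J \<subseteq> J' \<and> (\<forall>i\<in>UNIV. (\<lambda>x. x $ (i :: 'n) - c i) \<in> J')"
    proof (rule exists_values[where Y = Y and F = F and e = "\<lambda>k I y. monomial I y / \<phi> y ^ snd k"])
      show "b \<in> J" if "b \<in> A" "\<forall>y\<in>Y. b y = 0" for b
        unfolding J_def using that null_A by auto
      fix b assume "b \<in> A"
      then obtain p n where p: "p \<in> poly_fun" "\<And>y. y \<in> Y \<Longrightarrow> b y = p y / \<phi> y ^ n"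
        using A_E by meson
      obtain D T where "\<And>x. p x = (\<Sum>I\<in>words D. T I * monomial I x)"
        using poly_fun_word_sum[OF p(1)] by blast
      then show "\<exists>k T. \<forall>y\<in>Y. b y = (\<Sum>i\<in>F k. T i * (monomial i y / \<phi> y ^ snd k))"
        using p(2) by (intro exI[of _ "(D, n)"] exI[of _ T]) (auto simp: F_def sum_divide_distrib)
    qed (use J False poly_fun.coord poly_A F_def in auto)
    then obtain J' c where J': "fun_ideal J'" "(\<lambda>x. 1) \<notin> J'" "J \<subseteq> J'"
      and c: "\<And>i. (\<lambda>x. x $ i - c i) \<in> J'" by blast
    define z where "z = (\<chi> i. c i)"
    have at_z: "(\<lambda>x. p x - p z) \<in> J'" if "p \<in> poly_fun" for p
      using that
    proof induction
      case (const c)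
      then show ?case using fun_idealD(4)[OF J'(1)] by simp
    next
      case (coord i)
      then show ?case using c by (simp add: z_def)
    next
      case (add p q)
      have "(\<lambda>x. (p x - p z) + (q x - q z)) \<in> J'" by (intro fun_idealD(2)[OF J'(1)] add)
      then show ?case by (simp add: algebra_simps)
    next
      case (mult p q)
      have "(\<lambda>x. p x * (q x - q z) + q z * (p x - p z)) \<in> J'"
        by (intro fun_idealD(2,3)[OF J'(1)] fun_ideal_cmult[OF J'(1)] mult poly_A)
      then show ?case by (simp add: algebra_simps)
    qed
    have vanish: "p z = 0" if "p \<in> poly_fun" "p \<in> J'" for p
    proof (rule ccontr)
      assume "p z \<noteq> 0"
      have "(\<lambda>x. p x - (p x - p z)) \<in> J'" by (intro fun_ideal_diff[OF J'(1)] that at_z)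
      then have "(\<lambda>x. inverse (p z) * (p x - (p x - p z))) \<in> J'" by (rule fun_ideal_cmult[OF J'(1)])
      then show False using J'(2) \<open>p z \<noteq> 0\<close> by simp
    qed
    have null_J: "b \<in> J'" if "\<forall>y\<in>Y. b y = 0" for b
      using J'(3) null_A that by (auto simp: J_def)
    have "z \<in> zariski_closure Y"
      unfolding in_zariski_closure_iff using vanish null_J by blast
    moreover have "\<phi> z \<noteq> 0"
    proof
      assume "\<phi> z = 0"
      then have "\<phi> \<in> J'" using at_z[OF phi] by simp
      moreover have "(\<lambda>x. inverse (\<phi> x)) \<in> A"
        by (rule A_I[OF poly_fun.const[of 1], of _ 1]) (auto simp: divide_inverse)
      ultimately have "(\<lambda>x. inverse (\<phi> x) * \<phi> x) \<in> J'" by (intro fun_idealD(3)[OF J'(1)])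
      moreover have "(\<lambda>x. 1 - inverse (\<phi> x) * \<phi> x) \<in> J'" by (intro null_J) (simp add: phi0)
      ultimately have "(\<lambda>x. inverse (\<phi> x) * \<phi> x + (1 - inverse (\<phi> x) * \<phi> x)) \<in> J'"
        by (rule fun_idealD(2)[OF J'(1)])
      then show False using J'(2) by simp
    qed
    ultimately have "z \<in> Y" using Y by blast
    then obtain U p q where U: "zariski_closed (- U)" "z \<in> U" "p \<in> poly_fun" "q \<in> poly_fun"
      "\<And>y. y \<in> U \<Longrightarrow> y \<in> Y \<Longrightarrow> q y \<noteq> 0 \<and> f y = p y / q y"
      using f unfolding regular_fun_def by blast
    obtain h where h: "h \<in> poly_fun" "h z \<noteq> 0" "\<And>y. y \<notin> U \<Longrightarrow> h y = 0"
    proof -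
      obtain P where P: "P \<subseteq> poly_fun" "- U = {x. \<forall>p\<in>P. p x = 0}"
        using U(1) unfolding zariski_closed_def by blast
      have "z \<notin> - U" using U(2) by simp
      then obtain h where "h \<in> P" "h z \<noteq> 0" unfolding P(2) by blast
      moreover have "h y = 0" if "y \<notin> U" for y
        using P(2) \<open>h \<in> P\<close> that by blast
      ultimately show thesis using P(1) that by blast
    qed
    \<comment> \<open>The local representation holds on all of \<open>Y\<close> after multiplication with \<open>h\<close>, as \<open>h\<close> is zero
      outside \<open>U\<close>.\<close>
    have "(\<lambda>x. (h x * q x) * f x) \<in> A"
    proof (rule A_I[where n = 0])
      show "(\<lambda>x. h x * p x) \<in> poly_fun" by (intro poly_fun.mult h U)
      show "h y * q y * f y = h y * p y / \<phi> y ^ 0" if "y \<in> Y" for y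
        using U(5)[of y] h(3)[of y] that by (cases "y \<in> U") auto
    qed
    then have "(\<lambda>x. h x * q x) \<in> J"
      unfolding J_def using poly_A poly_fun.mult[OF h(1) U(4)] by simp
    then have "h z * q z = 0"
      using vanish[of "\<lambda>x. h x * q x"] J'(3) poly_fun.mult[OF h(1) U(4)] by blast
    then show thesis using h(2) U(5)[OF U(2) \<open>z \<in> Y\<close>] by simp
  qed
qed

section \<open>Cones over closed sets\<close>

text \<open>
  If \<open>e\<close> does not divide \<open>n\<close>, multiplication by a primitive root \<open>w\<close> permutes the roots of unity and
  scales the sum by a factor different from \<open>1\<close>.
\<close>

lemma sum_inverse_roots_unity:
  assumes "e > 0"
  shows "(\<Sum>z | z ^ e = (1::complex). inverse z ^ n) = (if e dvd n then of_nat e else 0)"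
proof (cases "e dvd n")
  case True
  then obtain k where n: "n = e * k" by auto
  have "(\<Sum>z | z ^ e = (1::complex). inverse z ^ n) = (\<Sum>z | z ^ e = (1::complex). 1)"
    by (intro sum.cong) (auto simp: n power_mult power_inverse)
  then show ?thesis using True card_roots_unity_eq[OF assms] by simp
next
  case False
  define w where "w = exp (2 * of_real pi * \<i> * of_nat 1 / of_nat e)"
  have w: "w ^ e = 1" using complex_root_unity[of e 1] assms by (simp add: w_def)
  have "w ^ n = exp (2 * of_real pi * \<i> * of_nat n / of_nat e)"
    unfolding w_def exp_of_nat_mult[symmetric] by (simp add: algebra_simps)
  then have wn: "w ^ n \<noteq> 1" using complex_root_unity_eq_1[of e n] assms False by simp
  have w0: "w \<noteq> 0" by (simp add: w_def)
  define S where "S = (\<Sum>z | z ^ e = (1::complex). inverse z ^ n)"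
  have "S = (\<Sum>z | z ^ e = (1::complex). inverse (w * z) ^ n)"
    unfolding S_def
    by (rule sum.reindex_bij_witness[of _ "\<lambda>z. w * z" "\<lambda>z. inverse w * z"])
       (use w w0 in \<open>auto simp: power_mult_distrib power_inverse\<close>)
  also have "\<dots> = inverse w ^ n * S"
    unfolding S_def sum_distrib_left by (simp add: power_mult_distrib)
  finally have "S * w ^ n = S" using w0 by (simp add: power_inverse divide_simps)
  then have "S = 0" using wn by simp
  then show ?thesis using False by (simp add: S_def)
qed

definition punctured_cone :: "(complex ^ 'n) set \<Rightarrow> (complex ^ 'n) set" where
  "punctured_cone V = {c *s x | c x. c \<noteq> 0 \<and> x \<in> V}"

lemma in_coneI: "c \<noteq> 0 \<Longrightarrow> x \<in> V \<Longrightarrow> c *s x \<in> punctured_cone V"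
  by (auto simp: punctured_cone_def)

lemma in_coneE:
  assumes "y \<in> punctured_cone V"
  obtains c x where "c \<noteq> 0" "x \<in> V" "y = c *s x"
  using assms by (auto simp: punctured_cone_def)

lemma cone_scale: "y \<in> punctured_cone V \<Longrightarrow> c \<noteq> 0 \<Longrightarrow> c *s y \<in> punctured_cone V"
  by (metis in_coneE in_coneI mult_eq_0_iff vector_smult_assoc)

lemma subset_zariski_closure: "y \<in> Y \<Longrightarrow> y \<in> zariski_closure Y"
  using hull_subset[of Y zariski_closed] by blast

lemma poly_eq_on_closure:
  assumes "p \<in> poly_fun" "q \<in> poly_fun" "\<And>y. y \<in> Y \<Longrightarrow> p y = q y" "x \<in> zariski_closure Y"
  shows "p x = q x"
  using assms(4) poly_fun_diff[OF assms(1,2)] assms(3) unfolding in_zariski_closure_iff by fastforce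

lemma closure_cone_scale:
  assumes "x \<in> zariski_closure (punctured_cone V)" "c \<noteq> 0"
  shows "c *s x \<in> zariski_closure (punctured_cone V)"
  unfolding in_zariski_closure_iff
proof (intro ballI impI)
  fix p assume p: "p \<in> poly_fun" "\<forall>y\<in>punctured_cone V. p y = 0"
  then have "\<forall>y\<in>punctured_cone V. p (c *s y) = 0" using cone_scale[OF _ assms(2), of _ V] by blast
  then show "p (c *s x) = 0"
    using assms(1) poly_fun_scale[OF p(1), of c] unfolding in_zariski_closure_iff by auto
qed

lemma exists_separating_poly:
  assumes "zariski_closed V" "finite \<Xi>" "\<And>\<zeta>. \<zeta> \<in> \<Xi> \<Longrightarrow> \<zeta> \<noteq> 0" "\<And>\<zeta>. \<zeta> \<in> \<Xi> \<Longrightarrow> inverse \<zeta> *s x \<notin> V"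
  obtains p where "p \<in> poly_fun" "p x \<noteq> 0" "\<And>\<zeta> v. \<zeta> \<in> \<Xi> \<Longrightarrow> v \<in> V \<Longrightarrow> p (\<zeta> *s v) = 0"
proof -
  have "\<forall>\<zeta>\<in>\<Xi>. \<exists>q\<in>poly_fun. (\<forall>v\<in>V. q v = 0) \<and> q (inverse \<zeta> *s x) \<noteq> 0"
    using assms(1,4) unfolding zariski_closed_def by blast
  then obtain q where q: "\<And>\<zeta>. \<zeta> \<in> \<Xi> \<Longrightarrow> q \<zeta> \<in> poly_fun" "\<And>\<zeta> v. \<zeta> \<in> \<Xi> \<Longrightarrow> v \<in> V \<Longrightarrow> q \<zeta> v = 0"
    "\<And>\<zeta>. \<zeta> \<in> \<Xi> \<Longrightarrow> q \<zeta> (inverse \<zeta> *s x) \<noteq> 0"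
    by metis
  define p where "p = (\<lambda>y. \<Prod>\<zeta>\<in>\<Xi>. q \<zeta> (inverse \<zeta> *s y))"
  show thesis
  proof
    show "p \<in> poly_fun" unfolding p_def by (intro poly_fun_prod poly_fun_scale q)
    show "p x \<noteq> 0" unfolding p_def using assms(2) q(3) by simp
    show "p (\<zeta> *s v) = 0" if "\<zeta> \<in> \<Xi>" "v \<in> V" for \<zeta> v
      unfolding p_def
    proof (rule prod_zero[OF assms(2)], rule bexI[OF _ that(1)])
      show "q \<zeta> (inverse \<zeta> *s (\<zeta> *s v)) = 0"
        using q(2)[OF that] assms(3)[OF that(1)] by (simp add: vector_smult_assoc)
    qed
  qed
qed

lemma poly_eqI_nonzero:
  fixes P Q :: "complex poly"
  assumes "\<And>c. c \<noteq> 0 \<Longrightarrow> poly P c = poly Q c"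
  shows "P = Q"
proof (rule ccontr)
  assume "P \<noteq> Q"
  then have "finite {c. poly (P - Q) c = 0}" by (intro poly_roots_finite) simp
  moreover have "UNIV - {0} \<subseteq> {c. poly (P - Q) c = 0}" using assms by auto
  ultimately have "finite (UNIV - {0 :: complex})" by (rule finite_subset[rotated])
  then show False by (simp add: infinite_UNIV_char_0)
qed

lemma poly_fun_radial:
  assumes "\<And>x. p x = (\<Sum>d\<le>D. form d T x)"
  shows "p (c *s x) = poly (\<Sum>d\<le>D. monom (form d T x) d) c"
  by (simp add: assms form_scale poly_sum poly_monom mult.commute)

lemma coeff_radial: "coeff (\<Sum>d\<le>D. monom (h d) d) j = (if j \<le> D then h j else 0)"
  by (simp add: coeff_sum sum.delta)

text \<open>
  A homogeneous function of degree \<open>k\<close> that is a quotient \<open>a / s\<close> near the vertex of the cone is a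
  polynomial: compare the coefficients of \<open>c ^ k\<close> along each ray, where \<open>s\<close> contributes only its
  constant term.
\<close>

lemma homogeneous_of_local:
  assumes "a \<in> poly_fun" "s \<in> poly_fun" "s 0 \<noteq> 0"
    and eq: "\<And>c x. c \<noteq> 0 \<Longrightarrow> x \<in> V \<Longrightarrow> a (c *s x) = c ^ k * s (c *s x)"
  obtains p where "p \<in> poly_fun" "\<And>c x. x \<in> V \<Longrightarrow> p (c *s x) = c ^ k"
proof -
  obtain D T where a: "\<And>x. a x = (\<Sum>d\<le>D. form d T x)" using poly_fun_forms[OF assms(1)] by blast
  obtain E S where s: "\<And>x. s x = (\<Sum>d\<le>E. form d S x)" using poly_fun_forms[OF assms(2)] by blast
  have form_k: "form k T x = s 0" if "x \<in> V" for x
  proof -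
    have "(\<Sum>d\<le>D. monom (form d T x) d) = monom 1 k * (\<Sum>d\<le>E. monom (form d S x) d)"
      by (rule poly_eqI_nonzero)
         (simp only: poly_mult poly_monom flip: poly_fun_radial[OF a] poly_fun_radial[OF s],
          simp add: eq that)
    then have "(if k \<le> D then form k T x else 0) = form 0 S x"
      using coeff_radial[of "\<lambda>d. form d T x" D k] coeff_radial[of "\<lambda>d. form d S x" E 0]
      by (simp add: coeff_monom_mult)
    also have "form 0 S x = s 0"
      using poly_fun_radial[OF s, of 0 x] coeff_radial[of "\<lambda>d. form d S x" E 0]
      by (simp add: poly_0_coeff_0)
    finally show ?thesis using assms(3) by (auto split: if_splits)
  qed
  show thesis
  proof
    show "(\<lambda>x. inverse (s 0) * form k T x) \<in> poly_fun" by (intro poly_fun_cmult form_poly_fun)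
    show "inverse (s 0) * form k T (c *s x) = c ^ k" if "x \<in> V" for c x
      using form_k[OF that] assms(3) by (simp add: form_scale)
  qed
qed

lemma no_negative_degree:
  assumes "a \<in> poly_fun" "k > 0"
  shows "\<exists>c. c \<noteq> 0 \<and> c ^ k * a (c *s x) \<noteq> 1"
proof (rule ccontr)
  assume "\<not> ?thesis"
  then have *: "c ^ k * a (c *s x) = 1" if "c \<noteq> 0" for c using that by blast
  obtain D T where a: "\<And>x. a x = (\<Sum>d\<le>D. form d T x)" using poly_fun_forms[OF assms(1)] by blast
  have "monom 1 k * (\<Sum>d\<le>D. monom (form d T x) d) = 1"
    by (rule poly_eqI_nonzero)
       (simp only: poly_mult poly_monom poly_1 flip: poly_fun_radial[OF a], simp add: *)
  then have "poly (monom 1 k * (\<Sum>d\<le>D. monom (form d T x) d)) 0 = 1" by simp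
  then show False using assms(2) by (simp add: poly_monom power_0_left)
qed

locale cone_slice =
  fixes V :: "(complex ^ 'n::finite) set" and \<phi> :: "complex ^ 'n \<Rightarrow> complex" and e :: nat
  assumes closed: "zariski_closed V" and phi: "\<phi> \<in> poly_fun" and e: "e > 0"
    and phi_scale: "c \<noteq> 0 \<Longrightarrow> x \<in> V \<Longrightarrow> \<phi> (c *s x) = c ^ e"
begin

lemma phi_scale_closure:
  assumes "x \<in> zariski_closure (punctured_cone V)" "c \<noteq> 0"
  shows "\<phi> (c *s x) = c ^ e * \<phi> x"
proof (rule poly_eq_on_closure[OF _ _ _ assms(1)])
  show "(\<lambda>x. \<phi> (c *s x)) \<in> poly_fun" "(\<lambda>x. c ^ e * \<phi> x) \<in> poly_fun"
    by (intro poly_fun_scale poly_fun_cmult phi)+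
  show "\<phi> (c *s y) = c ^ e * \<phi> y" if "y \<in> punctured_cone V" for y
    using that assms(2) by (elim in_coneE) (auto simp: phi_scale vector_smult_assoc power_mult_distrib)
qed

lemma phi_cone_nonzero: "y \<in> punctured_cone V \<Longrightarrow> \<phi> y \<noteq> 0"
  by (elim in_coneE) (simp add: phi_scale)

text \<open>
  The components of degree congruent to \<open>r\<close> modulo \<open>e\<close>, raised to the common degree \<open>r\<close> by powers of
  \<open>\<phi>\<close>. The subtraction \<open>r - j\<close> is exact as soon as \<open>D \<le> r\<close>.
\<close>

definition residue_part :: "nat \<Rightarrow> ('n list \<Rightarrow> complex) \<Rightarrow> nat \<Rightarrow> complex ^ 'n \<Rightarrow> complex" where
  "residue_part D T r y = (\<Sum>j | j \<le> D \<and> j mod e = r mod e. form j T y * \<phi> y ^ ((r - j) div e))"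

lemma residue_part_poly_fun: "residue_part D T r \<in> poly_fun"
proof -
  have "residue_part D T r = (\<lambda>y. \<Sum>j | j \<le> D \<and> j mod e = r mod e. form j T y * \<phi> y ^ ((r - j) div e))"
    by (auto simp: residue_part_def)
  then show ?thesis
    by (auto intro!: poly_fun_sum poly_fun.mult form_poly_fun poly_fun_power phi)
qed

lemma residue_part_scale:
  assumes "x \<in> V" "c \<noteq> 0" "r \<ge> D"
  shows "residue_part D T r (c *s x) = c ^ r * (\<Sum>j | j \<le> D \<and> j mod e = r mod e. form j T x)"
  unfolding residue_part_def sum_distrib_left
proof (intro sum.cong refl)
  fix j assume j: "j \<in> {j. j \<le> D \<and> j mod e = r mod e}"
  then have "e dvd r - j" using assms(3) by (metis (mono_tags, lifting) le_trans mem_Collect_eq mod_eq_dvd_iff_nat)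
  then have "e * ((r - j) div e) = r - j" by simp
  then have "\<phi> (c *s x) ^ ((r - j) div e) = c ^ (r - j)"
    by (simp add: phi_scale assms flip: power_mult)
  then show "form j T (c *s x) * \<phi> (c *s x) ^ ((r - j) div e) = c ^ r * form j T x"
    using j assms(3) by (simp add: form_scale mult_ac flip: power_add)
qed

text \<open>
  Averaging against the character \<open>\<zeta> \<mapsto> \<zeta> ^ r\<close> of the \<open>e\<close>-th roots of unity selects the degrees
  congruent to \<open>r\<close>.
\<close>

lemma residue_part_average:
  assumes "x \<in> V" "c \<noteq> 0" "r \<ge> D" and p: "\<And>x. p x = (\<Sum>d\<le>D. form d T x)"
  shows "of_nat e * residue_part D T r (c *s x)
    = c ^ r * (\<Sum>\<zeta> | \<zeta> ^ e = (1::complex). inverse \<zeta> ^ r * p (\<zeta> *s x))"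
proof -
  have "(\<Sum>\<zeta> | \<zeta> ^ e = (1::complex). inverse \<zeta> ^ r * p (\<zeta> *s x))
      = (\<Sum>\<zeta> | \<zeta> ^ e = (1::complex). \<Sum>j\<le>D. form j T x * inverse \<zeta> ^ (r - j))"
  proof (intro sum.cong refl)
    fix \<zeta> :: complex assume "\<zeta> \<in> {\<zeta>. \<zeta> ^ e = 1}"
    then have z: "\<zeta> \<noteq> 0" using e by (auto simp: power_0_left)
    have "inverse \<zeta> ^ r * \<zeta> ^ j = inverse \<zeta> ^ (r - j)" if "j \<le> D" for j
    proof -
      have "inverse \<zeta> ^ r = inverse \<zeta> ^ (r - j) * inverse \<zeta> ^ j"
        using that assms(3) by (simp flip: power_add)
      then show ?thesis using z by (simp add: power_inverse)
    qed
    then have "inverse \<zeta> ^ r * (\<zeta> ^ j * form j T x) = form j T x * inverse \<zeta> ^ (r - j)" if "j \<le> D" for j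
      using that unfolding mult.assoc[symmetric] by (simp add: mult.commute)
    then show "inverse \<zeta> ^ r * p (\<zeta> *s x) = (\<Sum>j\<le>D. form j T x * inverse \<zeta> ^ (r - j))"
      unfolding p sum_distrib_left form_scale by (intro sum.cong) auto
  qed
  also have "\<dots> = (\<Sum>j\<le>D. form j T x * (\<Sum>\<zeta> | \<zeta> ^ e = (1::complex). inverse \<zeta> ^ (r - j)))"
    by (subst sum.swap) (simp add: sum_distrib_left)
  also have "\<dots> = (\<Sum>j\<le>D. if j mod e = r mod e then of_nat e * form j T x else 0)"
    unfolding sum_inverse_roots_unity[OF e]
  proof (intro sum.cong refl)
    fix j assume "j \<in> {..D}"
    then have "e dvd r - j \<longleftrightarrow> j mod e = r mod e"
      using assms(3) mod_eq_dvd_iff_nat[of j r e] by (auto simp: eq_commute)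
    then show "form j T x * (if e dvd r - j then of_nat e else 0)
        = (if j mod e = r mod e then of_nat e * form j T x else 0)" by simp
  qed
  also have "\<dots> = of_nat e * (\<Sum>j | j \<le> D \<and> j mod e = r mod e. form j T x)"
    unfolding sum_distrib_left
    by (subst sum.inter_filter[symmetric]) auto
  finally show ?thesis using residue_part_scale[OF assms(1-3)] by simp
qed

lemma exists_residue_part_nonzero:
  assumes p: "\<And>x. p x = (\<Sum>d\<le>D. form d T x)" and "p x \<noteq> 0"
  obtains r where "r \<ge> D" "(\<Sum>j | j \<le> D \<and> j mod e = r mod e. form j T x) \<noteq> 0"
proof -
  have "p x = (\<Sum>s<e. \<Sum>j | j \<in> {..D} \<and> j mod e = s. form j T x)"
    unfolding p using e by (intro sum.group[symmetric]) auto
  then obtain s where s: "s < e" "(\<Sum>j | j \<in> {..D} \<and> j mod e = s. form j T x) \<noteq> 0"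
    using assms(2) by (metis (no_types, lifting) lessThan_iff sum.neutral)
  show thesis
  proof
    show "s + D * e \<ge> D" using e by (simp add: trans_le_add2)
    show "(\<Sum>j | j \<le> D \<and> j mod e = (s + D * e) mod e. form j T x) \<noteq> 0" using s by simp
  qed
qed

text \<open>
  After scaling one may assume \<open>\<phi> x = 1\<close>. A point \<open>x\<close> outside the cone avoids the finitely many closed
  sets \<open>\<zeta> V\<close>, \<open>\<zeta> ^ e = 1\<close>, so a polynomial \<open>p\<close> vanishes on them and not at \<open>x\<close>. All residue parts of \<open>p\<close>
  vanish on the cone, hence on its closure, while at \<open>x\<close> the powers of \<open>\<phi>\<close> disappear and the residue
  parts add up to \<open>p x \<noteq> 0\<close>.
\<close>

lemma closure_nonzero_in_cone:
  assumes y: "y \<in> zariski_closure (punctured_cone V)" and "\<phi> y \<noteq> 0"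
  shows "y \<in> punctured_cone V"
proof -
  obtain t where t: "\<phi> y = t ^ e" using exists_complex_root[of e "\<phi> y"] e by blast
  have t0: "t \<noteq> 0" using t assms(2) e by (auto simp: power_0_left)
  define x where "x = inverse t *s y"
  have y_eq: "y = t *s x" using t0 by (simp add: x_def vector_smult_assoc)
  have x: "x \<in> zariski_closure (punctured_cone V)" unfolding x_def using closure_cone_scale[OF y] t0 by simp
  have phi_x: "\<phi> x = 1"
    unfolding x_def using phi_scale_closure[OF y, of "inverse t"] t0 by (simp add: t power_inverse)
  have "x \<in> punctured_cone V"
  proof (rule ccontr)
    assume nx: "x \<notin> punctured_cone V"
    have *: "inverse \<zeta> *s x \<notin> V" if "\<zeta> ^ e = 1" for \<zeta>
    proof
      have z: "\<zeta> \<noteq> 0" using that e by (auto simp: power_0_left)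
      assume "inverse \<zeta> *s x \<in> V"
      from in_coneI[OF z this] show False using nx z by (simp add: vector_smult_assoc)
    qed
    have nz: "\<zeta> \<noteq> 0" if "\<zeta> ^ e = 1" for \<zeta> :: complex using that e by (auto simp: power_0_left)
    have "finite {\<zeta>::complex. \<zeta> ^ e = 1}" using e by (intro finite_roots_unity) auto
    then obtain p where p: "p \<in> poly_fun" "p x \<noteq> 0" "\<And>\<zeta> v. \<zeta> ^ e = 1 \<Longrightarrow> v \<in> V \<Longrightarrow> p (\<zeta> *s v) = 0"
      using * nz by - (rule exists_separating_poly[OF closed, of "{\<zeta>. \<zeta> ^ e = 1}" x], auto)
    obtain D T where T: "\<And>x. p x = (\<Sum>d\<le>D. form d T x)" using poly_fun_forms[OF p(1)] by blast
    obtain r where r: "r \<ge> D" "(\<Sum>j | j \<le> D \<and> j mod e = r mod e. form j T x) \<noteq> 0"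
      using exists_residue_part_nonzero[OF T p(2)] by blast
    have "residue_part D T r z = 0" if "z \<in> punctured_cone V" for z
      using that
    proof (rule in_coneE)
      fix c v assume "c \<noteq> 0" "v \<in> V" "z = c *s v"
      then show ?thesis using residue_part_average[OF _ _ r(1) T, of v c] p(3) e by simp
    qed
    then have "residue_part D T r x = 0"
      using x residue_part_poly_fun unfolding in_zariski_closure_iff by blast
    then show False using r(2) phi_x by (simp add: residue_part_def)
  qed
  then show ?thesis unfolding y_eq by (rule cone_scale[OF _ t0])
qed

text \<open>
  The function \<open>c *s x \<mapsto> c ^ k\<close> on the cone is well defined by the hypothesis. If \<open>p\<close> vanishes on all
  \<open>\<zeta> V\<close> with \<open>\<zeta> ^ e = 1\<close> and \<open>\<zeta> ^ k \<noteq> 1\<close>, only roots of unity with \<open>\<zeta> ^ k = 1\<close> contribute to the averages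
  of \<open>p\<close>, so the residue parts for \<open>r\<close> and \<open>r + k\<close> differ exactly by the factor \<open>c ^ k\<close>. This writes the
  function locally as a quotient of polynomials.
\<close>

lemma exists_semi_invariant:
  assumes k: "\<And>c x. x \<in> V \<Longrightarrow> c *s x \<in> V \<Longrightarrow> c ^ k = 1"
  obtains p n where "p \<in> poly_fun" "\<And>c x. c \<noteq> 0 \<Longrightarrow> x \<in> V \<Longrightarrow> p (c *s x) = c ^ (k + e * n)"
proof -
  define g where "g = (\<lambda>y\<in>punctured_cone V. THE z. \<exists>c x. c \<noteq> 0 \<and> x \<in> V \<and> y = c *s x \<and> z = c ^ k)"
  have g: "g (c *s x) = c ^ k" if "c \<noteq> 0" "x \<in> V" for c x
  proof -
    have "(THE z. \<exists>d y. d \<noteq> 0 \<and> y \<in> V \<and> c *s x = d *s y \<and> z = d ^ k) = c ^ k"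
    proof (rule the_equality)
      show "\<exists>d y. d \<noteq> 0 \<and> y \<in> V \<and> c *s x = d *s y \<and> c ^ k = d ^ k" using that by blast
      fix z assume "\<exists>d y. d \<noteq> 0 \<and> y \<in> V \<and> c *s x = d *s y \<and> z = d ^ k"
      then obtain d y where d: "d \<noteq> 0" "y \<in> V" "c *s x = d *s y" "z = d ^ k" by blast
      have "(c / d) *s x = inverse d *s (c *s x)" by (simp add: vector_smult_assoc divide_inverse mult.commute)
      also have "\<dots> = y" unfolding d(3) using d(1) by (simp add: vector_smult_assoc)
      finally have "(c / d) ^ k = 1" using k[OF that(2), of "c / d"] d(2) by simp
      then show "z = c ^ k" using d by (simp add: power_divide)
    qed
    then show ?thesis unfolding g_def using in_coneI[OF that] by simp
  qed
  have "g \<in> regular_fun (punctured_cone V)"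
    unfolding regular_fun_def
  proof (intro CollectI conjI ballI)
    show "g \<in> extensional (punctured_cone V)" by (simp add: g_def)
    fix y0 assume "y0 \<in> punctured_cone V"
    then obtain c0 x0 where y0: "c0 \<noteq> 0" "x0 \<in> V" "y0 = c0 *s x0" by (rule in_coneE)
    define \<Xi> where "\<Xi> = {\<zeta>::complex. \<zeta> ^ e = 1 \<and> \<zeta> ^ k \<noteq> 1}"
    have "finite \<Xi>" using finite_subset[OF _ finite_roots_unity[of e]] e by (auto simp: \<Xi>_def)
    moreover have "\<zeta> \<noteq> 0" if "\<zeta> \<in> \<Xi>" for \<zeta> using that e by (auto simp: \<Xi>_def power_0_left)
    moreover have "inverse \<zeta> *s x0 \<notin> V" if "\<zeta> \<in> \<Xi>" for \<zeta>
      using k[OF y0(2), of "inverse \<zeta>"] that by (auto simp: \<Xi>_def power_inverse)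
    ultimately obtain p where p: "p \<in> poly_fun" "p x0 \<noteq> 0" "\<And>\<zeta> v. \<zeta> \<in> \<Xi> \<Longrightarrow> v \<in> V \<Longrightarrow> p (\<zeta> *s v) = 0"
      using exists_separating_poly[OF closed, of \<Xi> x0] by blast
    obtain D T where T: "\<And>x. p x = (\<Sum>d\<le>D. form d T x)" using poly_fun_forms[OF p(1)] by blast
    obtain r where r: "r \<ge> D" "(\<Sum>j | j \<le> D \<and> j mod e = r mod e. form j T x0) \<noteq> 0"
      using exists_residue_part_nonzero[OF T p(2)] by blast
    define P where "P = residue_part D T (r + k)"
    define Q where "Q = residue_part D T r"
    have PQ: "P (c *s x) = c ^ k * Q (c *s x)" if "c \<noteq> 0" "x \<in> V" for c x
    proof -
      have "inverse \<zeta> ^ (r + k) * p (\<zeta> *s x) = inverse \<zeta> ^ r * p (\<zeta> *s x)" if "\<zeta> ^ e = 1" for \<zeta>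
        using p(3)[of \<zeta> x] that \<open>x \<in> V\<close> by (cases "\<zeta> ^ k = 1") (auto simp: \<Xi>_def power_add power_inverse)
      then have "(\<Sum>\<zeta> | \<zeta> ^ e = 1. inverse \<zeta> ^ (r + k) * p (\<zeta> *s x))
          = (\<Sum>\<zeta> | \<zeta> ^ e = 1. inverse \<zeta> ^ r * p (\<zeta> *s x))" by (intro sum.cong) auto
      then have "of_nat e * P (c *s x) = c ^ k * (of_nat e * Q (c *s x))"
        unfolding P_def Q_def
        using residue_part_average[OF that(2,1) _ T, of r] residue_part_average[OF that(2,1) _ T, of "r + k"] r(1)
        by (simp add: power_add)
      then show ?thesis using e by simp
    qed
    have "zariski_closed (- {y. Q y \<noteq> 0})"
      unfolding zariski_closed_def Q_def
      by (rule exI[of _ "{residue_part D T r}"]) (auto simp: residue_part_poly_fun)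
    moreover have "y0 \<in> {y. Q y \<noteq> 0}"
      using residue_part_scale[OF y0(2,1) r(1)] r(2) y0 by (simp add: Q_def)
    moreover have "P \<in> poly_fun" "Q \<in> poly_fun" by (simp_all add: P_def Q_def residue_part_poly_fun)
    moreover have "\<forall>y\<in>{y. Q y \<noteq> 0} \<inter> punctured_cone V. Q y \<noteq> 0 \<and> g y = P y / Q y"
      by (auto elim!: in_coneE simp: g PQ)
    ultimately show "\<exists>U. zariski_closed (- U) \<and> y0 \<in> U \<and>
        (\<exists>p\<in>poly_fun. \<exists>q\<in>poly_fun. \<forall>y\<in>U \<inter> punctured_cone V. q y \<noteq> 0 \<and> g y = p y / q y)"
      by blast
  qed
  then obtain p n where p: "p \<in> poly_fun" "\<And>y. y \<in> punctured_cone V \<Longrightarrow> g y = p y / \<phi> y ^ n"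
    using regular_fun_eq_fraction[OF phi phi_cone_nonzero closure_nonzero_in_cone] by blast
  have "p (c *s x) = c ^ (k + e * n)" if "c \<noteq> 0" "x \<in> V" for c x
    using p(2)[OF in_coneI[OF that]] g[OF that] phi_scale[OF that] that
    by (simp add: power_add power_mult field_simps)
  then show thesis by (rule that[OF p(1)])
qed

end

section \<open>Fractions over a domain\<close>

lemma UN2_const:
  assumes "(a0, s0) \<in> A" "(b0, t0) \<in> B" "\<And>a s b t. (a, s) \<in> A \<Longrightarrow> (b, t) \<in> B \<Longrightarrow> f a s b t = C"
  shows "(\<Union>(a, s)\<in>A. \<Union>(b, t)\<in>B. f a s b t) = C"
  using assms by fastforce

locale localized_domain = domain R for R (structure) +
  fixes S
  assumes S_sub: "S \<subseteq> carrier R - {\<zero>}" and S_one: "\<one> \<in> S"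
    and S_mult: "s \<in> S \<Longrightarrow> t \<in> S \<Longrightarrow> s \<otimes> t \<in> S"
begin

abbreviation L where "L \<equiv> localization R S"
abbreviation frac where "frac \<equiv> fraction R S"

lemma S_carr [simp]: "s \<in> S \<Longrightarrow> s \<in> carrier R"
  using S_sub by blast

lemma S_nonzero: "s \<in> S \<Longrightarrow> s \<noteq> \<zero>"
  using S_sub by blast

text \<open>
  In a domain the extra factor in the definition of the relation can be cancelled.
\<close>

lemma frac_rel_iff:
  "((a, s), (b, t)) \<in> frac_rel R S \<longleftrightarrow>
     a \<in> carrier R \<and> b \<in> carrier R \<and> s \<in> S \<and> t \<in> S \<and> t \<otimes> a = s \<otimes> b"
  unfolding frac_rel_def using S_one S_nonzero m_lcancel S_carr by fastforce

lemma equiv_frac_rel: "equiv (carrier R \<times> S) (frac_rel R S)"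
proof (rule equivI)
  show "frac_rel R S \<subseteq> (carrier R \<times> S) \<times> (carrier R \<times> S)"
    unfolding frac_rel_def by auto
  show "refl_on (carrier R \<times> S) (frac_rel R S)"
    by (rule refl_onI) (auto simp: frac_rel_iff)
  show "sym (frac_rel R S)"
    by (rule symI) (auto simp: frac_rel_iff)
  show "trans (frac_rel R S)"
  proof (rule transI, clarify)
    fix a s b t c u assume "((a, s), (b, t)) \<in> frac_rel R S" "((b, t), (c, u)) \<in> frac_rel R S"
    then have *: "a \<in> carrier R" "b \<in> carrier R" "c \<in> carrier R" "s \<in> S" "t \<in> S" "u \<in> S"
      "t \<otimes> a = s \<otimes> b" "u \<otimes> b = t \<otimes> c" by (auto simp: frac_rel_iff)
    have "t \<otimes> (u \<otimes> a) = u \<otimes> (t \<otimes> a)" using *(1-6) by (simp add: m_lcomm)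
    also have "\<dots> = s \<otimes> (u \<otimes> b)" unfolding *(7) using *(1-6) by (simp add: m_lcomm)
    also have "\<dots> = t \<otimes> (s \<otimes> c)" unfolding *(8) using *(1-6) by (simp add: m_lcomm)
    finally have "u \<otimes> a = s \<otimes> c" using * S_nonzero m_lcancel by simp
    then show "((a, s), (c, u)) \<in> frac_rel R S" using * by (simp add: frac_rel_iff)
  qed
qed

lemma frac_eq_iff:
  assumes "a \<in> carrier R" "b \<in> carrier R" "s \<in> S" "t \<in> S"
  shows "frac a s = frac b t \<longleftrightarrow> t \<otimes> a = s \<otimes> b"
  unfolding fraction_def
  using eq_equiv_class_iff[OF equiv_frac_rel, of "(a, s)" "(b, t)"] assms by (simp add: frac_rel_iff)

lemma in_fracD:
  assumes "(a', s') \<in> frac a s"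
  shows "a' \<in> carrier R" "s' \<in> S" "s' \<otimes> a = s \<otimes> a'"
  using assms unfolding fraction_def by (auto simp: frac_rel_iff)

lemma in_frac_self: "a \<in> carrier R \<Longrightarrow> s \<in> S \<Longrightarrow> (a, s) \<in> frac a s"
  unfolding fraction_def by (simp add: frac_rel_iff)

lemma carrier_localization: "carrier L = {frac a s | a s. a \<in> carrier R \<and> s \<in> S}"
  unfolding localization_def fraction_def quotient_def by auto

lemma frac_closed: "a \<in> carrier R \<Longrightarrow> s \<in> S \<Longrightarrow> frac a s \<in> carrier L"
  by (auto simp: carrier_localization)

lemma frac_cases:
  assumes "x \<in> carrier L"
  obtains a s where "a \<in> carrier R" "s \<in> S" "x = frac a s"
  using assms by (auto simp: carrier_localization)

lemma one_localization: "\<one>\<^bsub>L\<^esub> = frac \<one> \<one>" and zero_localization: "\<zero>\<^bsub>L\<^esub> = frac \<zero> \<one>"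
  by (simp_all add: localization_def)

lemma mult_frac:
  assumes "a \<in> carrier R" "b \<in> carrier R" "s \<in> S" "t \<in> S"
  shows "frac a s \<otimes>\<^bsub>L\<^esub> frac b t = frac (a \<otimes> b) (s \<otimes> t)"
proof -
  have "(\<Union>(a', s')\<in>frac a s. \<Union>(b', t')\<in>frac b t. frac (a' \<otimes> b') (s' \<otimes> t')) = frac (a \<otimes> b) (s \<otimes> t)"
  proof (rule UN2_const)
    fix a' s' b' t' assume "(a', s') \<in> frac a s" "(b', t') \<in> frac b t"
    then have *: "a' \<in> carrier R" "b' \<in> carrier R" "s' \<in> S" "t' \<in> S"
      "s' \<otimes> a = s \<otimes> a'" "t' \<otimes> b = t \<otimes> b'" using in_fracD by blast+
    have "(s \<otimes> t) \<otimes> (a' \<otimes> b') = (s \<otimes> a') \<otimes> (t \<otimes> b')" using *(1-4) assms by (simp add: m_ac)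
    also have "\<dots> = (s' \<otimes> t') \<otimes> (a \<otimes> b)" unfolding *(5,6)[symmetric] using *(1-4) assms by (simp add: m_ac)
    finally show "frac (a' \<otimes> b') (s' \<otimes> t') = frac (a \<otimes> b) (s \<otimes> t)"
      using * assms S_mult by (subst frac_eq_iff) auto
  qed (use in_frac_self assms in auto)
  then show ?thesis by (simp add: localization_def)
qed

lemma add_frac:
  assumes "a \<in> carrier R" "b \<in> carrier R" "s \<in> S" "t \<in> S"
  shows "frac a s \<oplus>\<^bsub>L\<^esub> frac b t = frac ((a \<otimes> t) \<oplus> (b \<otimes> s)) (s \<otimes> t)"
proof -
  have "(\<Union>(a', s')\<in>frac a s. \<Union>(b', t')\<in>frac b t. frac ((a' \<otimes> t') \<oplus> (b' \<otimes> s')) (s' \<otimes> t'))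
      = frac ((a \<otimes> t) \<oplus> (b \<otimes> s)) (s \<otimes> t)"
  proof (rule UN2_const)
    fix a' s' b' t' assume "(a', s') \<in> frac a s" "(b', t') \<in> frac b t"
    then have *: "a' \<in> carrier R" "b' \<in> carrier R" "s' \<in> S" "t' \<in> S"
      "s' \<otimes> a = s \<otimes> a'" "t' \<otimes> b = t \<otimes> b'" using in_fracD by blast+
    have "(s \<otimes> t) \<otimes> ((a' \<otimes> t') \<oplus> (b' \<otimes> s')) = (s \<otimes> a') \<otimes> (t \<otimes> t') \<oplus> (t \<otimes> b') \<otimes> (s \<otimes> s')"
      using *(1-4) assms by (simp add: r_distr m_ac)
    also have "\<dots> = (s' \<otimes> t') \<otimes> ((a \<otimes> t) \<oplus> (b \<otimes> s))"
      unfolding *(5,6)[symmetric] using *(1-4) assms by (simp add: r_distr m_ac)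
    finally show "frac ((a' \<otimes> t') \<oplus> (b' \<otimes> s')) (s' \<otimes> t') = frac ((a \<otimes> t) \<oplus> (b \<otimes> s)) (s \<otimes> t)"
      using * assms S_mult by (subst frac_eq_iff) auto
  qed (use in_frac_self assms in auto)
  then show ?thesis by (simp add: localization_def)
qed

lemma cring_localization: "cring L"
proof (rule cringI)
  show "abelian_group L"
  proof (rule abelian_groupI)
    fix x y z assume "x \<in> carrier L" "y \<in> carrier L" "z \<in> carrier L"
    then obtain a s b t c u where *: "a \<in> carrier R" "s \<in> S" "x = frac a s"
      "b \<in> carrier R" "t \<in> S" "y = frac b t" "c \<in> carrier R" "u \<in> S" "z = frac c u"
      by (metis frac_cases)
    show "x \<oplus>\<^bsub>L\<^esub> y \<oplus>\<^bsub>L\<^esub> z = x \<oplus>\<^bsub>L\<^esub> (y \<oplus>\<^bsub>L\<^esub> z)"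
      using * by (simp add: add_frac S_mult l_distr r_distr m_ac a_ac)
  next
    fix x y assume "x \<in> carrier L" "y \<in> carrier L"
    then obtain a s b t where *: "a \<in> carrier R" "s \<in> S" "x = frac a s"
      "b \<in> carrier R" "t \<in> S" "y = frac b t" by (metis frac_cases)
    show "x \<oplus>\<^bsub>L\<^esub> y \<in> carrier L" using * by (simp add: add_frac frac_closed S_mult)
    show "x \<oplus>\<^bsub>L\<^esub> y = y \<oplus>\<^bsub>L\<^esub> x" using * by (simp add: add_frac m_comm a_comm)
  next
    show "\<zero>\<^bsub>L\<^esub> \<in> carrier L" by (simp add: zero_localization frac_closed S_one)
  next
    fix x assume "x \<in> carrier L"
    then obtain a s where *: "a \<in> carrier R" "s \<in> S" "x = frac a s" by (metis frac_cases)
    show "\<zero>\<^bsub>L\<^esub> \<oplus>\<^bsub>L\<^esub> x = x" using * by (simp add: zero_localization add_frac S_one)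
    have "frac (\<ominus> a) s \<oplus>\<^bsub>L\<^esub> x = \<zero>\<^bsub>L\<^esub>"
      using * by (simp add: zero_localization add_frac S_one S_mult frac_eq_iff l_minus l_neg)
    then show "\<exists>y\<in>carrier L. y \<oplus>\<^bsub>L\<^esub> x = \<zero>\<^bsub>L\<^esub>" using * frac_closed by blast
  qed
  show "comm_monoid L"
  proof (rule comm_monoidI)
    fix x y z assume "x \<in> carrier L" "y \<in> carrier L" "z \<in> carrier L"
    then obtain a s b t c u where *: "a \<in> carrier R" "s \<in> S" "x = frac a s"
      "b \<in> carrier R" "t \<in> S" "y = frac b t" "c \<in> carrier R" "u \<in> S" "z = frac c u"
      by (metis frac_cases)
    show "x \<otimes>\<^bsub>L\<^esub> y \<otimes>\<^bsub>L\<^esub> z = x \<otimes>\<^bsub>L\<^esub> (y \<otimes>\<^bsub>L\<^esub> z)"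
      using * by (simp add: mult_frac S_mult m_ac)
  next
    fix x y assume "x \<in> carrier L" "y \<in> carrier L"
    then obtain a s b t where *: "a \<in> carrier R" "s \<in> S" "x = frac a s"
      "b \<in> carrier R" "t \<in> S" "y = frac b t" by (metis frac_cases)
    show "x \<otimes>\<^bsub>L\<^esub> y \<in> carrier L" using * by (simp add: mult_frac frac_closed S_mult)
    show "x \<otimes>\<^bsub>L\<^esub> y = y \<otimes>\<^bsub>L\<^esub> x" using * by (simp add: mult_frac m_comm)
  next
    show "\<one>\<^bsub>L\<^esub> \<in> carrier L" by (simp add: one_localization frac_closed S_one)
  next
    fix x assume "x \<in> carrier L"
    then obtain a s where *: "a \<in> carrier R" "s \<in> S" "x = frac a s" by (metis frac_cases)
    show "\<one>\<^bsub>L\<^esub> \<otimes>\<^bsub>L\<^esub> x = x" using * by (simp add: one_localization mult_frac S_one)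
  qed
  fix x y z assume "x \<in> carrier L" "y \<in> carrier L" "z \<in> carrier L"
  then obtain a s b t c u where *: "a \<in> carrier R" "s \<in> S" "x = frac a s"
    "b \<in> carrier R" "t \<in> S" "y = frac b t" "c \<in> carrier R" "u \<in> S" "z = frac c u"
    by (metis frac_cases)
  show "(x \<oplus>\<^bsub>L\<^esub> y) \<otimes>\<^bsub>L\<^esub> z = x \<otimes>\<^bsub>L\<^esub> z \<oplus>\<^bsub>L\<^esub> y \<otimes>\<^bsub>L\<^esub> z"
    using * by (simp add: add_frac mult_frac S_mult frac_eq_iff l_distr r_distr m_ac)
qed

lemma pow_closed: "s \<in> S \<Longrightarrow> s [^] (n :: nat) \<in> S"
  by (induction n) (auto simp: S_one S_mult)

lemma frac_pow:
  assumes "a \<in> carrier R" "s \<in> S"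
  shows "frac a s [^]\<^bsub>L\<^esub> (n :: nat) = frac (a [^] n) (s [^] n)"
  using assms by (induction n) (auto simp: one_localization mult_frac pow_closed)

end

lemma (in domain) localized_domain_nonzero: "localized_domain R (carrier R - {\<zero>})"
  by unfold_locales (auto simp: integral_iff)

text \<open>
  The fraction \<open>F / G\<close> is a root of the monic polynomial \<open>T ^ e - c\<close>, so it lies in the ring.
\<close>

lemma integrally_closed_domainD:
  fixes L (structure)
  assumes L: "integrally_closed_domain L"
    and carr: "F \<in> carrier L" "G \<in> carrier L" "c \<in> carrier L" "G \<noteq> \<zero>"
    and "e > 0" and eq: "F [^] e = c \<otimes> G [^] (e :: nat)"
  shows "\<exists>a\<in>carrier L. F = a \<otimes> G"
proof -
  interpret domain L using L by (simp add: integrally_closed_domain_def)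
  interpret Q: localized_domain L "carrier L - {\<zero>}" by (rule localized_domain_nonzero)
  define Q where "Q = fraction_field L"
  have Q: "Q = Q.L" by (simp add: Q_def fraction_field_def)
  interpret Q': cring Q unfolding Q by (rule Q.cring_localization)
  have G: "G \<in> carrier L - {\<zero>}" and one: "\<one> \<in> carrier L - {\<zero>}" using carr by auto
  define x where "x = Q.frac F G"
  have x: "x \<in> carrier Q" unfolding x_def Q by (rule Q.frac_closed[OF carr(1) G])
  define b where "b = Q.frac (\<ominus> c) \<one>"
  have b: "b \<in> embedded_ring L" unfolding b_def embedded_ring_def using carr by auto
  have emb: "embedded_ring L \<subseteq> carrier Q"
    unfolding embedded_ring_def Q using Q.frac_closed one by auto
  define p where "p = \<one>\<^bsub>Q\<^esub> # replicate (e - 1) \<zero>\<^bsub>Q\<^esub> @ [b]"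
  have one_zero: "\<one>\<^bsub>Q\<^esub> \<in> embedded_ring L" "\<zero>\<^bsub>Q\<^esub> \<in> embedded_ring L"
    unfolding Q Q.one_localization Q.zero_localization embedded_ring_def by auto
  have "\<one>\<^bsub>Q\<^esub> \<noteq> \<zero>\<^bsub>Q\<^esub>"
    unfolding Q Q.one_localization Q.zero_localization
    using Q.frac_eq_iff[of \<one> \<zero> \<one> \<one>] one by simp
  then have poly: "polynomial\<^bsub>Q\<^esub> (embedded_ring L) p"
    unfolding polynomial_def p_def using one_zero b by auto
  have "ring.eval Q p x = x [^]\<^bsub>Q\<^esub> e \<oplus>\<^bsub>Q\<^esub> b"
  proof -
    have bQ: "b \<in> carrier Q" using b emb by blast
    have "ring.eval Q p x = ring.eval Q ([\<one>\<^bsub>Q\<^esub>] @ (replicate (e - 1) \<zero>\<^bsub>Q\<^esub> @ [b])) x"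
      by (simp add: p_def)
    also have "\<dots> = ring.eval Q [\<one>\<^bsub>Q\<^esub>] x \<otimes>\<^bsub>Q\<^esub> x [^]\<^bsub>Q\<^esub> e
        \<oplus>\<^bsub>Q\<^esub> ring.eval Q (replicate (e - 1) \<zero>\<^bsub>Q\<^esub> @ [b]) x"
      using \<open>e > 0\<close> by (subst Q'.eval_append) (use x bQ in auto)
    also have "ring.eval Q (replicate (e - 1) \<zero>\<^bsub>Q\<^esub> @ [b]) x = b"
      using Q'.eval_replicate[of "[b]" x "e - 1"] x bQ by simp
    also have "ring.eval Q [\<one>\<^bsub>Q\<^esub>] x = \<one>\<^bsub>Q\<^esub>" using x by simp
    finally show ?thesis using x by simp
  qed
  also have "x [^]\<^bsub>Q\<^esub> e = Q.frac (F [^] e) (G [^] e)"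
    unfolding x_def Q using Q.frac_pow[OF carr(1) G] .
  also have "Q.frac (F [^] e) (G [^] e) \<oplus>\<^bsub>Q\<^esub> b = \<zero>\<^bsub>Q\<^esub>"
    unfolding Q b_def Q.zero_localization
    using carr Q.pow_closed[OF G, of e] one Q.S_mult[OF Q.pow_closed[OF G, of e] one]
    by (simp add: Q.add_frac Q.frac_eq_iff eq l_minus r_neg)
  finally have "integral_over Q (embedded_ring L) x"
    unfolding integral_over_def using poly by (intro exI[of _ p]) (auto simp: p_def)
  then have "x \<in> embedded_ring L"
    using L x unfolding integrally_closed_domain_def Q_def by blast
  then obtain a where a: "a \<in> carrier L" "x = Q.frac a \<one>" unfolding embedded_ring_def by blast
  then have "\<one> \<otimes> F = G \<otimes> a"
    using Q.frac_eq_iff[OF carr(1) a(1) G one] by (simp add: x_def)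
  then show ?thesis using a(1) carr m_comm by auto
qed

lemma valuation_ringD:
  fixes R (structure)
  assumes R: "valuation_ring R"
    and carr: "F \<in> carrier R" "G \<in> carrier R" "F \<noteq> \<zero>" "G \<noteq> \<zero>"
  shows "(\<exists>a\<in>carrier R. F = a \<otimes> G) \<or> (\<exists>a\<in>carrier R. G = a \<otimes> F)"
proof -
  interpret domain R using R by (simp add: valuation_ring_def)
  interpret Q: localized_domain R "carrier R - {\<zero>}" by (rule localized_domain_nonzero)
  interpret Q': cring Q.L by (rule Q.cring_localization)
  have F: "F \<in> carrier R - {\<zero>}" and G: "G \<in> carrier R - {\<zero>}" and one: "\<one> \<in> carrier R - {\<zero>}"
    using carr by auto
  define x where "x = Q.frac F G"
  define y where "y = Q.frac G F"
  have x: "x \<in> carrier Q.L" "x \<noteq> \<zero>\<^bsub>Q.L\<^esub>" and y: "y \<in> carrier Q.L"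
    unfolding x_def y_def Q.zero_localization
    using Q.frac_closed[OF carr(1) G] Q.frac_closed[OF carr(2) F] Q.frac_eq_iff[OF carr(1) _ G one, of \<zero>] carr
    by auto
  have "x \<otimes>\<^bsub>Q.L\<^esub> y = \<one>\<^bsub>Q.L\<^esub>"
    unfolding x_def y_def Q.one_localization
    using carr F G one Q.S_mult[OF G F] by (simp add: Q.mult_frac Q.frac_eq_iff m_comm)
  then have "inv\<^bsub>Q.L\<^esub> x = y" using x y Q'.comm_inv_char by blast
  then have "x \<in> embedded_ring R \<or> y \<in> embedded_ring R"
    using R x unfolding valuation_ring_def fraction_field_def by auto
  then show ?thesis
  proof
    assume "x \<in> embedded_ring R"
    then obtain a where a: "a \<in> carrier R" "Q.frac F G = Q.frac a \<one>"
      unfolding embedded_ring_def x_def by blast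
    then have "\<one> \<otimes> F = G \<otimes> a" using Q.frac_eq_iff[OF carr(1) a(1) G one] by simp
    then show ?thesis using a(1) carr m_comm by auto
  next
    assume "y \<in> embedded_ring R"
    then obtain a where a: "a \<in> carrier R" "Q.frac G F = Q.frac a \<one>"
      unfolding embedded_ring_def y_def by blast
    then have "\<one> \<otimes> G = F \<otimes> a" using Q.frac_eq_iff[OF carr(2) a(1) F one] by simp
    then show ?thesis using a(1) carr m_comm by auto
  qed
qed

section \<open>The group action on tensors\<close>

lemma sum_prod3: "(\<Sum>c\<in>UNIV. case c of (i :: 'm::finite, j :: 'm, k :: 'm) \<Rightarrow> f i j k) = (\<Sum>i\<in>UNIV. \<Sum>j\<in>UNIV. \<Sum>k\<in>UNIV. f i j k)"
  by (simp add: sum.cartesian_product flip: UNIV_Times_UNIV)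

lemma kronecker3_nth:
  "kronecker3 A B C $ (i, j, k) $ (i', j', k') = A $ i $ i' * B $ j $ j' * C $ k $ k'"
  by (simp add: kronecker3_def)

lemma kronecker3_mult:
  "kronecker3 A B C ** kronecker3 A' B' C' = kronecker3 (A ** A') (B ** B') (C ** C')"
proof -
  have "(kronecker3 A B C ** kronecker3 A' B' C') $ (i, j, k) $ (i', j', k') =
      kronecker3 (A ** A') (B ** B') (C ** C') $ (i, j, k) $ (i', j', k')" for i j k i' j' k'
  proof -
    have "(kronecker3 A B C ** kronecker3 A' B' C') $ (i, j, k) $ (i', j', k')
      = (\<Sum>c\<in>UNIV. case c of (a, b, d) \<Rightarrow>
          (A $ i $ a * A' $ a $ i') * ((B $ j $ b * B' $ b $ j') * (C $ k $ d * C' $ d $ k')))"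
      unfolding matrix_matrix_mult_def by (auto simp: kronecker3_nth intro!: sum.cong)
    also have "\<dots> = (\<Sum>a\<in>UNIV. A $ i $ a * A' $ a $ i') *
        ((\<Sum>b\<in>UNIV. B $ j $ b * B' $ b $ j') * (\<Sum>d\<in>UNIV. C $ k $ d * C' $ d $ k'))"
      unfolding sum_prod3 sum_distrib_left[symmetric] sum_distrib_right[symmetric] ..
    finally show ?thesis by (simp add: kronecker3_nth matrix_matrix_mult_def mult.assoc)
  qed
  then show ?thesis by (simp add: vec_eq_iff split_paired_all)
qed

lemma kronecker3_mat: "kronecker3 (mat a) (mat b) (mat c) = mat (a * b * c)"
  by (auto simp: vec_eq_iff kronecker3_nth mat_def)

lemma adjoint_kronecker3:
  "adjoint_matrix (kronecker3 A B C) = kronecker3 (adjoint_matrix A) (adjoint_matrix B) (adjoint_matrix C)"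
  by (auto simp: vec_eq_iff kronecker3_nth adjoint_matrix_def)

lemma det_adjoint: "det (adjoint_matrix A) = cnj (det A)"
proof -
  have "det (adjoint_matrix A) = det (transpose (adjoint_matrix A))" by (rule det_transpose[symmetric])
  also have "\<dots> = cnj (det A)"
    by (simp add: det_def adjoint_matrix_def transpose_def)
  finally show ?thesis .
qed

lemma mat_mult_vector: "mat (c :: complex) *v x = c *s x"
  by (simp add: vec_eq_iff matrix_vector_mult_def mat_def if_distrib[of "\<lambda>a. a * _"] sum.delta cong: if_cong)

lemma det_mat: "det (mat (c :: complex) :: complex ^ 'm ^ 'm) = c ^ CARD('m::finite)"
  by (subst det_diagonal) (auto simp: mat_def)

lemma act_mult: "act (A ** A', B ** B', C ** C') x = act (A, B, C) (act (A', B', C') x)"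
  by (simp add: act_def matrix_vector_mul_assoc kronecker3_mult)

lemma act_mat: "act (mat a, mat b, mat c) x = (a * b * c) *s x"
  by (simp add: act_def kronecker3_mat mat_mult_vector)

lemma act_scale: "act g (c *s x) = c *s act g x"
  by (cases g) (simp add: act_def vector_scalar_commute)

lemma GL3_iff: "(A, B, C) \<in> GL3 \<longleftrightarrow> det A \<noteq> 0 \<and> det B \<noteq> 0 \<and> det C \<noteq> 0"
  by (simp add: GL3_def invertible_det_nz)

lemma SL3_iff: "(A, B, C) \<in> SL3 \<longleftrightarrow> det A = 1 \<and> det B = 1 \<and> det C = 1"
  by (simp add: SL3_def)

text \<open>
  The scalar is a root of order \<open>CARD('m)\<close> of the determinant.
\<close>

lemma invertible_eq_scalar_mult_special:
  fixes A :: "complex ^ 'm::finite ^ 'm"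
  assumes "det A \<noteq> 0"
  obtains c B where "c \<noteq> 0" "c ^ CARD('m) = det A" "det B = 1" "A = mat c ** B"
proof -
  obtain c where c: "c \<noteq> 0" "det A = c ^ CARD('m)"
    using exists_complex_root_nonzero[OF assms, of "CARD('m)"] by auto
  have "det (mat (inverse c) ** A) = 1" using c by (simp add: det_mul det_mat power_inverse)
  moreover have "mat c ** (mat (inverse c) ** A) = A"
  proof -
    have "(mat c ** mat (inverse c) :: complex ^ 'm ^ 'm) = mat 1"
      using c(1) by (simp add: matrix_eq mat_mult_vector vector_smult_assoc flip: matrix_vector_mul_assoc)
    then show ?thesis by (simp add: matrix_mul_assoc)
  qed
  ultimately show thesis using that[of c "mat (inverse c) ** A"] c by simp
qed

lemma GL3_eq_scalar_SL3:
  fixes g :: "'m::finite triple"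
  assumes "g \<in> GL3"
  obtains c h where "c \<noteq> 0" "h \<in> SL3" "c ^ CARD('m) = det_char g" "\<And>x. act g x = c *s act h x"
proof -
  obtain A B C where g: "g = (A, B, C)" by (cases g)
  have "det A \<noteq> 0" "det B \<noteq> 0" "det C \<noteq> 0" using assms unfolding g GL3_iff by auto
  then obtain a A' b B' c C' where *: "a \<noteq> 0" "a ^ CARD('m) = det A" "det A' = 1" "A = mat a ** A'"
    "b \<noteq> 0" "b ^ CARD('m) = det B" "det B' = 1" "B = mat b ** B'"
    "c \<noteq> 0" "c ^ CARD('m) = det C" "det C' = 1" "C = mat c ** C'"
    using invertible_eq_scalar_mult_special by metis
  show thesis
  proof
    show "a * b * c \<noteq> 0" using * by simp
    show "(A', B', C') \<in> SL3" using * by (simp add: SL3_iff)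
    show "(a * b * c) ^ CARD('m) = det_char g"
      using *(2,6,10) by (simp add: g det_char_def power_mult_distrib)
    show "act g x = (a * b * c) *s act (A', B', C') x" for x
      unfolding g *(4,8,12) act_mult act_mat ..
  qed
qed

lemma scalar_SL3_in_GL3:
  fixes h :: "'m::finite triple"
  assumes "c \<noteq> 0" "h \<in> SL3"
  obtains g where "g \<in> GL3" "det_char g = c ^ CARD('m)" "\<And>x. act g x = c *s act h x"
proof -
  obtain A B C where h: "h = (A, B, C)" by (cases h)
  show thesis
  proof
    show "(mat c ** A, mat 1 ** B, mat 1 ** C) \<in> GL3"
      "det_char (mat c ** A, mat 1 ** B, mat 1 ** C) = c ^ CARD('m)"
      using assms by (auto simp: h SL3_iff GL3_iff det_mul det_mat det_char_def)
    show "act (mat c ** A, mat 1 ** B, mat 1 ** C) x = c *s act h x" for x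
      unfolding act_mult act_mat h by simp
  qed
qed

lemma GL3_mult:
  assumes "g \<in> GL3" "h \<in> GL3"
  obtains f where "f \<in> GL3" "det_char f = det_char g * det_char h" "\<And>x. act f x = act g (act h x)"
proof -
  obtain A B C A' B' C' where gh: "g = (A, B, C)" "h = (A', B', C')" by (cases g, cases h)
  show thesis
    using assms that[of "(A ** A', B ** B', C ** C')"]
    by (auto simp: gh GL3_iff det_mul det_char_def act_mult)
qed

lemma SL3_mult:
  assumes "g \<in> SL3" "h \<in> SL3"
  obtains f where "f \<in> SL3" "\<And>x. act f x = act g (act h x)"
proof -
  obtain A B C A' B' C' where gh: "g = (A, B, C)" "h = (A', B', C')" by (cases g, cases h)
  show thesis
    using assms that[of "(A ** A', B ** B', C ** C')"]
    by (auto simp: gh SL3_iff det_mul act_mult)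
qed

lemma SL3_one: "(mat 1, mat 1, mat 1) \<in> SL3" and act_one: "act (mat 1, mat 1, mat 1) x = x"
  by (simp_all add: SL3_iff act_mat)

lemma SL3_inverse:
  assumes "g \<in> SL3"
  obtains f where "f \<in> SL3" "\<And>x. act f (act g x) = x"
proof -
  obtain A B C where g: "g = (A, B, C)" by (cases g)
  have *: "\<exists>A'. det A' = 1 \<and> A' ** A = mat 1" if "det A = 1" for A :: "complex ^ 'a ^ 'a"
  proof -
    have "invertible A" using that by (simp add: invertible_det_nz)
    then obtain A' where A': "A' ** A = mat 1" unfolding invertible_def by blast
    then have "det A' * det A = 1" by (metis det_I det_mul)
    then show ?thesis using A' that by auto
  qed
  obtain A' B' C' where inv: "det A' = 1" "det B' = 1" "det C' = 1"
    "A' ** A = mat 1" "B' ** B = mat 1" "C' ** C = mat 1"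
    using *[of A] *[of B] *[of C] assms unfolding g SL3_iff by blast
  have "act (A', B', C') (act g x) = x" for x
    unfolding g act_mult[symmetric] inv by (rule act_one)
  then show thesis using that[of "(A', B', C')"] inv by (simp add: SL3_iff)
qed

lemma act_poly_fun: "p \<in> poly_fun \<Longrightarrow> (\<lambda>x. p (act g x)) \<in> poly_fun"
  by (cases g) (simp add: act_def poly_fun_matrix)

section \<open>Irreducibility of the orbit closure\<close>

lemma polynomial_functions_closed:
  fixes f g :: "complex \<Rightarrow> complex"
  shows "(\<lambda>t :: complex. c :: complex) \<in> range poly" "(\<lambda>t :: complex. t) \<in> range poly"
    and "f \<in> range poly \<Longrightarrow> g \<in> range poly \<Longrightarrow> (\<lambda>t. f t + g t) \<in> range poly"
    and "f \<in> range poly \<Longrightarrow> g \<in> range poly \<Longrightarrow> (\<lambda>t. f t * g t) \<in> range poly"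
proof -
  have "(\<lambda>t. c) = poly [:c:]" "(\<lambda>t. t) = poly [:0, 1 :: complex:]" by auto
  then show "(\<lambda>t :: complex. c) \<in> range poly" "(\<lambda>t :: complex. t) \<in> range poly" by simp_all
  assume "f \<in> range poly" "g \<in> range poly"
  then obtain p q where "f = poly p" "g = poly q" by auto
  then have "(\<lambda>t. f t + g t) = poly (p + q)" "(\<lambda>t. f t * g t) = poly (p * q)" by auto
  then show "(\<lambda>t. f t + g t) \<in> range poly" "(\<lambda>t. f t * g t) \<in> range poly" by simp_all
qed

lemma polynomial_functions_sum_prod:
  fixes f :: "'i \<Rightarrow> complex \<Rightarrow> complex"
  assumes "\<And>i. i \<in> I \<Longrightarrow> f i \<in> range poly"
  shows "(\<lambda>t. \<Sum>i\<in>I. f i t) \<in> range poly" "(\<lambda>t. \<Prod>i\<in>I. f i t) \<in> range poly"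
  using assms
  by (induction I rule: infinite_finite_induct) (auto intro: polynomial_functions_closed)

lemma poly_fun_curve:
  fixes \<gamma> :: "complex \<Rightarrow> complex ^ 'n::finite"
  assumes "p \<in> poly_fun" "\<And>i. (\<lambda>t. \<gamma> t $ i) \<in> range poly"
  shows "(\<lambda>t. p (\<gamma> t)) \<in> range poly"
  using assms(1) by induction (auto intro: polynomial_functions_closed assms(2))

definition matrix_line :: "complex ^ 'm ^ 'm \<Rightarrow> complex ^ 'm ^ 'm \<Rightarrow> complex \<Rightarrow> complex ^ 'm ^ 'm" where
  "matrix_line A B t = (\<chi> i j. A $ i $ j + t * (B $ i $ j - A $ i $ j))"

lemma matrix_line_ends: "matrix_line A B 0 = A" "matrix_line A B 1 = B"
  by (simp_all add: matrix_line_def vec_eq_iff)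

lemma matrix_line_entry: "(\<lambda>t. matrix_line A B t $ i $ j) \<in> range poly"
  by (simp add: matrix_line_def) (intro polynomial_functions_closed)

lemma det_matrix_line: "(\<lambda>t. det (matrix_line A B t)) \<in> range poly"
  unfolding det_def
  by (intro polynomial_functions_sum_prod polynomial_functions_closed matrix_line_entry)

lemma act_matrix_line:
  "(\<lambda>t. act (matrix_line A A' t, matrix_line B B' t, matrix_line C C' t) w $ i) \<in> range poly"
proof -
  obtain i1 i2 i3 where i: "i = (i1, i2, i3)" by (cases i)
  show ?thesis
    unfolding act_def matrix_vector_mult_def i
    by (simp add: kronecker3_def split_beta)
       (intro polynomial_functions_sum_prod polynomial_functions_closed matrix_line_entry)
qed

text \<open>
  The orbit is an image of the complement of a hypersurface in an affine space. If \<open>p\<close> and \<open>q\<close> are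
  nonzero at the images of \<open>g\<close> and \<open>h\<close>, then along the line through \<open>g\<close> and \<open>h\<close> the functions \<open>p\<close>, \<open>q\<close>
  and the determinant are nonzero polynomials in one variable, hence all nonzero at some point of the
  line.
\<close>

lemma orbit_irreducible:
  assumes p: "p \<in> poly_fun" and q: "q \<in> poly_fun"
    and zero: "\<And>y. y \<in> orbit w \<Longrightarrow> p y * q y = 0"
  shows "(\<forall>y\<in>orbit w. p y = 0) \<or> (\<forall>y\<in>orbit w. q y = 0)"
proof (rule ccontr)
  assume "\<not> ?thesis"
  then obtain g h where g: "g \<in> GL3" "p (act g w) \<noteq> 0" and h: "h \<in> GL3" "q (act h w) \<noteq> 0"
    by (auto simp: orbit_def)
  obtain A B C A' B' C' where gh: "g = (A, B, C)" "h = (A', B', C')" by (cases g, cases h)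
  define l where "l t = (matrix_line A A' t, matrix_line B B' t, matrix_line C C' t)" for t
  have l: "l 0 = g" "l 1 = h" by (simp_all add: l_def gh matrix_line_ends)
  have "(\<lambda>t. p (act (l t) w)) \<in> range poly" "(\<lambda>t. q (act (l t) w)) \<in> range poly"
    unfolding l_def by (rule poly_fun_curve[OF p act_matrix_line] poly_fun_curve[OF q act_matrix_line])+
  then obtain P Q where PQ: "\<And>t. p (act (l t) w) = poly P t" "\<And>t. q (act (l t) w) = poly Q t"
    by (auto simp: fun_eq_iff image_iff)
  have "(\<lambda>t. det_char (l t)) \<in> range poly"
    unfolding det_char_def l_def by simp (intro polynomial_functions_closed det_matrix_line)
  then obtain D where D: "\<And>t. det_char (l t) = poly D t"
    by (auto simp: fun_eq_iff image_iff)
  have "poly P 0 \<noteq> 0" "poly Q 1 \<noteq> 0" "poly D 0 \<noteq> 0"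
    using g h by (simp_all add: l GL3_iff det_char_def gh flip: PQ D)
  then have "P * Q * D \<noteq> 0" by auto
  then have "finite {t. poly (P * Q * D) t = 0}" by (rule poly_roots_finite)
  then obtain t where t: "poly (P * Q * D) t \<noteq> 0"
    using infinite_UNIV_char_0[where 'a = complex] by (metis (mono_tags, lifting) UNIV_eq_I mem_Collect_eq)
  then have "det_char (l t) \<noteq> 0" by (simp add: D)
  then have "l t \<in> GL3" by (simp add: l_def GL3_iff det_char_def)
  then have "act (l t) w \<in> orbit w" by (auto simp: orbit_def)
  then show False using zero t by (fastforce simp: PQ)
qed

section \<open>The coordinate ring\<close>

lemma coord_ring_simps [simp]:
  "carrier (coord_ring Z) = (\<lambda>p. restrict p Z) ` poly_fun"
  "f \<otimes>\<^bsub>coord_ring Z\<^esub> g = (\<lambda>x\<in>Z. f x * g x)"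
  "f \<oplus>\<^bsub>coord_ring Z\<^esub> g = (\<lambda>x\<in>Z. f x + g x)"
  "\<one>\<^bsub>coord_ring Z\<^esub> = (\<lambda>x\<in>Z. 1)"
  "\<zero>\<^bsub>coord_ring Z\<^esub> = (\<lambda>x\<in>Z. 0)"
  by (simp_all add: coord_ring_def function_ring_def)

lemma restrict_cong_iff: "restrict f Z = restrict g Z \<longleftrightarrow> (\<forall>x\<in>Z. f x = g x)"
  by (metis restrict_apply' restrict_ext)

lemma cring_coord_ring: "cring (coord_ring Z)"
proof (rule cringI)
  show "abelian_group (coord_ring Z)"
  proof (rule abelian_groupI)
    fix f assume "f \<in> carrier (coord_ring Z)"
    then obtain p where p: "p \<in> poly_fun" "f = restrict p Z" by auto
    have "restrict (\<lambda>x. (-1) * p x) Z \<in> carrier (coord_ring Z)"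
      using poly_fun_cmult[OF p(1), of "-1"] unfolding coord_ring_simps by (rule imageI)
    moreover have "restrict (\<lambda>x. (-1) * p x) Z \<oplus>\<^bsub>coord_ring Z\<^esub> f = \<zero>\<^bsub>coord_ring Z\<^esub>"
      unfolding coord_ring_simps p restrict_cong_iff by simp
    ultimately show "\<exists>g\<in>carrier (coord_ring Z). g \<oplus>\<^bsub>coord_ring Z\<^esub> f = \<zero>\<^bsub>coord_ring Z\<^esub>" by (intro bexI)
  next
    fix f g assume "f \<in> carrier (coord_ring Z)" "g \<in> carrier (coord_ring Z)"
    then obtain p q where p: "p \<in> poly_fun" "f = restrict p Z" "q \<in> poly_fun" "g = restrict q Z" by auto
    have "f \<oplus>\<^bsub>coord_ring Z\<^esub> g = restrict (\<lambda>x. p x + q x) Z" by (auto simp: p)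
    then show "f \<oplus>\<^bsub>coord_ring Z\<^esub> g \<in> carrier (coord_ring Z)"
      using poly_fun.add[OF p(1,3)] unfolding coord_ring_simps(1) by auto
  next
    show "\<zero>\<^bsub>coord_ring Z\<^esub> \<in> carrier (coord_ring Z)"
      using poly_fun.const[of 0] by auto
  qed (auto simp: restrict_cong_iff algebra_simps fun_eq_iff)
  show "comm_monoid (coord_ring Z)"
  proof (rule comm_monoidI)
    fix f g assume "f \<in> carrier (coord_ring Z)" "g \<in> carrier (coord_ring Z)"
    then obtain p q where p: "p \<in> poly_fun" "f = restrict p Z" "q \<in> poly_fun" "g = restrict q Z" by auto
    have "f \<otimes>\<^bsub>coord_ring Z\<^esub> g = restrict (\<lambda>x. p x * q x) Z" by (auto simp: p)
    then show "f \<otimes>\<^bsub>coord_ring Z\<^esub> g \<in> carrier (coord_ring Z)"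
      using poly_fun.mult[OF p(1,3)] unfolding coord_ring_simps(1) by auto
  next
    show "\<one>\<^bsub>coord_ring Z\<^esub> \<in> carrier (coord_ring Z)"
      using poly_fun.const[of 1] by auto
  qed (auto simp: restrict_cong_iff algebra_simps fun_eq_iff)
qed (auto simp: restrict_cong_iff algebra_simps fun_eq_iff)

lemma coord_ring_pow:
  "(f [^]\<^bsub>coord_ring Z\<^esub> (n :: nat)) = (\<lambda>x\<in>Z. f x ^ n)"
proof -
  interpret cring "coord_ring Z" by (rule cring_coord_ring)
  show ?thesis
  proof (induction n)
    case 0
    then show ?case using nat_pow_0[of f] by simp
  next
    case (Suc n)
    then show ?case using nat_pow_Suc[of f n] by (auto simp: mult.commute)
  qed
qed

lemma domain_coord_ring: "domain (coord_ring (orbit_closure w))"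
proof -
  define Z where "Z = orbit_closure w"
  interpret cring "coord_ring Z" by (rule cring_coord_ring)
  have "w \<in> orbit w"
    unfolding orbit_def
    by (rule image_eqI[of _ _ "(mat 1, mat 1, mat 1)"]) (simp_all add: GL3_iff act_one)
  then have w: "w \<in> Z" unfolding Z_def by (rule subset_zariski_closure)
  have "domain (coord_ring Z)"
  proof
    show "\<one>\<^bsub>coord_ring Z\<^esub> \<noteq> \<zero>\<^bsub>coord_ring Z\<^esub>"
      unfolding coord_ring_simps restrict_cong_iff using w by auto
    fix f g assume "f \<otimes>\<^bsub>coord_ring Z\<^esub> g = \<zero>\<^bsub>coord_ring Z\<^esub>" "f \<in> carrier (coord_ring Z)" "g \<in> carrier (coord_ring Z)"
    then obtain p q where p: "p \<in> poly_fun" "f = restrict p Z" "q \<in> poly_fun" "g = restrict q Z"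
      and zero: "\<forall>x\<in>Z. p x * q x = 0" by (auto simp: restrict_cong_iff)
    have "(\<forall>y\<in>orbit w. p y = 0) \<or> (\<forall>y\<in>orbit w. q y = 0)"
    proof (rule orbit_irreducible[OF p(1,3)])
      fix y assume "y \<in> orbit w"
      then show "p y * q y = 0" using zero subset_zariski_closure[of y "orbit w"] by (simp add: Z_def)
    qed
    then have "(\<forall>x\<in>Z. p x = 0) \<or> (\<forall>x\<in>Z. q x = 0)"
      using poly_eq_on_closure[OF p(1) poly_fun.const[of 0], of "orbit w"]
        poly_eq_on_closure[OF p(3) poly_fun.const[of 0], of "orbit w"] unfolding Z_def by blast
    then show "f = \<zero>\<^bsub>coord_ring Z\<^esub> \<or> g = \<zero>\<^bsub>coord_ring Z\<^esub>"
      unfolding p coord_ring_simps restrict_cong_iff by blast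
  qed
  then show ?thesis by (simp add: Z_def)
qed

section \<open>The orbit closure of a polystable tensor\<close>

text \<open>
  Multiplication by \<open>z\<close> permutes \<open>H\<close>, so it preserves the product of all elements.
\<close>

lemma finite_group_pow_card:
  fixes H :: "complex set"
  assumes "finite H" "0 \<notin> H" "\<And>x y. x \<in> H \<Longrightarrow> y \<in> H \<Longrightarrow> x * y \<in> H" "z \<in> H"
  shows "z ^ card H = 1"
proof -
  have z0: "z \<noteq> 0" using assms(2,4) by auto
  have inj: "inj_on ((*) z) H" using z0 by (auto simp: inj_on_def)
  have "(*) z ` H = H" using assms(1,3,4) inj by (intro endo_inj_surj) auto
  then have "bij_betw ((*) z) H H" using inj by (simp add: bij_betw_def)
  then have "(\<Prod>x\<in>H. z * x) = (\<Prod>x\<in>H. x)" by (rule prod.reindex_bij_betw)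
  then have "z ^ card H * (\<Prod>x\<in>H. x) = (\<Prod>x\<in>H. x)" by (simp add: prod.distrib)
  moreover have "(\<Prod>x\<in>H. x) \<noteq> 0" using assms(1,2) by simp
  ultimately show ?thesis by simp
qed

locale polystable_tensor =
  fixes w :: "'m::finite tensor"
  assumes nonzero: "w \<noteq> 0" and polystable: "polystable w"
begin

definition slice :: "'m tensor set" where
  "slice = (\<lambda>g. act g w) ` SL3"

text \<open>
  This expresses through plain polynomials that the invariants of degree \<open>d\<close> are nontrivial, see
  \<open>invariants_nontrivial_iff\<close>.
\<close>

definition has_degree :: "nat \<Rightarrow> bool" where
  "has_degree d \<longleftrightarrow> (\<exists>p\<in>poly_fun. \<forall>c x. c \<noteq> 0 \<longrightarrow> x \<in> slice \<longrightarrow> p (c *s x) = c ^ d)"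

lemma closed_slice: "zariski_closed slice"
  using polystable by (simp add: polystable_def slice_def)

lemma w_in_slice: "w \<in> slice"
  unfolding slice_def by (rule image_eqI[of _ _ "(mat 1, mat 1, mat 1)"]) (simp_all add: SL3_one act_one)

lemma act_slice: "g \<in> SL3 \<Longrightarrow> x \<in> slice \<Longrightarrow> act g x \<in> slice"
proof -
  assume g: "g \<in> SL3" and "x \<in> slice"
  then obtain h where h: "h \<in> SL3" "x = act h w" unfolding slice_def by blast
  obtain f where "f \<in> SL3" "\<And>x. act f x = act g (act h x)" using SL3_mult[OF g h(1)] by metis
  then show ?thesis unfolding h(2) slice_def by (metis imageI)
qed

lemma zero_notin_slice: "0 \<notin> slice"
proof
  assume "0 \<in> slice"
  then obtain g where g: "g \<in> SL3" "act g w = 0" unfolding slice_def by force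
  obtain h where "\<And>x. act h (act g x) = x" using SL3_inverse[OF g(1)] by blast
  then have "w = act h 0" using g(2) by metis
  also have "\<dots> = 0" using act_scale[of h 0 0] by simp
  finally show False using nonzero by simp
qed

lemma orbit_eq_cone: "orbit w = punctured_cone slice"
proof (intro Set.set_eqI iffI)
  fix x assume "x \<in> orbit w"
  then obtain g where g: "g \<in> GL3" "x = act g w" by (auto simp: orbit_def)
  obtain c h where "c \<noteq> 0" "h \<in> SL3" "\<And>x. act g x = c *s act h x" using GL3_eq_scalar_SL3[OF g(1)] by metis
  then show "x \<in> punctured_cone slice" unfolding g(2) slice_def by (auto intro!: in_coneI)
next
  fix x assume "x \<in> punctured_cone slice"
  then obtain c h where *: "c \<noteq> 0" "h \<in> SL3" "x = c *s act h w"
    unfolding slice_def by (auto elim: in_coneE)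
  obtain g where "g \<in> GL3" "\<And>x. act g x = c *s act h x" using scalar_SL3_in_GL3[OF *(1,2)] by metis
  then show "x \<in> orbit w" unfolding orbit_def *(3) by (metis image_eqI)
qed

lemma slice_in_closure: "c \<noteq> 0 \<Longrightarrow> x \<in> slice \<Longrightarrow> c *s x \<in> orbit_closure w"
  unfolding orbit_eq_cone by (intro subset_zariski_closure in_coneI)

lemma exists_degree: "\<exists>d>0. has_degree d"
proof -
  define G where "G = (\<lambda>(A, B, C). kronecker3 A B C) ` (SL3 :: 'm triple set)"
  have G: "M *v x = act g x" if "M = (\<lambda>(A, B, C). kronecker3 A B C) g" for M x and g :: "'m triple"
    using that by (cases g) (simp add: act_def)
  have stable: "M *v x \<in> slice" if "M \<in> G" "x \<in> slice" for M x
    using that act_slice G unfolding G_def by (metis (no_types, lifting) imageE)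
  have adj: "adjoint_matrix M \<in> G" if "M \<in> G" for M
  proof -
    obtain A B C where "(A, B, C) \<in> SL3" "M = kronecker3 A B C" using \<open>M \<in> G\<close> by (auto simp: G_def)
    then have "(adjoint_matrix A, adjoint_matrix B, adjoint_matrix C) \<in> SL3"
      "adjoint_matrix M = (\<lambda>(A, B, C). kronecker3 A B C) (adjoint_matrix A, adjoint_matrix B, adjoint_matrix C)"
      by (simp_all add: SL3_iff det_adjoint adjoint_kronecker3)
    then show ?thesis unfolding G_def by blast
  qed
  obtain d T where T: "d > 0" "form d T w \<noteq> 0" "\<And>M x. M \<in> G \<Longrightarrow> form d T (M *v x) = form d T x"
    using exists_invariant_form[OF closed_slice zero_notin_slice w_in_slice stable adj] by metis
  have inv: "form d T x = form d T w" if "x \<in> slice" for x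
  proof -
    obtain g where g: "g \<in> SL3" "x = act g w" using \<open>x \<in> slice\<close> unfolding slice_def by blast
    then have "(\<lambda>(A, B, C). kronecker3 A B C) g \<in> G" by (simp add: G_def)
    then show ?thesis using T(3)[of _ w] G[OF refl, of g w] g(2) by metis
  qed
  have "has_degree d"
    unfolding has_degree_def
  proof (intro bexI[of _ "\<lambda>x. inverse (form d T w) * form d T x"] allI impI)
    show "(\<lambda>x. inverse (form d T w) * form d T x) \<in> poly_fun" by (intro poly_fun_cmult form_poly_fun)
    show "inverse (form d T w) * form d T (c *s x) = c ^ d" if "x \<in> slice" for c x
      using inv[OF that] T(2) by (simp add: form_scale)
  qed
  then show ?thesis using T(1) by blast
qed

text \<open>
  Carries identities along the punctured ray through \<open>w\<close> over to the origin, where the grading of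
  invariants is tested with the scalar \<open>0\<close>.
\<close>

lemma poly_at_zero:
  assumes p: "p \<in> poly_fun" and "\<And>c. c \<noteq> 0 \<Longrightarrow> p (c *s w) = a * c ^ d"
  shows "p 0 = a * 0 ^ d"
proof -
  obtain D T where T: "\<And>x. p x = (\<Sum>d\<le>D. form d T x)" using poly_fun_forms[OF p] by blast
  have "(\<Sum>d\<le>D. monom (form d T w) d) = monom a d"
    by (rule poly_eqI_nonzero) (simp only: poly_monom flip: poly_fun_radial[OF T], rule assms(2))
  then have "p (0 *s w) = poly (monom a d) 0" unfolding poly_fun_radial[OF T] by simp
  then show ?thesis by (simp add: poly_monom)
qed

lemma zero_in_closure: "0 \<in> orbit_closure w"
  unfolding in_zariski_closure_iff
proof (intro ballI impI)
  fix p assume "p \<in> poly_fun" "\<forall>y\<in>orbit w. p y = 0"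
  then show "p 0 = 0"
    using poly_at_zero[of p 0 0] in_coneI[OF _ w_in_slice] unfolding orbit_eq_cone by simp
qed

lemma closure_scale: "x \<in> orbit_closure w \<Longrightarrow> c *s x \<in> orbit_closure w"
  using closure_cone_scale[of x slice c] zero_in_closure by (cases "c = 0") (simp_all add: orbit_eq_cone)

lemma closure_act:
  assumes "g \<in> SL3" "x \<in> orbit_closure w"
  shows "act g x \<in> orbit_closure w"
  unfolding in_zariski_closure_iff
proof (intro ballI impI)
  fix p assume p: "p \<in> poly_fun" "\<forall>y\<in>orbit w. p y = 0"
  have "p (act g y) = 0" if "y \<in> orbit w" for y
    using that unfolding orbit_eq_cone
  proof (rule in_coneE)
    fix c x assume "c \<noteq> 0" "x \<in> slice" "y = c *s x"
    then show ?thesis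
      using p(2) in_coneI[OF _ act_slice[OF assms(1)], of c x] by (simp add: act_scale orbit_eq_cone)
  qed
  then show "p (act g x) = 0"
    using poly_eq_on_closure[OF act_poly_fun[OF p(1)] poly_fun.const[of 0] _ assms(2)] by blast
qed

lemma restrict_in_invariants:
  assumes p: "p \<in> poly_fun" and "d > 0"
    and hom: "\<And>c x. c \<noteq> 0 \<Longrightarrow> x \<in> slice \<Longrightarrow> p (c *s x) = a * c ^ d"
  shows "restrict p (orbit_closure w) \<in> invariants w d"
proof -
  have "p (act g x) = p x" if "g \<in> SL3" "x \<in> orbit_closure w" for g x
  proof (rule poly_eq_on_closure[OF act_poly_fun[OF p] p _ that(2)])
    show "p (act g y) = p y" if "y \<in> orbit w" for y
      using that act_slice[OF \<open>g \<in> SL3\<close>] unfolding orbit_eq_cone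
      by (auto elim!: in_coneE simp: act_scale hom)
  qed
  moreover have "p (c *s x) = c ^ d * p x" if "x \<in> orbit_closure w" for c x
  proof (rule poly_eq_on_closure[OF poly_fun_scale[OF p] poly_fun_cmult[OF p] _ that])
    have "p 0 = 0" using poly_at_zero[OF p hom[OF _ w_in_slice]] assms(2) by (simp add: power_0_left)
    then show "p (c *s y) = c ^ d * p y" if "y \<in> orbit w" for y
      using that assms(2) unfolding orbit_eq_cone
      by (cases "c = 0") (auto elim!: in_coneE simp: hom vector_smult_assoc power_mult_distrib power_0_left)
  qed
  ultimately show ?thesis
    unfolding invariants_def using p closure_act closure_scale by (auto simp: coord_ring_simps)
qed

lemma invariants_on_slice:
  assumes f: "f \<in> invariants w d" and "c \<noteq> 0" "x \<in> slice"
  shows "f (c *s x) = c ^ d * f w"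
proof -
  obtain g where g: "g \<in> SL3" "x = act g w" using assms(3) unfolding slice_def by blast
  have "w \<in> orbit_closure w" "x \<in> orbit_closure w"
    using slice_in_closure[of 1] w_in_slice assms(3) by auto
  then show ?thesis using f g unfolding invariants_def by auto
qed

text \<open>
  An invariant takes the value \<open>c ^ d * f w\<close> at \<open>c *s x\<close>. If \<open>f w = 0\<close> it is zero on the orbit and
  hence on the closure; otherwise it can be normalized.
\<close>

lemma invariants_nontrivial_iff:
  assumes "d > 0"
  shows "invariants w d \<noteq> {\<zero>\<^bsub>coord_ring (orbit_closure w)\<^esub>} \<longleftrightarrow> has_degree d"
proof
  have "(\<lambda>x\<in>orbit_closure w. 0) \<in> invariants w d"
    by (rule restrict_in_invariants[OF poly_fun.const assms, of 0 0]) simp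
  moreover assume "invariants w d \<noteq> {\<zero>\<^bsub>coord_ring (orbit_closure w)\<^esub>}"
  ultimately obtain f where f: "f \<in> invariants w d" "f \<noteq> (\<lambda>x\<in>orbit_closure w. 0)"
    by (auto simp: coord_ring_simps)
  obtain p where p: "p \<in> poly_fun" "f = restrict p (orbit_closure w)"
    using f(1) by (auto simp: invariants_def coord_ring_simps)
  have p_slice: "p (c *s x) = c ^ d * f w" if "c \<noteq> 0" "x \<in> slice" for c x
    using invariants_on_slice[OF f(1) that] slice_in_closure[OF that] by (simp add: p(2))
  have fw: "f w \<noteq> 0"
  proof
    assume "f w = 0"
    then have "p y = 0" if "y \<in> orbit w" for y
      using that p_slice unfolding orbit_eq_cone by (auto elim!: in_coneE)
    then have "p x = 0" if "x \<in> orbit_closure w" for x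
      using poly_eq_on_closure[OF p(1) poly_fun.const[of 0] _ that] by blast
    then show False using f(2) by (auto simp: p(2))
  qed
  show "has_degree d"
    unfolding has_degree_def
  proof (intro bexI[of _ "\<lambda>x. inverse (f w) * p x"] allI impI)
    show "(\<lambda>x. inverse (f w) * p x) \<in> poly_fun" by (intro poly_fun_cmult p)
  qed (simp add: p_slice fw)
next
  assume "has_degree d"
  then obtain p where p: "p \<in> poly_fun" "\<And>c x. c \<noteq> 0 \<Longrightarrow> x \<in> slice \<Longrightarrow> p (c *s x) = 1 * c ^ d"
    unfolding has_degree_def by auto
  have "p w = 1" using p(2)[of 1 w] w_in_slice by simp
  moreover have "w \<in> orbit_closure w" using slice_in_closure[of 1] w_in_slice by auto
  ultimately have "restrict p (orbit_closure w) \<noteq> (\<lambda>x\<in>orbit_closure w. 0)"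
    by (metis restrict_apply' zero_neq_one)
  moreover have "restrict p (orbit_closure w) \<in> invariants w d"
    by (rule restrict_in_invariants[OF p(1) assms p(2)])
  ultimately show "invariants w d \<noteq> {\<zero>\<^bsub>coord_ring (orbit_closure w)\<^esub>}"
    by (auto simp: coord_ring_simps)
qed

lemma minimal_degree_eq: "minimal_degree w = (LEAST d. d > 0 \<and> has_degree d)"
  unfolding minimal_degree_def using invariants_nontrivial_iff by (metis (no_types, lifting))

lemma minimal_degree:
  shows "minimal_degree w > 0" "has_degree (minimal_degree w)"
    and "d > 0 \<Longrightarrow> has_degree d \<Longrightarrow> minimal_degree w \<le> d"
  unfolding minimal_degree_eq
  using LeastI_ex[OF exists_degree[unfolded Bex_def]] Least_le[of "\<lambda>d. d > 0 \<and> has_degree d" d] by auto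

lemma fundamental_invariant:
  obtains \<phi> where "\<phi> \<in> poly_fun" "fundamental_invariant w = restrict \<phi> (orbit_closure w)"
    "\<And>c x. c \<noteq> 0 \<Longrightarrow> x \<in> slice \<Longrightarrow> \<phi> (c *s x) = c ^ minimal_degree w"
proof -
  obtain p where p: "p \<in> poly_fun" "\<And>c x. c \<noteq> 0 \<Longrightarrow> x \<in> slice \<Longrightarrow> p (c *s x) = 1 * c ^ minimal_degree w"
    using minimal_degree(2) unfolding has_degree_def by auto
  have w: "w \<in> orbit_closure w" using slice_in_closure[of 1] w_in_slice by auto
  have "fundamental_invariant w = restrict p (orbit_closure w)"
    unfolding fundamental_invariant_def
  proof (rule the_equality, intro conjI)
    show "restrict p (orbit_closure w) \<in> invariants w (minimal_degree w)"
      by (rule restrict_in_invariants[OF p(1) minimal_degree(1) p(2)])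
    show "restrict p (orbit_closure w) w = 1" using p(2)[of 1 w] w_in_slice w by simp
    fix f assume f: "f \<in> invariants w (minimal_degree w) \<and> f w = 1"
    then obtain q where q: "q \<in> poly_fun" "f = restrict q (orbit_closure w)"
      by (auto simp: invariants_def coord_ring_simps)
    have "q y = p y" if "y \<in> orbit w" for y
      using that unfolding orbit_eq_cone
    proof (rule in_coneE)
      fix c x assume "c \<noteq> 0" "x \<in> slice" "y = c *s x"
      then show ?thesis
        using invariants_on_slice[of f _ c x] f slice_in_closure[of c x] p(2) by (simp add: q(2))
    qed
    then have "q x = p x" if "x \<in> orbit_closure w" for x
      using poly_eq_on_closure[OF q(1) p(1) _ that] by blast
    then show "f = restrict p (orbit_closure w)" by (auto simp: q(2))
  qed
  then show thesis using that p by simp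
qed

text \<open>
  An element of the stabilizer is a scalar \<open>c\<close> times some \<open>h \<in> SL3\<close>, and \<open>\<Phi>\<close> detects that \<open>c ^ e = 1\<close>,
  where \<open>e\<close> is the minimal degree. In particular the values of the character on the stabilizer form
  a finite group.
\<close>

lemma stab_det_char_root:
  assumes "z \<in> det_char ` stab w"
  shows "z ^ minimal_degree w = 1"
proof -
  obtain \<phi> where phi: "\<And>c x. c \<noteq> 0 \<Longrightarrow> x \<in> slice \<Longrightarrow> \<phi> (c *s x) = c ^ minimal_degree w"
    using fundamental_invariant by metis
  obtain g where g: "g \<in> GL3" "act g w = w" "z = det_char g" using assms unfolding stab_def by blast
  obtain c h where c: "c \<noteq> 0" "h \<in> SL3" "c ^ CARD('m) = det_char g" "\<And>x. act g x = c *s act h x"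
    using GL3_eq_scalar_SL3[OF g(1)] by metis
  have "c ^ minimal_degree w = \<phi> (c *s act h w)" using phi[OF c(1)] act_slice[OF c(2) w_in_slice] by simp
  also have "\<dots> = 1" using phi[of 1 w] w_in_slice g(2) c(4)[of w] by simp
  finally show ?thesis unfolding g(3) c(3)[symmetric] by (metis power_mult mult.commute power_one)
qed

lemma finite_stab_det_char: "finite (det_char ` stab w)"
proof (rule finite_subset)
  show "det_char ` stab w \<subseteq> {z. z ^ minimal_degree w = 1}" using stab_det_char_root by blast
  show "finite {z :: complex. z ^ minimal_degree w = 1}"
    using minimal_degree(1) by (intro finite_roots_unity) simp
qed

lemma stab_period_pos: "stab_period w > 0"
proof -
  have "(mat 1, mat 1, mat 1) \<in> stab w" by (simp add: stab_def GL3_iff act_one)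
  then show ?thesis using finite_stab_det_char by (auto simp: stab_period_def card_gt_0_iff)
qed

text \<open>
  Two points \<open>x\<close> and \<open>c *s x\<close> of the slice give a stabilizer element that is \<open>c\<close> times an element of
  \<open>SL3\<close>. Its character value \<open>c ^ CARD('m)\<close> lies in a group of order \<open>stab_period w\<close>.
\<close>

lemma slice_scalars:
  assumes "x \<in> slice" "c *s x \<in> slice"
  shows "c ^ (CARD('m) * stab_period w) = 1"
proof -
  define H where "H = det_char ` stab w"
  have root: "z ^ minimal_degree w = 1" if "z \<in> H" for z
    using stab_det_char_root that by (simp add: H_def)
  have fin: "finite H" unfolding H_def by (rule finite_stab_det_char)
  have "0 \<notin> H" using root[of 0] minimal_degree(1) by (auto simp: power_0_left)
  moreover have "y * z \<in> H" if "y \<in> H" "z \<in> H" for y z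
  proof -
    obtain g h where gh: "g \<in> GL3" "act g w = w" "y = det_char g" "h \<in> GL3" "act h w = w" "z = det_char h"
      using \<open>y \<in> H\<close> \<open>z \<in> H\<close> unfolding H_def stab_def by blast
    obtain f where "f \<in> GL3" "det_char f = det_char g * det_char h" "\<And>x. act f x = act g (act h x)"
      using GL3_mult[OF gh(1,4)] by metis
    then show ?thesis using gh unfolding H_def stab_def by (intro image_eqI[of _ _ f]) auto
  qed
  moreover have "c ^ CARD('m) \<in> H"
  proof -
    have c0: "c \<noteq> 0" using assms(2) zero_notin_slice by auto
    obtain g h where gh: "g \<in> SL3" "x = act g w" "h \<in> SL3" "c *s x = act h w"
      using assms unfolding slice_def by blast
    obtain h' where h': "h' \<in> SL3" "\<And>x. act h' (act h x) = x" using SL3_inverse[OF gh(3)] by metis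
    obtain f where f: "f \<in> SL3" "\<And>x. act f x = act h' (act g x)" using SL3_mult[OF h'(1) gh(1)] by metis
    obtain k where k: "k \<in> GL3" "det_char k = c ^ CARD('m)" "\<And>x. act k x = c *s act f x"
      using scalar_SL3_in_GL3[OF c0 f(1)] by metis
    have "act k w = act h' (c *s x)" unfolding k(3) f(2) gh(2) act_scale ..
    also have "\<dots> = w" unfolding gh(4) by (rule h'(2))
    finally show ?thesis using k unfolding H_def stab_def by (intro image_eqI[of _ _ k]) auto
  qed
  ultimately have "(c ^ CARD('m)) ^ card H = 1" using finite_group_pow_card[OF fin] by blast
  then show ?thesis by (simp add: power_mult H_def stab_period_def)
qed

lemma boundary_eq_zero_set: "{x \<in> orbit_closure w. fundamental_invariant w x = 0} = boundary w"
proof -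
  obtain \<phi> where phi: "\<phi> \<in> poly_fun" "fundamental_invariant w = restrict \<phi> (orbit_closure w)"
    "\<And>c x. c \<noteq> 0 \<Longrightarrow> x \<in> slice \<Longrightarrow> \<phi> (c *s x) = c ^ minimal_degree w"
    using fundamental_invariant by metis
  interpret C: cone_slice slice \<phi> "minimal_degree w"
    by unfold_locales (simp_all add: closed_slice phi minimal_degree(1))
  show ?thesis
    using C.phi_cone_nonzero C.closure_nonzero_in_cone
    unfolding boundary_def phi(2) orbit_eq_cone by auto
qed

text \<open>
  The isomorphism evaluates a fraction pointwise, which is possible because \<open>\<Phi>\<close> has no zeros on the
  orbit. It is injective because functions on the closure are determined on the orbit, and
  surjective by \<open>regular_fun_eq_fraction\<close>.
\<close>

lemma coordinate_ring_iso:
  defines "R \<equiv> coord_ring (orbit_closure w)"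
  defines "S \<equiv> powers R (fundamental_invariant w)"
  shows "\<exists>h \<in> ring_iso (localization R S) (regular_ring (orbit w)).
     \<forall>f \<in> carrier R. h (fraction R S f \<one>\<^bsub>R\<^esub>) = restrict f (orbit w)"
proof -
  define Y where "Y = orbit w"
  define Z where "Z = orbit_closure w"
  have YZ: "y \<in> Z" if "y \<in> Y" for y using subset_zariski_closure[of y "orbit w"] that by (simp add: Y_def Z_def)
  have R: "R = coord_ring Z" by (simp add: R_def Z_def)
  obtain \<phi> where phi: "\<phi> \<in> poly_fun" "fundamental_invariant w = restrict \<phi> Z"
    "\<And>c x. c \<noteq> 0 \<Longrightarrow> x \<in> slice \<Longrightarrow> \<phi> (c *s x) = c ^ minimal_degree w"
    using fundamental_invariant unfolding Z_def by metis
  interpret C: cone_slice slice \<phi> "minimal_degree w"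
    by unfold_locales (simp_all add: closed_slice phi minimal_degree(1))
  have phi0: "\<phi> y \<noteq> 0" if "y \<in> Y" for y using C.phi_cone_nonzero that by (simp add: Y_def orbit_eq_cone)
  have S: "S = {restrict (\<lambda>x. \<phi> x ^ n) Z | n. True}"
    unfolding S_def powers_def R coord_ring_pow phi(2) by (auto simp: restrict_cong_iff intro!: Collect_cong)
  have w: "w \<in> Y" using in_coneI[of 1 w slice] w_in_slice by (simp add: Y_def orbit_eq_cone)
  interpret R: domain R unfolding R_def by (rule domain_coord_ring)
  have S_fun: "\<exists>n. s = restrict (\<lambda>x. \<phi> x ^ n) Z" if "s \<in> S" for s using that S by blast
  interpret L: localized_domain R S
  proof unfold_locales
    show "S \<subseteq> carrier R - {\<zero>\<^bsub>R\<^esub>}"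
    proof
      fix s assume "s \<in> S"
      then obtain n where s: "s = restrict (\<lambda>x. \<phi> x ^ n) Z" using S_fun by blast
      have "\<phi> w ^ n \<noteq> 0" using phi0[OF w] by simp
      then have "s \<noteq> \<zero>\<^bsub>R\<^esub>" unfolding s R coord_ring_simps restrict_cong_iff using YZ[OF w] by blast
      then show "s \<in> carrier R - {\<zero>\<^bsub>R\<^esub>}"
        using poly_fun_power[OF phi(1), of n] by (auto simp: s R coord_ring_simps)
    qed
    show "\<one>\<^bsub>R\<^esub> \<in> S" unfolding S R coord_ring_simps by (intro CollectI exI[of _ 0]) simp
    fix s t assume "s \<in> S" "t \<in> S"
    then obtain n k where st: "s = restrict (\<lambda>x. \<phi> x ^ n) Z" "t = restrict (\<lambda>x. \<phi> x ^ k) Z"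
      using S_fun by meson
    show "s \<otimes>\<^bsub>R\<^esub> t \<in> S"
      unfolding S R coord_ring_simps st by (intro CollectI exI[of _ "n + k"]) (auto simp: restrict_cong_iff power_add)
  qed
  have S0: "s y \<noteq> 0" if "s \<in> S" "y \<in> Y" for s y
    using S_fun[OF that(1)] YZ[OF that(2)] phi0[OF that(2)] by auto
  have mult_R: "(f \<otimes>\<^bsub>R\<^esub> g) y = f y * g y" and add_R: "(f \<oplus>\<^bsub>R\<^esub> g) y = f y + g y" if "y \<in> Y" for f g y
    using YZ[OF that] by (simp_all add: R coord_ring_simps)
  have one_R: "\<one>\<^bsub>R\<^esub> y = 1" if "y \<in> Y" for y using YZ[OF that] by (simp add: R coord_ring_simps)
  have R_eqI: "f = g" if fg: "f \<in> carrier R" "g \<in> carrier R" "\<And>y. y \<in> Y \<Longrightarrow> f y = g y" for f g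
  proof -
    obtain p q where p: "p \<in> poly_fun" "f = restrict p Z" "q \<in> poly_fun" "g = restrict q Z"
      using fg(1,2) by (auto simp: R coord_ring_simps)
    have "p y = q y" if "y \<in> orbit w" for y using fg(3)[of y] that YZ[of y] by (simp add: p Y_def)
    then have "p x = q x" if "x \<in> Z" for x using poly_eq_on_closure[OF p(1,3)] that unfolding Z_def by blast
    then show ?thesis by (simp add: p restrict_cong_iff)
  qed
  define h where "h A = (THE g. \<exists>f s. f \<in> carrier R \<and> s \<in> S \<and> A = L.frac f s \<and> g = (\<lambda>y\<in>Y. f y / s y))" for A
  have h: "h (L.frac f s) = (\<lambda>y\<in>Y. f y / s y)" if fs: "f \<in> carrier R" "s \<in> S" for f s
    unfolding h_def
  proof (rule the_equality)
    show "\<exists>f' s'. f' \<in> carrier R \<and> s' \<in> S \<and> L.frac f s = L.frac f' s' \<and> (\<lambda>y\<in>Y. f y / s y) = (\<lambda>y\<in>Y. f' y / s' y)"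
      using fs by blast
    fix g assume "\<exists>f' s'. f' \<in> carrier R \<and> s' \<in> S \<and> L.frac f s = L.frac f' s' \<and> g = (\<lambda>y\<in>Y. f' y / s' y)"
    then obtain f' s' where *: "f' \<in> carrier R" "s' \<in> S" "L.frac f s = L.frac f' s'" "g = (\<lambda>y\<in>Y. f' y / s' y)"
      by blast
    have eq: "s' \<otimes>\<^bsub>R\<^esub> f = s \<otimes>\<^bsub>R\<^esub> f'" using *(3) L.frac_eq_iff[OF fs(1) *(1) fs(2) *(2)] by simp
    have "f' y / s' y = f y / s y" if "y \<in> Y" for y
      using arg_cong[OF eq, of "\<lambda>u. u y"] S0[OF fs(2) that] S0[OF *(2) that]
      by (simp add: mult_R that field_simps)
    then show "g = (\<lambda>y\<in>Y. f y / s y)" by (simp add: *(4) restrict_cong_iff)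
  qed
  have reg: "carrier (regular_ring Y) = regular_fun Y" "\<one>\<^bsub>regular_ring Y\<^esub> = (\<lambda>y\<in>Y. 1)"
    "f \<otimes>\<^bsub>regular_ring Y\<^esub> g = (\<lambda>y\<in>Y. f y * g y)" "f \<oplus>\<^bsub>regular_ring Y\<^esub> g = (\<lambda>y\<in>Y. f y + g y)" for f g
    by (simp_all add: regular_ring_def function_ring_def)
  have into: "h A \<in> carrier (regular_ring Y)" if "A \<in> carrier L.L" for A
  proof -
    from that obtain f s where fs: "f \<in> carrier R" "s \<in> S" "A = L.frac f s" by (rule L.frac_cases)
    obtain p where p: "p \<in> poly_fun" "f = restrict p Z" using fs(1) by (auto simp: R coord_ring_simps)
    obtain n where n: "s = restrict (\<lambda>x. \<phi> x ^ n) Z" using S_fun[OF fs(2)] by blast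
    have "zariski_closed (- (UNIV :: 'm tensor set))"
      unfolding zariski_closed_def by (rule exI[of _ "{\<lambda>x. 1}"]) (auto simp: poly_fun.const)
    moreover have "\<forall>y\<in>UNIV \<inter> Y. \<phi> y ^ n \<noteq> 0 \<and> h A y = p y / \<phi> y ^ n"
      using YZ phi0 by (simp add: fs(3) h[OF fs(1,2)]) (simp add: p n)
    then have "\<exists>q\<in>poly_fun. \<forall>y\<in>UNIV \<inter> Y. q y \<noteq> 0 \<and> h A y = p y / q y"
      by (rule bexI[OF _ poly_fun_power[OF phi(1)]])
    ultimately have "\<exists>U. zariski_closed (- U) \<and> x \<in> U \<and>
       (\<exists>p\<in>poly_fun. \<exists>q\<in>poly_fun. \<forall>y\<in>U \<inter> Y. q y \<noteq> 0 \<and> h A y = p y / q y)" for x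
      using p(1) by (intro exI[of _ UNIV]) blast
    then show "h A \<in> carrier (regular_ring Y)"
      unfolding reg regular_fun_def by (simp add: fs(3) h[OF fs(1,2)])
  qed
  have "h \<in> ring_iso L.L (regular_ring Y)"
  proof (rule ring_iso_memI)
    show "h A \<in> carrier (regular_ring Y)" if "A \<in> carrier L.L" for A using into[OF that] .
  next
    fix A B assume "A \<in> carrier L.L" "B \<in> carrier L.L"
    then obtain f s g t where *: "f \<in> carrier R" "s \<in> S" "A = L.frac f s" "g \<in> carrier R" "t \<in> S" "B = L.frac g t"
      by (metis L.frac_cases)
    show "h (A \<otimes>\<^bsub>L.L\<^esub> B) = h A \<otimes>\<^bsub>regular_ring Y\<^esub> h B"
      using * by (simp add: L.mult_frac h L.S_mult reg restrict_cong_iff mult_R)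
    show "h (A \<oplus>\<^bsub>L.L\<^esub> B) = h A \<oplus>\<^bsub>regular_ring Y\<^esub> h B"
      using * S0 by (simp add: L.add_frac h L.S_mult reg restrict_cong_iff mult_R add_R add_frac_eq)
  next
    show "h \<one>\<^bsub>L.L\<^esub> = \<one>\<^bsub>regular_ring Y\<^esub>"
      using L.S_one by (simp add: L.one_localization h reg restrict_cong_iff one_R)
  next
    show "bij_betw h (carrier L.L) (carrier (regular_ring Y))"
      unfolding bij_betw_def
    proof
      show "inj_on h (carrier L.L)"
      proof (rule inj_onI)
        fix A B assume "A \<in> carrier L.L" "B \<in> carrier L.L" and hAB: "h A = h B"
        then obtain f s g t where *: "f \<in> carrier R" "s \<in> S" "A = L.frac f s" "g \<in> carrier R" "t \<in> S" "B = L.frac g t"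
          by (metis L.frac_cases)
        have quot: "f y / s y = g y / t y" if "y \<in> Y" for y
          using hAB that unfolding *(3,6) h[OF *(1,2)] h[OF *(4,5)] restrict_cong_iff by blast
        have "t \<otimes>\<^bsub>R\<^esub> f = s \<otimes>\<^bsub>R\<^esub> g"
        proof (rule R_eqI)
          show "(t \<otimes>\<^bsub>R\<^esub> f) y = (s \<otimes>\<^bsub>R\<^esub> g) y" if "y \<in> Y" for y
            using quot[OF that] S0[OF *(2) that] S0[OF *(5) that] by (simp add: mult_R that field_simps)
        qed (use * in auto)
        then show "A = B" using L.frac_eq_iff * by simp
      qed
      show "h ` carrier L.L = carrier (regular_ring Y)"
      proof
        show "h ` carrier L.L \<subseteq> carrier (regular_ring Y)" using into by blast
        show "carrier (regular_ring Y) \<subseteq> h ` carrier L.L"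
        proof
          fix f assume "f \<in> carrier (regular_ring Y)"
          then have f: "f \<in> regular_fun Y" "f \<in> extensional Y" by (simp_all add: reg regular_fun_def)
          obtain p n where p: "p \<in> poly_fun" "\<And>y. y \<in> Y \<Longrightarrow> f y = p y / \<phi> y ^ n"
            using regular_fun_eq_fraction[OF phi(1) phi0 _ f(1)] C.closure_nonzero_in_cone
            unfolding Y_def orbit_eq_cone by metis
          define a where "a = restrict p Z"
          define s where "s = restrict (\<lambda>x. \<phi> x ^ n) Z"
          have as: "a \<in> carrier R" "s \<in> S" using p(1) by (auto simp: a_def s_def R coord_ring_simps S)
          have "h (L.frac a s) = f"
            using f(2) p(2) YZ
            by (subst h[OF as], intro extensionalityI[of _ Y]) (auto simp: a_def s_def)
          then show "f \<in> h ` carrier L.L" using L.frac_closed[OF as] by blast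
        qed
      qed
    qed
  qed
  moreover have "h (L.frac f \<one>\<^bsub>R\<^esub>) = restrict f Y" if "f \<in> carrier R" for f
    using h[OF that L.S_one] by (simp add: restrict_cong_iff one_R)
  ultimately show ?thesis unfolding Y_def by blast
qed

section \<open>Failure of normality\<close>

lemma has_degreeI:
  assumes "p \<in> poly_fun" "\<And>c x. c \<noteq> 0 \<Longrightarrow> x \<in> slice \<Longrightarrow> p (c *s x) = c ^ d"
  shows "has_degree d"
  unfolding has_degree_def using assms by blast

text \<open>
  Take the smallest degree \<open>D\<close> that is not a multiple of \<open>e = minimal_degree w\<close>. Its invariant \<open>p\<close>
  satisfies \<open>p ^ e = \<Phi> ^ D\<close>, so it vanishes on the boundary. If \<open>\<Phi>\<close> divided it, the quotient would have
  degree \<open>D - e\<close>, which is not a multiple of \<open>e\<close> either.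
\<close>

lemma vanishing_ideal_not_principal:
  assumes d: "has_degree d" "\<not> minimal_degree w dvd d"
  defines "R \<equiv> coord_ring (orbit_closure w)"
  shows "PIdl\<^bsub>R\<^esub> (fundamental_invariant w) \<subset> vanishing_ideal (orbit_closure w) (boundary w)"
proof -
  define e where "e = minimal_degree w"
  define Z where "Z = orbit_closure w"
  have R: "R = coord_ring Z" by (simp add: R_def Z_def)
  interpret R: domain R unfolding R_def by (rule domain_coord_ring)
  obtain \<phi> where phi: "\<phi> \<in> poly_fun" "fundamental_invariant w = restrict \<phi> Z"
    "\<And>c x. c \<noteq> 0 \<Longrightarrow> x \<in> slice \<Longrightarrow> \<phi> (c *s x) = c ^ e"
    using fundamental_invariant unfolding Z_def e_def by metis
  have bd: "x \<in> Z" "\<phi> x = 0" if "x \<in> boundary w" for x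
  proof -
    have "x \<in> Z \<and> fundamental_invariant w x = 0" using that boundary_eq_zero_set by (auto simp: Z_def)
    then show "x \<in> Z" "\<phi> x = 0" by (auto simp: phi(2))
  qed
  have in_Z: "c *s x \<in> Z" if "c \<noteq> 0" "x \<in> slice" for c x using slice_in_closure[OF that] by (simp add: Z_def)
  define D where "D = (LEAST d. has_degree d \<and> \<not> e dvd d)"
  have D: "has_degree D" "\<not> e dvd D" and D_le: "\<And>d. has_degree d \<Longrightarrow> \<not> e dvd d \<Longrightarrow> D \<le> d"
    using LeastI[of "\<lambda>d. has_degree d \<and> \<not> e dvd d" d] Least_le[of "\<lambda>d. has_degree d \<and> \<not> e dvd d"] d
    by (auto simp: D_def e_def)
  have "D > 0" using D(2) by (cases D) auto
  then have "e \<le> D" using minimal_degree(3) D(1) by (simp add: e_def)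
  obtain p where p: "p \<in> poly_fun" "\<And>c x. c \<noteq> 0 \<Longrightarrow> x \<in> slice \<Longrightarrow> p (c *s x) = c ^ D"
    using D(1) unfolding has_degree_def by blast
  have p_vanish: "p x = 0" if "x \<in> boundary w" for x
  proof -
    have "p x ^ e = \<phi> x ^ D"
    proof (rule poly_eq_on_closure[OF poly_fun_power[OF p(1)] poly_fun_power[OF phi(1)]])
      show "x \<in> orbit_closure w" using bd(1)[OF that] by (simp add: Z_def)
      show "p y ^ e = \<phi> y ^ D" if "y \<in> orbit w" for y
        using that unfolding orbit_eq_cone
        by (auto elim!: in_coneE simp: p phi mult.commute simp flip: power_mult)
    qed
    then show ?thesis using bd(2)[OF that] \<open>D > 0\<close> by (simp add: power_0_left)
  qed
  have "restrict p Z \<in> vanishing_ideal (orbit_closure w) (boundary w)"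
    unfolding vanishing_ideal_def using p(1) p_vanish bd(1) by (auto simp: coord_ring_simps Z_def)
  moreover have "restrict p Z \<notin> PIdl\<^bsub>R\<^esub> (fundamental_invariant w)"
  proof
    assume "restrict p Z \<in> PIdl\<^bsub>R\<^esub> (fundamental_invariant w)"
    then obtain q where q: "q \<in> poly_fun" "restrict p Z = restrict q Z \<otimes>\<^bsub>R\<^esub> restrict \<phi> Z"
      unfolding cgenideal_def phi(2) by (auto simp: R coord_ring_simps)
    then have pq: "p x = q x * \<phi> x" if "x \<in> Z" for x
      using that by (auto simp: R coord_ring_simps restrict_cong_iff)
    have "has_degree (D - e)"
    proof (rule has_degreeI[OF q(1)])
      fix c :: complex and x assume cx: "c \<noteq> 0" "x \<in> slice"
      have "q (c *s x) * c ^ e = c ^ D"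
        using pq[OF in_Z[OF cx]] by (simp add: p(2)[OF cx] phi(3)[OF cx])
      also have "\<dots> = c ^ (D - e) * c ^ e" using \<open>e \<le> D\<close> by (simp flip: power_add)
      finally show "q (c *s x) = c ^ (D - e)" using cx(1) by (metis mult_right_cancel power_not_zero)
    qed
    moreover have "\<not> e dvd D - e" using D(2) \<open>e \<le> D\<close> by (metis dvd_diffD dvd_refl)
    ultimately have "D \<le> D - e" by (rule D_le)
    then show False using minimal_degree(1) \<open>D > 0\<close> by (simp add: e_def)
  qed
  moreover have "PIdl\<^bsub>R\<^esub> (fundamental_invariant w) \<subseteq> vanishing_ideal (orbit_closure w) (boundary w)"
  proof
    fix f assume "f \<in> PIdl\<^bsub>R\<^esub> (fundamental_invariant w)"
    then obtain g where g: "g \<in> carrier R" "f = g \<otimes>\<^bsub>R\<^esub> restrict \<phi> Z" unfolding cgenideal_def phi(2) by blast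
    have "restrict \<phi> Z \<in> carrier R" using phi(1) by (simp add: R coord_ring_simps)
    then have "f \<in> carrier R" using g by simp
    then show "f \<in> vanishing_ideal (orbit_closure w) (boundary w)"
      unfolding vanishing_ideal_def using bd by (auto simp: g(2) R coord_ring_simps Z_def)
  qed
  ultimately show ?thesis by blast
qed

text \<open>
  The function \<open>p / q\<close> is \<open>c *s x \<mapsto> c ^ k\<close> on the orbit. By \<open>homogeneous_of_local\<close>, a representation
  \<open>a / s\<close> of it near the origin would make \<open>k\<close> a degree, and its inverse is unbounded near the origin.
\<close>

lemma fraction_not_local_inverse_not_regular:
  assumes k: "k > 0" "\<not> has_degree k"
    and F: "p \<in> poly_fun" "\<And>c x. c \<noteq> 0 \<Longrightarrow> x \<in> slice \<Longrightarrow> p (c *s x) = c ^ (k + N)"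
    and G: "q \<in> poly_fun" "\<And>c x. c \<noteq> 0 \<Longrightarrow> x \<in> slice \<Longrightarrow> q (c *s x) = c ^ N"
  shows "\<lbrakk>a \<in> poly_fun; s \<in> poly_fun; s 0 \<noteq> 0\<rbrakk> \<Longrightarrow> \<exists>x\<in>orbit_closure w. s x * p x \<noteq> a x * q x"
    and "a \<in> poly_fun \<Longrightarrow> \<exists>x\<in>orbit_closure w. q x \<noteq> a x * p x"
proof -
  assume a: "a \<in> poly_fun" and s: "s \<in> poly_fun" "s 0 \<noteq> 0"
  show "\<exists>x\<in>orbit_closure w. s x * p x \<noteq> a x * q x"
  proof (rule ccontr)
    assume "\<not> ?thesis"
    then have eq: "s x * p x = a x * q x" if "x \<in> orbit_closure w" for x using that by blast
    have "a (c *s x) = c ^ k * s (c *s x)" if "c \<noteq> 0" "x \<in> slice" for c x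
      using eq[OF slice_in_closure[OF that]] that by (simp add: F(2)[OF that] G(2)[OF that] power_add mult.commute)
    then obtain r where "r \<in> poly_fun" "\<And>c x. x \<in> slice \<Longrightarrow> r (c *s x) = c ^ k"
      using homogeneous_of_local[OF a s, of slice k] by blast
    then show False using k(2) has_degreeI by blast
  qed
next
  assume a: "a \<in> poly_fun"
  show "\<exists>x\<in>orbit_closure w. q x \<noteq> a x * p x"
  proof (rule ccontr)
    assume "\<not> ?thesis"
    then have eq: "q x = a x * p x" if "x \<in> orbit_closure w" for x using that by blast
    have "c ^ k * a (c *s w) = 1" if "c \<noteq> 0" for c
      using eq[OF slice_in_closure[OF that w_in_slice]] that
      by (simp add: F(2)[OF that w_in_slice] G(2)[OF that w_in_slice] power_add field_simps)
    then show False using no_negative_degree[OF a k(1), of w] by blast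
  qed
qed

text \<open>
  The function \<open>c *s x \<mapsto> c ^ k\<close> is \<open>F / G\<close> with \<open>F\<close> of degree \<open>k + e n\<close> and \<open>G = \<Phi> ^ n\<close>, where
  \<open>e = minimal_degree w\<close>. Its \<open>e\<close>-th power is \<open>\<Phi> ^ k\<close>, so it is integral, but it is not in the local
  ring at the vertex of the cone.
\<close>

lemma not_normal_and_not_valuation:
  assumes k: "k > 0" "\<not> has_degree k" and "has_degree (k + minimal_degree w * n)"
  shows "\<not> normal_variety (orbit_closure w)" "\<not> valuation_ring (coord_ring (orbit_closure w))"
proof -
  define e where "e = minimal_degree w"
  define Z where "Z = orbit_closure w"
  define R where "R = coord_ring Z"
  interpret R: domain R unfolding R_def Z_def by (rule domain_coord_ring)
  obtain \<phi> where phi: "\<phi> \<in> poly_fun" "\<And>c x. c \<noteq> 0 \<Longrightarrow> x \<in> slice \<Longrightarrow> \<phi> (c *s x) = c ^ e"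
    using minimal_degree(2) unfolding has_degree_def e_def by blast
  obtain p where p: "p \<in> poly_fun" "\<And>c x. c \<noteq> 0 \<Longrightarrow> x \<in> slice \<Longrightarrow> p (c *s x) = c ^ (k + e * n)"
    using assms(3) unfolding has_degree_def e_def by blast
  define q where "q = (\<lambda>x. \<phi> x ^ n)"
  have q: "q \<in> poly_fun" "\<And>c x. c \<noteq> 0 \<Longrightarrow> x \<in> slice \<Longrightarrow> q (c *s x) = c ^ (e * n)"
    using poly_fun_power[OF phi(1)] by (simp_all add: q_def phi(2) power_mult)
  have rels: "a \<in> poly_fun \<Longrightarrow> s \<in> poly_fun \<Longrightarrow> s 0 \<noteq> 0 \<Longrightarrow> \<exists>x\<in>Z. s x * p x \<noteq> a x * q x"
    "a \<in> poly_fun \<Longrightarrow> \<exists>x\<in>Z. q x \<noteq> a x * p x" for a s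
    unfolding Z_def by (rule fraction_not_local_inverse_not_regular[OF k]; use p q in blast)+
  define F where "F = restrict p Z"
  define G where "G = restrict q Z"
  have carr: "F \<in> carrier R" "G \<in> carrier R"
    using p(1) q(1) by (simp_all add: F_def G_def R_def coord_ring_simps)
  have R_E: "\<exists>p\<in>poly_fun. f = restrict p Z" if "f \<in> carrier R" for f
    using that by (auto simp: R_def coord_ring_simps)
  have w: "w \<in> Z" "p w = 1" "q w = 1"
    using slice_in_closure[of 1 w] w_in_slice p(2)[of 1 w] q(2)[of 1 w] by (auto simp: Z_def)
  have nonzero: "F \<noteq> \<zero>\<^bsub>R\<^esub>" "G \<noteq> \<zero>\<^bsub>R\<^esub>"
    unfolding F_def G_def R_def coord_ring_simps restrict_cong_iff using w by (metis zero_neq_one)+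
  show "\<not> valuation_ring (coord_ring (orbit_closure w))"
  proof
    assume "valuation_ring (coord_ring (orbit_closure w))"
    then have "valuation_ring R" by (simp add: R_def Z_def)
    from valuation_ringD[OF this carr nonzero] show False
    proof
      assume "\<exists>a\<in>carrier R. F = a \<otimes>\<^bsub>R\<^esub> G"
      then obtain a where a: "a \<in> poly_fun" "\<And>x. x \<in> Z \<Longrightarrow> p x = a x * q x"
        using R_E unfolding F_def G_def R_def coord_ring_simps by (auto simp: restrict_cong_iff)
      then show False using rels(1)[OF a(1) poly_fun.const[of 1]] by (auto simp: Z_def)
    next
      assume "\<exists>a\<in>carrier R. G = a \<otimes>\<^bsub>R\<^esub> F"
      then obtain a where a: "a \<in> poly_fun" "\<And>x. x \<in> Z \<Longrightarrow> q x = a x * p x"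
        using R_E unfolding F_def G_def R_def coord_ring_simps by (auto simp: restrict_cong_iff)
      then show False using rels(2)[OF a(1)] by (auto simp: Z_def)
    qed
  qed
  show "\<not> normal_variety (orbit_closure w)"
  proof
    define S where "S = {f \<in> carrier R. f 0 \<noteq> 0}"
    have Z0: "0 \<in> Z" unfolding Z_def by (rule zero_in_closure)
    assume "normal_variety (orbit_closure w)"
    then have norm: "integrally_closed_domain (localization R S)"
      using Z0 unfolding normal_variety_def local_ring_def Z_def R_def S_def by blast
    interpret L: localized_domain R S
    proof unfold_locales
      show "S \<subseteq> carrier R - {\<zero>\<^bsub>R\<^esub>}" using Z0 by (auto simp: S_def R_def coord_ring_simps)
      show "\<one>\<^bsub>R\<^esub> \<in> S" using Z0 R.one_closed by (simp add: S_def) (simp add: R_def coord_ring_simps)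
      show "s \<otimes>\<^bsub>R\<^esub> t \<in> S" if "s \<in> S" "t \<in> S" for s t
      proof -
        have "(s \<otimes>\<^bsub>R\<^esub> t) 0 = s 0 * t 0" using Z0 by (simp add: R_def coord_ring_simps)
        then show ?thesis using that R.m_closed by (simp add: S_def)
      qed
    qed
    define C where "C = restrict (\<lambda>x. \<phi> x ^ k) Z"
    have C: "C \<in> carrier R"
      using poly_fun_power[OF phi(1)] by (simp add: C_def R_def coord_ring_simps)
    have "p x ^ e = \<phi> x ^ k * q x ^ e" if "x \<in> Z" for x
    proof (rule poly_eq_on_closure[OF poly_fun_power[OF p(1)]
          poly_fun.mult[OF poly_fun_power[OF phi(1)] poly_fun_power[OF q(1)]]])
      show "x \<in> orbit_closure w" using that by (simp add: Z_def)
      show "p y ^ e = \<phi> y ^ k * q y ^ e" if "y \<in> orbit w" for y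
        using that unfolding orbit_eq_cone
        by (auto elim!: in_coneE simp: p phi q algebra_simps simp flip: power_mult power_add)
    qed
    then have FG: "F [^]\<^bsub>R\<^esub> e = C \<otimes>\<^bsub>R\<^esub> G [^]\<^bsub>R\<^esub> e"
      unfolding R_def coord_ring_pow coord_ring_simps by (auto simp: F_def G_def C_def restrict_cong_iff)
    define F' where "F' = L.frac F \<one>\<^bsub>R\<^esub>"
    define G' where "G' = L.frac G \<one>\<^bsub>R\<^esub>"
    define C' where "C' = L.frac C \<one>\<^bsub>R\<^esub>"
    have carr': "F' \<in> carrier L.L" "G' \<in> carrier L.L" "C' \<in> carrier L.L"
      using carr C L.S_one L.frac_closed by (simp_all add: F'_def G'_def C'_def)
    have "G' \<noteq> \<zero>\<^bsub>L.L\<^esub>"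
      unfolding G'_def L.zero_localization using L.frac_eq_iff[OF carr(2) R.zero_closed L.S_one L.S_one] carr nonzero by simp
    moreover have "F' [^]\<^bsub>L.L\<^esub> e = C' \<otimes>\<^bsub>L.L\<^esub> G' [^]\<^bsub>L.L\<^esub> e"
      unfolding F'_def G'_def C'_def
      using carr C L.S_one FG by (simp add: L.frac_pow L.mult_frac)
    moreover have "e > 0" by (simp add: e_def minimal_degree(1))
    ultimately obtain A where A: "A \<in> carrier L.L" "F' = A \<otimes>\<^bsub>L.L\<^esub> G'"
      using integrally_closed_domainD[OF norm carr'] by blast
    obtain a s where as: "a \<in> carrier R" "s \<in> S" "A = L.frac a s" using A(1) by (rule L.frac_cases)
    have s: "s \<in> carrier R" "s 0 \<noteq> 0" using as(2) unfolding S_def by blast+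
    have "L.frac F \<one>\<^bsub>R\<^esub> = L.frac (a \<otimes>\<^bsub>R\<^esub> G) s"
      using A(2) as carr L.S_one by (simp add: F'_def G'_def L.mult_frac)
    then have eq: "s \<otimes>\<^bsub>R\<^esub> F = a \<otimes>\<^bsub>R\<^esub> G"
      using L.frac_eq_iff[of F "a \<otimes>\<^bsub>R\<^esub> G" "\<one>\<^bsub>R\<^esub>" s] as carr L.S_one by simp
    obtain a' s' where as': "a' \<in> poly_fun" "a = restrict a' Z" "s' \<in> poly_fun" "s = restrict s' Z"
      using R_E[OF as(1)] R_E[OF s(1)] by blast
    have "s' 0 \<noteq> 0" using s(2) Z0 by (simp add: as')
    moreover have "\<forall>x\<in>Z. s' x * p x = a' x * q x"
      using eq unfolding as'(2,4) F_def G_def R_def coord_ring_simps by (simp add: restrict_cong_iff)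
    ultimately show False using rels(1)[OF as'(1,3)] by (auto simp: Z_def)
  qed
qed

lemma large_minimal_degree:
  assumes "CARD('m) * stab_period w < minimal_degree w"
  obtains k n where "k > 0" "\<not> has_degree k" "has_degree (k + minimal_degree w * n)"
    "\<not> minimal_degree w dvd k + minimal_degree w * n"
proof -
  define k where "k = CARD('m) * stab_period w"
  have k: "k > 0" "k < minimal_degree w" using stab_period_pos assms by (simp_all add: k_def)
  obtain \<phi> where phi: "\<phi> \<in> poly_fun" "\<And>c x. c \<noteq> 0 \<Longrightarrow> x \<in> slice \<Longrightarrow> \<phi> (c *s x) = c ^ minimal_degree w"
    using minimal_degree(2) unfolding has_degree_def by blast
  interpret C: cone_slice slice \<phi> "minimal_degree w"
    by unfold_locales (simp_all add: closed_slice phi minimal_degree(1))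
  obtain p n where "p \<in> poly_fun" "\<And>c x. c \<noteq> 0 \<Longrightarrow> x \<in> slice \<Longrightarrow> p (c *s x) = c ^ (k + minimal_degree w * n)"
    using C.exists_semi_invariant[of k] slice_scalars unfolding k_def by metis
  then have "has_degree (k + minimal_degree w * n)" by (rule has_degreeI)
  moreover have "\<not> has_degree k" using minimal_degree(3)[OF k(1)] k(2) by auto
  moreover have "\<not> minimal_degree w dvd k + minimal_degree w * n"
    using k nat_dvd_not_less by (metis dvd_add_left_iff dvd_triv_left)
  ultimately show thesis using that k(1) by blast
qed

end

theorem theorem5p8:
  fixes w :: "complex ^ ('m::finite \<times> 'm \<times> 'm)"
  assumes "w \<noteq> 0" and "polystable w"
  shows
    "let \<Phi> = fundamental_invariant w; R = coord_ring (orbit_closure w); S = powers R \<Phi> in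
       {x \<in> orbit_closure w. \<Phi> x = 0} = boundary w
     \<and> (\<exists>h \<in> ring_iso (localization R S) (regular_ring (orbit w)).
          \<forall>f \<in> carrier R. h (fraction R S f \<one>\<^bsub>R\<^esub>) = restrict f (orbit w))
     \<and> (CARD('m) * stab_period w < minimal_degree w \<longrightarrow>
          PIdl\<^bsub>R\<^esub> \<Phi> \<subset> vanishing_ideal (orbit_closure w) (boundary w)
          \<and> \<not> normal_variety (orbit_closure w)
          \<and> \<not> valuation_ring R)"
proof -
  interpret polystable_tensor w using assms by unfold_locales
  have "PIdl\<^bsub>coord_ring (orbit_closure w)\<^esub> (fundamental_invariant w) \<subset> vanishing_ideal (orbit_closure w) (boundary w)
      \<and> \<not> normal_variety (orbit_closure w) \<and> \<not> valuation_ring (coord_ring (orbit_closure w))"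
    if small: "CARD('m) * stab_period w < minimal_degree w"
  proof -
    obtain k n where "k > 0" "\<not> has_degree k" "has_degree (k + minimal_degree w * n)"
      "\<not> minimal_degree w dvd k + minimal_degree w * n"
      using large_minimal_degree[OF small] by blast
    then show ?thesis using vanishing_ideal_not_principal not_normal_and_not_valuation by blast
  qed
  then show ?thesis
    unfolding Let_def using boundary_eq_zero_set coordinate_ring_iso by blast
qed

end
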